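(* Let $p_0\ge 1$ be a rational number with continued fraction $p_0=[\nu_0,\nu_1,\ldots,\nu_\alpha]$, and let the integers $y_i,z_i,m_i,n_j$, the signs $\epsilon(j)$, and the symmetric matrix $B=2\Theta$ of size $m_{\alpha+1}$ be those attached to $p_0$ as in the context. For each integer $l\ge 0$ put $$V_l^{(p_0)}(q)=\sum_{\lambda}\frac{q^{\frac12\widetilde\lambda B\widetilde\lambda^{t}}}{\prod_{j=1}^{m_{\alpha+1}}\left(q^{\epsilon(j)};q^{\epsilon(j)}\right)_{\lambda_j}},$$ where the sum is over all sequences of non-negative integers $\lambda=(\lambda_1,\ldots,\lambda_{m_{\alpha+1}})$ with $\sum_{k=1}^{m_{\alpha+1}}n_k\lambda_k=l$, and $\widetilde\lambda=(\widetilde\lambda_1,\ldots,\widetilde\lambda_{m_{\alpha+1}})$ with $\widetilde\lambda_j=\epsilon(j)\lambda_j$. Then $$\sum_{l\ge 0}q^{\frac{l^2}{p_0}}V_l^{(p_0)}(q)=1+\sum_{k>0}(-1)^{\frac{1-(-1)^\alpha}{2}k}\,q^{k^2(y_{\alpha+1}+y_\alpha)(z_\alpha+z_{\alpha-1})}\cdot\frac{L_k^{(p_0)}(q)}{(q;q)_k},$$ where $$L_k^{(p_0)}(q)=\sum_{m\ge0}(-1)^m q^{m^2y_\alpha z_{\alpha-1}-km(y_{\alpha+1}z_{\alpha-1}+2y_\alpha z_{\alpha-1}+y_\alpha z_\alpha)+\Delta_\alpha(k,k-m)}\,Q_{k,k-m}^{((-1)^\alpha)}(q),$$ with $$Q_{k,m}^{(\pm1)}(q)=q^{\frac{1\mp1}{2}(k+m)}\left[\begin{array}{c}k-1\\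 m\end{array}\right]_q+q^{\frac{1\pm1}{2}(2k-m)}\left[\begin{array}{c}k-1\\ m-1\end{array}\right]_q,$$ $$\Delta_\alpha(k,m)=\frac{1+(-1)^\alpha}{2}\binom{k-m}{2}+\frac{1-(-1)^\alpha}{2}\binom{m}{2}.$$
   Context: Continued fraction: $[\nu_0,\nu_1,\ldots,\nu_\alpha]=\nu_0+\cfrac{1}{\nu_1+\cfrac{1}{\nu_2+\cdots}}$ with positive integers $\nu_i$, and with $\nu_\alpha\ge 2$ if $\alpha>0$ (so the expansion of $p_0$ is unique). Integer sequences: $y_{-1}=0$, $y_0=1$, $y_1=\nu_0$, $y_{i+1}=y_{i-1}+\nu_i y_i$ for $0\le i\le\alpha$; $z_{-1}=0$, $z_0=1$, $z_1=\nu_1$, $z_{i+1}=z_{i-1}+\nu_{i+1}z_i$ (giving $z_i$ for $-1\le i\le\alpha$); $m_0=0$, $m_1=\nu_0$, $m_{i+1}=m_i+\nu_i$ for $0\le i\le\alpha$. For $1\le j\le m_{\alpha+1}$: $r(j)=i$ if $m_i\le j<m_{i+1}$ with $i\le\alpha$, and $r(m_{\alpha+1})=\alpha+1$; $\epsilon(j)=(-1)^{r(j)}$; and $n_j=y_{i-1}+(j-m_i)y_i$ where $i=r(j)$ (in particular $n_{m_{\alpha+1}}=y_\alpha$). The matrix $\Theta$ is defined through its inverse $\Theta^{-1}=(c_{ij})_{1\le i,j\le m_{\alpha+1}}$, the symmetric tridiagonal matrix ($c_{ij}=c_{ji}$, $c_{ij}=0$ if $|i-j|\ge2$) with $c_{j-1,j}=(-1)^{r(j)-1}$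 for $2\le j\le m_{\alpha+1}$; $c_{jj}=2(-1)^i$ if $m_i\le j<m_{i+1}-1$, $i\le\alpha$; $c_{jj}=(-1)^i$ if $j=m_{i+1}-1$, $i\le\alpha$; $c_{jj}=(-1)^{\alpha+1}$ if $j=m_{\alpha+1}$. (Its determinant has absolute value $y_{\alpha+1}$.) Set $B=2\Theta$. $q$-notation: $(a;x)_n=\prod_{i=0}^{n-1}(1-ax^i)$; $\left[\begin{array}{c}M\\ N\end{array}\right]_q=\dfrac{(q;q)_M}{(q;q)_N(q;q)_{M-N}}$ if $0\le N\le M$, and $0$ otherwise (so the terms of $L_k^{(p_0)}$ with $m>k$ are zero). The identity is one of series in $q$, with rational functions of $q$ (including the factors $1/(q^{-1};q^{-1})_n$) expanded around $q=0$. *)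

theory Defs
  imports
    "HOL-Computational_Algebra.Formal_Laurent_Series"
    "Jordan_Normal_Form.Determinant"
    "Jordan_Normal_Form.Gauss_Jordan_Elimination"
begin

section \<open>Continued fractions and the attached sequences\<close>

fun cfrac :: "(nat \<Rightarrow> nat) \<Rightarrow> nat \<Rightarrow> rat" where
  "cfrac \<nu> 0 = of_nat (\<nu> 0)"
| "cfrac \<nu> (Suc n) = of_nat (\<nu> 0) + 1 / cfrac (\<lambda>i. \<nu> (Suc i)) n"

text \<open>The sequences \<open>y\<close> and \<open>z\<close> start at index \<open>-1\<close>; the recursive auxiliary functions are
  shifted by one, \<open>y_aux \<nu> n\<close> being the entry of index \<open>n - 1\<close>.\<close>

fun y_aux :: "(nat \<Rightarrow> nat) \<Rightarrow> nat \<Rightarrow> nat" where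
  "y_aux \<nu> 0 = 0"
| "y_aux \<nu> (Suc 0) = 1"
| "y_aux \<nu> (Suc (Suc n)) = y_aux \<nu> n + \<nu> n * y_aux \<nu> (Suc n)"

fun z_aux :: "(nat \<Rightarrow> nat) \<Rightarrow> nat \<Rightarrow> nat" where
  "z_aux \<nu> 0 = 0"
| "z_aux \<nu> (Suc 0) = 1"
| "z_aux \<nu> (Suc (Suc n)) = z_aux \<nu> n + \<nu> (Suc n) * z_aux \<nu> (Suc n)"

definition yseq :: "(nat \<Rightarrow> nat) \<Rightarrow> int \<Rightarrow> nat" where
  "yseq \<nu> i = y_aux \<nu> (nat (i + 1))"

definition zseq :: "(nat \<Rightarrow> nat) \<Rightarrow> int \<Rightarrow> nat" where
  "zseq \<nu> i = z_aux \<nu> (nat (i + 1))"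

primrec mseq :: "(nat \<Rightarrow> nat) \<Rightarrow> nat \<Rightarrow> nat" where
  "mseq \<nu> 0 = 0"
| "mseq \<nu> (Suc i) = mseq \<nu> i + \<nu> i"

definition ridx :: "(nat \<Rightarrow> nat) \<Rightarrow> nat \<Rightarrow> nat \<Rightarrow> nat" where
  "ridx \<nu> \<alpha> j =
     (if j = mseq \<nu> (\<alpha> + 1) then \<alpha> + 1
      else (THE i. i \<le> \<alpha> \<and> mseq \<nu> i \<le> j \<and> j < mseq \<nu> (i + 1)))"

definition eps :: "(nat \<Rightarrow> nat) \<Rightarrow> nat \<Rightarrow> nat \<Rightarrow> int" where
  "eps \<nu> \<alpha> j = (-1) ^ ridx \<nu> \<alpha> j"

definition nseq :: "(nat \<Rightarrow> nat) \<Rightarrow> nat \<Rightarrow> nat \<Rightarrow> nat" where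
  "nseq \<nu> \<alpha> j =
     (let i = ridx \<nu> \<alpha> j in yseq \<nu> (int i - 1) + (j - mseq \<nu> i) * yseq \<nu> (int i))"

section \<open>The matrices\<close>

text \<open>Indices run over \<open>1 \<le> i, j \<le> m\<^bsub>\<alpha>+1\<^esub>\<close>. The off-diagonal entry \<open>(-1)\<^bsup>r(j)-1\<^esup>\<close> is written
  with exponent \<open>r(j) + 1\<close>, since \<open>r(j)\<close> may be \<open>0\<close>.\<close>

definition centry :: "(nat \<Rightarrow> nat) \<Rightarrow> nat \<Rightarrow> nat \<Rightarrow> nat \<Rightarrow> int" where
  "centry \<nu> \<alpha> i j =
     (if i = j then
        (if j = mseq \<nu> (\<alpha> + 1) then (-1) ^ (\<alpha> + 1)
         else if j + 1 = mseq \<nu> (ridx \<nu> \<alpha> j + 1) then (-1) ^ ridx \<nu> \<alpha> j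
         else 2 * (-1) ^ ridx \<nu> \<alpha> j)
      else if j = i + 1 then (-1) ^ (ridx \<nu> \<alpha> j + 1)
      else if i = j + 1 then (-1) ^ (ridx \<nu> \<alpha> i + 1)
      else 0)"

text \<open>Matrices and vectors of the library are indexed from \<open>0\<close>, hence the shifts by \<open>Suc\<close>.\<close>

definition Cmat :: "(nat \<Rightarrow> nat) \<Rightarrow> nat \<Rightarrow> rat mat" where
  "Cmat \<nu> \<alpha> = mat (mseq \<nu> (\<alpha> + 1)) (mseq \<nu> (\<alpha> + 1))
     (\<lambda>(i, j). of_int (centry \<nu> \<alpha> (Suc i) (Suc j)))"

definition Theta :: "(nat \<Rightarrow> nat) \<Rightarrow> nat \<Rightarrow> rat mat" where
  "Theta \<nu> \<alpha> = the (mat_inverse (Cmat \<nu> \<alpha>))"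

definition Bmat :: "(nat \<Rightarrow> nat) \<Rightarrow> nat \<Rightarrow> rat mat" where
  "Bmat \<nu> \<alpha> = 2 \<cdot>\<^sub>m Theta \<nu> \<alpha>"

section \<open>Notation for q-series\<close>

definition qpoch :: "'a::field \<Rightarrow> 'a \<Rightarrow> nat \<Rightarrow> 'a" where
  "qpoch a x n = (\<Prod>i<n. 1 - a * x ^ i)"

definition qbinom :: "'a::field \<Rightarrow> int \<Rightarrow> int \<Rightarrow> 'a" where
  "qbinom q M N =
     (if 0 \<le> N \<and> N \<le> M
      then qpoch q q (nat M) / (qpoch q q (nat N) * qpoch q q (nat (M - N)))
      else 0)"

text \<open>Rational powers of \<open>q\<close>: all exponents that occur lie in \<open>(1/y\<^bsub>\<alpha>+1\<^esub>)\<int>\<close> (see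
  \<open>scaled_square_in_Ints\<close> and \<open>scaled_Bform_in_Ints\<close> below), so the series live in the field of
  formal Laurent series in a variable \<open>t\<close> with \<open>q = t ^ y\<^bsub>\<alpha>+1\<^esub>\<close>, and \<open>q\<^bsup>e\<^esup>\<close> is
  \<open>t\<close> to the power \<open>y\<^bsub>\<alpha>+1\<^esub> e\<close>. In the exponents that occur the floor therefore rounds nothing.
  Inverting in this field is expanding around \<open>q = 0\<close>, and infinite sums are taken with respect
  to the library's metric on Laurent series, the \<open>t\<close>-adic one.\<close>

definition qpow :: "(nat \<Rightarrow> nat) \<Rightarrow> nat \<Rightarrow> rat \<Rightarrow> rat fls" where
  "qpow \<nu> \<alpha> e = fls_X powi \<lfloor>of_nat (yseq \<nu> (int \<alpha> + 1)) * e\<rfloor>"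

definition qvar :: "(nat \<Rightarrow> nat) \<Rightarrow> nat \<Rightarrow> rat fls" where
  "qvar \<nu> \<alpha> = qpow \<nu> \<alpha> 1"

section \<open>The two sides\<close>

definition lam_set :: "(nat \<Rightarrow> nat) \<Rightarrow> nat \<Rightarrow> nat \<Rightarrow> (nat \<Rightarrow> nat) set" where
  "lam_set \<nu> \<alpha> l =
     {lam \<in> {1..mseq \<nu> (\<alpha> + 1)} \<rightarrow>\<^sub>E UNIV.
        (\<Sum>k = 1..mseq \<nu> (\<alpha> + 1). nseq \<nu> \<alpha> k * lam k) = l}"

definition lam_tilde :: "(nat \<Rightarrow> nat) \<Rightarrow> nat \<Rightarrow> (nat \<Rightarrow> nat) \<Rightarrow> rat vec" where
  "lam_tilde \<nu> \<alpha> lam =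
     vec (mseq \<nu> (\<alpha> + 1)) (\<lambda>j. of_int (eps \<nu> \<alpha> (Suc j)) * of_nat (lam (Suc j)))"

definition Bform :: "(nat \<Rightarrow> nat) \<Rightarrow> nat \<Rightarrow> (nat \<Rightarrow> nat) \<Rightarrow> rat" where
  "Bform \<nu> \<alpha> lam =
     lam_tilde \<nu> \<alpha> lam \<bullet> (Bmat \<nu> \<alpha> *\<^sub>v lam_tilde \<nu> \<alpha> lam)"

definition Vser :: "(nat \<Rightarrow> nat) \<Rightarrow> nat \<Rightarrow> nat \<Rightarrow> rat fls" where
  "Vser \<nu> \<alpha> l =
     (\<Sum>lam \<in> lam_set \<nu> \<alpha> l.
        qpow \<nu> \<alpha> (1 / 2 * Bform \<nu> \<alpha> lam) /
        (\<Prod>j = 1..mseq \<nu> (\<alpha> + 1).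
           qpoch (qvar \<nu> \<alpha> powi eps \<nu> \<alpha> j) (qvar \<nu> \<alpha> powi eps \<nu> \<alpha> j) (lam j)))"

text \<open>The sign \<open>s\<close> is \<open>1\<close> or \<open>-1\<close>, so that the halved integers below are even.\<close>

definition Qpoly :: "int \<Rightarrow> 'a::field \<Rightarrow> int \<Rightarrow> int \<Rightarrow> 'a" where
  "Qpoly s q k m =
     q powi ((1 - s) div 2 * (k + m)) * qbinom q (k - 1) m
     + q powi ((1 + s) div 2 * (2 * k - m)) * qbinom q (k - 1) (m - 1)"

text \<open>Only used with \<open>0 \<le> m \<le> k\<close>, where the truncations by \<open>nat\<close> are vacuous.\<close>

definition Delta :: "nat \<Rightarrow> int \<Rightarrow> int \<Rightarrow> int" where
  "Delta \<alpha> k m =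
     (1 + (-1) ^ \<alpha>) div 2 * int (nat (k - m) choose 2)
     + (1 - (-1) ^ \<alpha>) div 2 * int (nat m choose 2)"

text \<open>The terms of the series \<open>Lser\<close> with \<open>m > k\<close> vanish, see \<open>Qpoly_eq_0\<close>.\<close>

definition Lser :: "(nat \<Rightarrow> nat) \<Rightarrow> nat \<Rightarrow> 'a::field \<Rightarrow> nat \<Rightarrow> 'a" where
  "Lser \<nu> \<alpha> q k =
     (let y = (\<lambda>i. int (yseq \<nu> i)); z = (\<lambda>i. int (zseq \<nu> i)); a = int \<alpha> in
      \<Sum>m\<le>k. (-1) ^ m *
        q powi ((int m)\<^sup>2 * y a * z (a - 1)
                - int k * int m * (y (a + 1) * z (a - 1) + 2 * y a * z (a - 1) + y a * z a)
                + Delta \<alpha> (int k) (int k - int m)) *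
        Qpoly ((-1) ^ \<alpha>) q (int k) (int k - int m))"

lemma Qpoly_eq_0: "m > k \<Longrightarrow> Qpoly s q (int k) (int k - int m) = 0"
  by (simp add: Qpoly_def qbinom_def)

section \<open>Well-definedness\<close>

text \<open>The sets \<open>lam_set\<close> are finite, \<open>Cmat\<close> is invertible with two-sided inverse \<open>Theta\<close>
  and determinant \<open>y\<^bsub>\<alpha>+1\<^esub>\<close> up to sign, and \<open>qpow\<close> is applied to no exponent
  that is rounded.\<close>

subsection \<open>The ranges of summation are finite\<close>

lemma mseq_mono: "i \<le> k \<Longrightarrow> mseq \<nu> i \<le> mseq \<nu> k"
  by (induction k) (auto simp: le_Suc_eq)

lemma mseq_cover: "j < mseq \<nu> (Suc \<alpha>) \<Longrightarrow> \<exists>i\<le>\<alpha>. mseq \<nu> i \<le> j \<and> j < mseq \<nu> (Suc i)"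
proof (induction \<alpha>)
  case (Suc \<alpha>)
  show ?case
  proof (cases "j < mseq \<nu> (Suc \<alpha>)")
    case True
    then show ?thesis using Suc.IH by (meson le_SucI)
  next
    case False
    then show ?thesis using Suc.prems by (intro exI[of _ "Suc \<alpha>"]) auto
  qed
qed auto

lemma ridx_eqI:
  assumes "i \<le> \<alpha>" "mseq \<nu> i \<le> j" "j < mseq \<nu> (Suc i)"
  shows "ridx \<nu> \<alpha> j = i"
proof -
  have "mseq \<nu> (Suc i) \<le> mseq \<nu> (Suc \<alpha>)" using assms by (intro mseq_mono) auto
  then have "j \<noteq> mseq \<nu> (\<alpha> + 1)" using assms(3) by simp
  moreover have "(THE i. i \<le> \<alpha> \<and> mseq \<nu> i \<le> j \<and> j < mseq \<nu> (i + 1)) = i"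
  proof (rule the_equality)
    show "i \<le> \<alpha> \<and> mseq \<nu> i \<le> j \<and> j < mseq \<nu> (i + 1)" using assms by simp
  next
    fix i' assume i': "i' \<le> \<alpha> \<and> mseq \<nu> i' \<le> j \<and> j < mseq \<nu> (i' + 1)"
    show "i' = i"
    proof (rule ccontr)
      assume "i' \<noteq> i"
      then have "Suc i' \<le> i \<or> Suc i \<le> i'" by auto
      then show False
        using i' assms mseq_mono[of "Suc i'" i \<nu>] mseq_mono[of "Suc i" i' \<nu>] by auto
    qed
  qed
  ultimately show ?thesis unfolding ridx_def by simp
qed

lemma ridx_last: "ridx \<nu> \<alpha> (mseq \<nu> (Suc \<alpha>)) = Suc \<alpha>"
  by (simp add: ridx_def)

lemma y_aux_pos: "\<forall>i<n. \<nu> i \<ge> 1 \<Longrightarrow> y_aux \<nu> (Suc n) > 0"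
  by (induction n) auto

lemma nseq_pos:
  assumes "\<forall>i\<le>\<alpha>. \<nu> i \<ge> 1" "1 \<le> j" "j \<le> mseq \<nu> (Suc \<alpha>)"
  shows "nseq \<nu> \<alpha> j > 0"
proof (cases "j = mseq \<nu> (Suc \<alpha>)")
  case True
  then show ?thesis using assms y_aux_pos[of \<alpha> \<nu>]
    by (simp add: nseq_def ridx_last yseq_def nat_add_distrib Let_def del: mseq.simps)
next
  case False
  then obtain i where i: "i \<le> \<alpha>" "mseq \<nu> i \<le> j" "j < mseq \<nu> (Suc i)"
    using mseq_cover[of j \<nu> \<alpha>] assms by auto
  show ?thesis
  proof (cases i)
    case 0
    then show ?thesis using i ridx_eqI[OF i] assms by (simp add: nseq_def yseq_def)
  next
    case (Suc i')
    then show ?thesis using i ridx_eqI[OF i] assms y_aux_pos[of i' \<nu>]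
      by (simp add: nseq_def yseq_def nat_add_distrib)
  qed
qed

lemma finite_lam_set:
  assumes "\<forall>i\<le>\<alpha>. \<nu> i \<ge> 1"
  shows "finite (lam_set \<nu> \<alpha> l)"
proof (rule finite_subset)
  let ?I = "{1..mseq \<nu> (\<alpha> + 1)}"
  show "finite (?I \<rightarrow>\<^sub>E {..l})" by (intro finite_PiE) auto
  show "lam_set \<nu> \<alpha> l \<subseteq> (?I \<rightarrow>\<^sub>E {..l})"
  proof
    fix lam assume lam: "lam \<in> lam_set \<nu> \<alpha> l"
    have "lam k \<le> l" if k: "k \<in> ?I" for k
    proof -
      have "lam k \<le> nseq \<nu> \<alpha> k * lam k" using nseq_pos[OF assms, of k] k by auto
      also have "\<dots> \<le> (\<Sum>k\<in>?I. nseq \<nu> \<alpha> k * lam k)" using k by (intro member_le_sum) auto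
      finally show ?thesis using lam by (simp add: lam_set_def)
    qed
    then show "lam \<in> (?I \<rightarrow>\<^sub>E {..l})" using lam by (auto simp: lam_set_def PiE_def Pi_def)
  qed
qed

subsection \<open>The rational exponents of \<open>q\<close> have denominators dividing \<open>y\<^bsub>\<alpha>+1\<^esub>\<close>\<close>

lemma z_aux_shift: "z_aux \<nu> n = y_aux (\<lambda>i. \<nu> (Suc i)) n"
  by (induction \<nu> n rule: z_aux.induct) auto

lemma y_aux_shift:
  "y_aux \<nu> (Suc (Suc n)) = \<nu> 0 * z_aux \<nu> (Suc n) + z_aux (\<lambda>i. \<nu> (Suc i)) n"
proof (induction n rule: induct_nat_012)
  case (ge2 n)
  show ?case
    using ge2 y_aux.simps(3)[of \<nu> "Suc (Suc n)"] z_aux.simps(3)[of \<nu> "Suc n"]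
      z_aux.simps(3)[of "\<lambda>i. \<nu> (Suc i)" n]
    by (simp only: algebra_simps)
qed auto

lemma cfrac_eq:
  assumes "\<forall>i\<le>\<alpha>. \<nu> i \<ge> 1"
  shows "cfrac \<nu> \<alpha> = of_nat (yseq \<nu> (int \<alpha> + 1)) / of_nat (zseq \<nu> (int \<alpha>))"
proof -
  have "cfrac \<nu> \<alpha> = of_nat (y_aux \<nu> (Suc (Suc \<alpha>))) / of_nat (z_aux \<nu> (Suc \<alpha>))"
    using assms
  proof (induction \<nu> \<alpha> rule: cfrac.induct)
    case (2 \<nu> n)
    let ?\<nu>' = "\<lambda>i. \<nu> (Suc i)"
    have "z_aux \<nu> (Suc (Suc n)) > 0"
      unfolding z_aux_shift using 2(2) by (intro y_aux_pos) auto
    moreover have "cfrac ?\<nu>' n = of_nat (z_aux \<nu> (Suc (Suc n))) / of_nat (z_aux ?\<nu>' (Suc n))"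
      using 2 unfolding z_aux_shift[of \<nu>] by auto
    ultimately show ?case
      unfolding y_aux_shift[of \<nu> "Suc n"] cfrac.simps(2)
      by (simp add: field_simps del: z_aux.simps(3))
  qed auto
  moreover have "nat (int \<alpha> + 1 + 1) = Suc (Suc \<alpha>)" "nat (int \<alpha> + 1) = Suc \<alpha>" by auto
  ultimately show ?thesis by (simp only: yseq_def zseq_def)
qed

lemma scaled_square_in_Ints:
  assumes "\<forall>i\<le>\<alpha>. \<nu> i \<ge> 1"
  shows "of_nat (yseq \<nu> (int \<alpha> + 1)) * ((of_nat l)\<^sup>2 / cfrac \<nu> \<alpha>) \<in> \<int>"
proof -
  have "nat (int \<alpha> + 1 + 1) = Suc (Suc \<alpha>)" by auto
  then have "yseq \<nu> (int \<alpha> + 1) > 0"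
    using y_aux_pos[of "Suc \<alpha>" \<nu>] assms by (simp only: yseq_def) auto
  then have "of_nat (yseq \<nu> (int \<alpha> + 1)) * ((of_nat l)\<^sup>2 / cfrac \<nu> \<alpha>)
      = of_nat (l\<^sup>2 * zseq \<nu> (int \<alpha>))"
    unfolding cfrac_eq[OF assms] by simp
  then show ?thesis by simp
qed

lemma det_tridiagonal:
  fixes c :: "nat \<Rightarrow> nat \<Rightarrow> int"
  assumes c: "\<And>i j. i + 2 \<le> j \<or> j + 2 \<le> i \<Longrightarrow> c i j = 0"
  defines "A \<equiv> \<lambda>n. mat n n (\<lambda>(i, j). c i j)"
  shows "det (A (Suc (Suc n))) =
    c (Suc n) (Suc n) * det (A (Suc n)) - c (Suc n) n * c n (Suc n) * det (A n)"
proof -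
  let ?A = "A (Suc (Suc n))"
  let ?B = "mat_delete ?A (Suc n) n"
  have carr: "?A \<in> carrier_mat (Suc (Suc n)) (Suc (Suc n))" by (simp add: A_def)
  have carrB: "?B \<in> carrier_mat (Suc n) (Suc n)" using carr by (simp add: mat_delete_def A_def)
  have *: "mat_delete ?A (Suc n) (Suc n) = A (Suc n)" "mat_delete ?B n n = A n"
    by (auto simp: mat_delete_def A_def intro!: eq_matI)
  have "det ?B = (\<Sum>i<Suc n. ?B $$ (i, n) * cofactor ?B i n)"
    by (rule laplace_expansion_column[OF carrB]) auto
  also have "\<dots> = c n (Suc n) * cofactor ?B n n"
    by (simp add: mat_delete_def A_def c)
  finally have B: "det ?B = c n (Suc n) * det (A n)" by (simp add: cofactor_def *)
  have "det ?A = (\<Sum>j<Suc (Suc n). ?A $$ (Suc n, j) * cofactor ?A (Suc n) j)"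
    by (rule laplace_expansion_row[OF carr]) auto
  also have "\<dots> = c (Suc n) n * cofactor ?A (Suc n) n
      + c (Suc n) (Suc n) * cofactor ?A (Suc n) (Suc n)"
    by (simp add: A_def c)
  finally show ?thesis by (simp add: cofactor_def * B)
qed

definition Cint :: "(nat \<Rightarrow> nat) \<Rightarrow> nat \<Rightarrow> nat \<Rightarrow> int mat" where
  "Cint \<nu> \<alpha> n = mat n n (\<lambda>(i, j). centry \<nu> \<alpha> (Suc i) (Suc j))"

text \<open>Leading principal minors, shifted by one.\<close>

fun lead_minor :: "(nat \<Rightarrow> nat) \<Rightarrow> nat \<Rightarrow> nat \<Rightarrow> int" where
  "lead_minor \<nu> \<alpha> 0 = 0"
| "lead_minor \<nu> \<alpha> (Suc 0) = 1"
| "lead_minor \<nu> \<alpha> (Suc (Suc n)) =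
     centry \<nu> \<alpha> (Suc n) (Suc n) * lead_minor \<nu> \<alpha> (Suc n) - lead_minor \<nu> \<alpha> n"

lemma det_Cint: "det (Cint \<nu> \<alpha> n) = lead_minor \<nu> \<alpha> (Suc n)"
proof (induction n rule: induct_nat_012)
  case 0
  show ?case by (simp add: Cint_def)
next
  case 1
  show ?case by (simp add: Cint_def det_single)
next
  case (ge2 n)
  have sq: "centry \<nu> \<alpha> (Suc (Suc n)) (Suc n) * centry \<nu> \<alpha> (Suc n) (Suc (Suc n)) = 1"
    by (simp add: centry_def flip: power_mult_distrib)
  have off: "centry \<nu> \<alpha> (Suc i) (Suc j) = 0" if "i + 2 \<le> j \<or> j + 2 \<le> i" for i j
    using that unfolding centry_def by auto
  have "det (Cint \<nu> \<alpha> (Suc (Suc n))) =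
    centry \<nu> \<alpha> (Suc (Suc n)) (Suc (Suc n)) * det (Cint \<nu> \<alpha> (Suc n)) - 1 * det (Cint \<nu> \<alpha> n)"
    unfolding Cint_def
    using det_tridiagonal[of "\<lambda>i j. centry \<nu> \<alpha> (Suc i) (Suc j)" n, OF off] unfolding sq .
  then show ?case using ge2 by simp
qed

lemma minor_block_aux:
  assumes i: "i \<le> \<alpha>" and s: "s = (-1) ^ i"
    and c0: "lead_minor \<nu> \<alpha> (mseq \<nu> i) = \<sigma> * y0"
    and c1: "\<nu> i \<ge> 2 \<Longrightarrow> lead_minor \<nu> \<alpha> (Suc (mseq \<nu> i)) = \<sigma> * s * (y0 + y1)"
    and n: "n < \<nu> i"
  shows "lead_minor \<nu> \<alpha> (mseq \<nu> i + n) = \<sigma> * s ^ n * (y0 + int n * y1)"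
  using n
proof (induction n rule: induct_nat_012)
  case (ge2 n)
  let ?j = "mseq \<nu> i + Suc n"
  have ss: "s * s = 1" by (simp add: s flip: power_mult_distrib)
  have lt: "?j + 1 < mseq \<nu> (Suc i)" using ge2.prems by simp
  also have "\<dots> \<le> mseq \<nu> (Suc \<alpha>)" using i by (intro mseq_mono) auto
  finally have "centry \<nu> \<alpha> ?j ?j = 2 * s"
    using lt ridx_eqI[OF i, of \<nu> ?j] by (auto simp: centry_def s)
  then have "lead_minor \<nu> \<alpha> (mseq \<nu> i + Suc (Suc n)) =
      2 * s * lead_minor \<nu> \<alpha> (mseq \<nu> i + Suc n) - lead_minor \<nu> \<alpha> (mseq \<nu> i + n)" by simp
  also have "\<dots> = \<sigma> * s ^ n * (2 * (s * s) * (y0 + int (Suc n) * y1) - (y0 + int n * y1))"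
    using ge2 by (simp add: algebra_simps)
  also have "\<dots> = \<sigma> * s ^ n * (s * s) * (y0 + int (Suc (Suc n)) * y1)"
    unfolding ss by (simp add: algebra_simps)
  finally show ?case by (simp add: algebra_simps)
next
  case 0
  then show ?case using c0 by simp
next
  case 1
  then show ?case using c1 by simp
qed

lemma minor_step:
  assumes nu: "\<forall>i\<le>\<alpha>. \<nu> i \<ge> 1" and i: "i \<le> \<alpha>"
  shows "\<exists>\<sigma>. \<sigma> \<in> {1, -1} \<and>
    lead_minor \<nu> \<alpha> (mseq \<nu> (Suc i)) = \<sigma> * int (y_aux \<nu> (Suc i)) \<and>
    lead_minor \<nu> \<alpha> (mseq \<nu> (Suc i) - 1) =
      (-1) ^ i * \<sigma> * (int (y_aux \<nu> (Suc (Suc i))) - int (y_aux \<nu> (Suc i)))"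
  using i
proof (induction i)
  case 0
  have b: "lead_minor \<nu> \<alpha> n = int n" if "n < \<nu> 0" for n
    using minor_block_aux[of 0 \<alpha> 1 \<nu> 1 0 1 n] that by simp
  obtain n where n: "\<nu> 0 = Suc n" using nu by (metis le0 not_one_le_zero not0_implies_Suc)
  have e: "lead_minor \<nu> \<alpha> (Suc n) = 1"
  proof (cases n)
    case (Suc n')
    have le: "Suc n' + 1 \<le> mseq \<nu> (Suc \<alpha>)"
      using mseq_mono[of "Suc 0" "Suc \<alpha>" \<nu>] n Suc by simp
    have "centry \<nu> \<alpha> (Suc n') (Suc n') = 1"
      using le ridx_eqI[of 0 \<alpha> \<nu> "Suc n'"] n Suc by (auto simp: centry_def)
    then show ?thesis using b[of n] b[of n'] n Suc by simp
  qed simp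
  then show ?case using b[of n] n by (intro exI[of _ 1]) simp
next
  case (Suc i)
  define s :: int where "s = (-1) ^ Suc i"
  have ss: "s * s = 1" by (simp add: s_def flip: power_mult_distrib)
  let ?y0 = "int (y_aux \<nu> (Suc i))" and ?y1 = "int (y_aux \<nu> (Suc (Suc i)))"
  let ?m = "mseq \<nu> (Suc i)"
  obtain \<sigma> where sg: "\<sigma> \<in> {1, -1}" and h0: "lead_minor \<nu> \<alpha> ?m = \<sigma> * ?y0"
    and h1: "lead_minor \<nu> \<alpha> (?m - 1) = - s * \<sigma> * (?y1 - ?y0)"
    using Suc.IH Suc.prems unfolding s_def by auto
  have "\<nu> 0 \<ge> 1" using nu by blast
  then have mpos: "?m > 0" using mseq_mono[of 1 "Suc i" \<nu>] by (simp del: mseq.simps(2) add: mseq.simps(2)[of _ 0])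
  then obtain m' where m': "?m = Suc m'" by (metis not0_implies_Suc not_gr_zero)
  have rec: "lead_minor \<nu> \<alpha> (Suc ?m) = centry \<nu> \<alpha> ?m ?m * lead_minor \<nu> \<alpha> ?m - lead_minor \<nu> \<alpha> (?m - 1)"
    unfolding m' by simp
  obtain n where n: "\<nu> (Suc i) = Suc n"
    using nu Suc.prems by (metis not_one_le_zero not0_implies_Suc)
  have le: "mseq \<nu> (Suc (Suc i)) \<le> mseq \<nu> (Suc \<alpha>)" using Suc.prems by (intro mseq_mono) auto
  have rk: "ridx \<nu> \<alpha> (?m + k) = Suc i" if "k < \<nu> (Suc i)" for k
    using that Suc.prems by (intro ridx_eqI) auto
  have cm: "centry \<nu> \<alpha> (?m + k) (?m + k) = (if k = n then s else 2 * s)" if "k \<le> n" for k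
    using that rk[of k] le n by (auto simp: centry_def s_def)
  have b: "lead_minor \<nu> \<alpha> (?m + k) = \<sigma> * s ^ k * (?y0 + int k * ?y1)" if "k \<le> n" for k
  proof (rule minor_block_aux[OF Suc.prems s_def h0])
    assume "2 \<le> \<nu> (Suc i)"
    then have "centry \<nu> \<alpha> ?m ?m = 2 * s" using cm[of 0] n by simp
    then show "lead_minor \<nu> \<alpha> (Suc ?m) = \<sigma> * s * (?y0 + ?y1)"
      unfolding rec h0 h1 by (simp add: algebra_simps)
  qed (use that n in simp)
  have e: "lead_minor \<nu> \<alpha> (?m + Suc n) = \<sigma> * s ^ Suc n * ?y1"
  proof (cases n)
    case 0
    then have "centry \<nu> \<alpha> ?m ?m = s" using cm[of 0] by simp
    then show ?thesis using rec 0 unfolding h0 h1 by (simp add: algebra_simps)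
  next
    case (Suc n')
    have "lead_minor \<nu> \<alpha> (?m + Suc (Suc n')) = s * lead_minor \<nu> \<alpha> (?m + n) - lead_minor \<nu> \<alpha> (?m + n')"
      using cm[of n] Suc by simp
    also have "\<dots> = \<sigma> * s ^ n' * (s * s * (?y0 + int n * ?y1) - (?y0 + int n' * ?y1))"
      using b[of n] b[of n'] Suc by (simp add: algebra_simps)
    also have "\<dots> = \<sigma> * s ^ n' * (s * s) * ?y1"
      unfolding ss using Suc by (simp add: algebra_simps)
    finally show ?thesis using Suc by (simp add: algebra_simps)
  qed
  have "lead_minor \<nu> \<alpha> (?m + n) = s * (\<sigma> * s ^ Suc n) * (?y0 + int n * ?y1)"
  proof -
    have "s * (\<sigma> * s ^ Suc n) = s * s * (\<sigma> * s ^ n)" by simp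
    then show ?thesis using b[of n] unfolding ss by simp
  qed
  moreover have "\<sigma> * s ^ Suc n \<in> {1, -1}"
    using sg power_mult[of "-1 :: int" "Suc i" "Suc n"] minus_one_power_iff[of "Suc i * Suc n", where 'a = int]
    by (auto simp: s_def split: if_splits)
  ultimately show ?case using e n
    by (intro exI[of _ "\<sigma> * s ^ Suc n"]) (simp add: s_def algebra_simps)
qed

lemma abs_det_Cint:
  assumes nu: "\<forall>i\<le>\<alpha>. \<nu> i \<ge> 1"
  shows "\<bar>det (Cint \<nu> \<alpha> (mseq \<nu> (Suc \<alpha>)))\<bar> = int (yseq \<nu> (int \<alpha> + 1))"
proof -
  let ?m = "mseq \<nu> (Suc \<alpha>)"
  obtain \<sigma> where sg: "\<sigma> \<in> {1, -1}"
    and h0: "lead_minor \<nu> \<alpha> ?m = \<sigma> * int (y_aux \<nu> (Suc \<alpha>))"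
    and h1: "lead_minor \<nu> \<alpha> (?m - 1) =
      (-1) ^ \<alpha> * \<sigma> * (int (y_aux \<nu> (Suc (Suc \<alpha>))) - int (y_aux \<nu> (Suc \<alpha>)))"
    using minor_step[OF nu, of \<alpha>] by auto
  have "\<nu> 0 \<ge> 1" using nu by blast
  then have "?m > 0" using mseq_mono[of 1 "Suc \<alpha>" \<nu>] by (simp del: mseq.simps(2) add: mseq.simps(2)[of _ 0])
  then obtain m' where m': "?m = Suc m'" by (metis not0_implies_Suc not_gr_zero)
  have c: "centry \<nu> \<alpha> ?m ?m = - ((-1) ^ \<alpha>)" by (simp add: centry_def)
  have "lead_minor \<nu> \<alpha> (Suc ?m) = centry \<nu> \<alpha> ?m ?m * lead_minor \<nu> \<alpha> ?m - lead_minor \<nu> \<alpha> (?m - 1)"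
    unfolding m' by simp
  also have "\<dots> = - ((-1) ^ \<alpha> * \<sigma> * int (y_aux \<nu> (Suc (Suc \<alpha>))))"
    unfolding c h0 h1 by (simp add: algebra_simps)
  finally have "det (Cint \<nu> \<alpha> ?m) = - ((-1) ^ \<alpha> * \<sigma> * int (y_aux \<nu> (Suc (Suc \<alpha>))))"
    by (simp only: det_Cint)
  moreover have "nat (int \<alpha> + 1 + 1) = Suc (Suc \<alpha>)" by auto
  ultimately show ?thesis using sg unfolding yseq_def
    by (auto simp: abs_mult simp del: y_aux.simps)
qed

lemma Cmat_eq: "Cmat \<nu> \<alpha> = map_mat of_int (Cint \<nu> \<alpha> (mseq \<nu> (Suc \<alpha>)))"
  by (auto simp: Cmat_def Cint_def)

lemma yseq_last_pos:
  assumes "\<forall>i\<le>\<alpha>. \<nu> i \<ge> 1"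
  shows "yseq \<nu> (int \<alpha> + 1) > 0"
proof -
  have "nat (int \<alpha> + 1 + 1) = Suc (Suc \<alpha>)" by auto
  then show ?thesis using y_aux_pos[of "Suc \<alpha>" \<nu>] assms by (simp only: yseq_def) auto
qed

lemma Theta_eq:
  assumes nu: "\<forall>i\<le>\<alpha>. \<nu> i \<ge> 1"
  defines "C \<equiv> Cint \<nu> \<alpha> (mseq \<nu> (Suc \<alpha>))"
  shows "Theta \<nu> \<alpha> = (1 / of_int (det C)) \<cdot>\<^sub>m map_mat of_int (adj_mat C)"
    and "Cmat \<nu> \<alpha> * Theta \<nu> \<alpha> = 1\<^sub>m (mseq \<nu> (Suc \<alpha>))"
    and "Theta \<nu> \<alpha> * Cmat \<nu> \<alpha> = 1\<^sub>m (mseq \<nu> (Suc \<alpha>))"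
    and "Theta \<nu> \<alpha> \<in> carrier_mat (mseq \<nu> (Suc \<alpha>)) (mseq \<nu> (Suc \<alpha>))"
proof -
  let ?n = "mseq \<nu> (Suc \<alpha>)"
  let ?T = "(1 / of_int (det C)) \<cdot>\<^sub>m map_mat of_int (adj_mat C) :: rat mat"
  have C: "C \<in> carrier_mat ?n ?n" by (simp add: C_def Cint_def)
  have d0: "det C \<noteq> 0"
    using abs_det_Cint[OF nu] yseq_last_pos[OF nu] by (auto simp: C_def)
  note adj = adj_mat[OF C]
  have eq: "map_mat of_int (adj_mat C) * Cmat \<nu> \<alpha> = (of_int (det C) :: rat) \<cdot>\<^sub>m 1\<^sub>m ?n"
    "Cmat \<nu> \<alpha> * map_mat of_int (adj_mat C) = (of_int (det C) :: rat) \<cdot>\<^sub>m 1\<^sub>m ?n"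
  proof -
    have "map_mat of_int (det C \<cdot>\<^sub>m 1\<^sub>m ?n) = (of_int (det C) :: rat) \<cdot>\<^sub>m 1\<^sub>m ?n"
      by (intro eq_matI) auto
    then show "map_mat of_int (adj_mat C) * Cmat \<nu> \<alpha> = (of_int (det C) :: rat) \<cdot>\<^sub>m 1\<^sub>m ?n"
      "Cmat \<nu> \<alpha> * map_mat of_int (adj_mat C) = (of_int (det C) :: rat) \<cdot>\<^sub>m 1\<^sub>m ?n"
      unfolding Cmat_eq C_def[symmetric]
      by (simp_all only: adj(2,3) flip: of_int_hom.mat_hom_mult[OF adj(1) C]
            of_int_hom.mat_hom_mult[OF C adj(1)])
  qed
  have CC: "Cmat \<nu> \<alpha> \<in> carrier_mat ?n ?n" by (simp add: Cmat_def)
  have T: "?T \<in> carrier_mat ?n ?n" using adj(1) by simp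
  have TC: "?T * Cmat \<nu> \<alpha> = 1\<^sub>m ?n"
    using eq(1) d0 adj(1) CC by (subst mult_smult_assoc_mat[of _ ?n ?n _ ?n]) (auto intro!: eq_matI)
  have CT: "Cmat \<nu> \<alpha> * ?T = 1\<^sub>m ?n"
    using eq(2) d0 adj(1) CC by (subst mult_smult_distrib[of _ ?n ?n _ ?n]) (auto intro!: eq_matI)
  have "mat_inverse (Cmat \<nu> \<alpha>) \<noteq> None"
  proof
    assume "mat_inverse (Cmat \<nu> \<alpha>) = None"
    from mat_inverse(1)[OF CC this] show False
      using CC T TC CT by (auto simp: Units_def ring_mat_def)
  qed
  then obtain S where S: "mat_inverse (Cmat \<nu> \<alpha>) = Some S" by auto
  note S' = mat_inverse(2)[OF CC S]
  have "S = S * (Cmat \<nu> \<alpha> * ?T)" unfolding CT using S' right_mult_one_mat[of S ?n ?n] by metis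
  also have "\<dots> = (S * Cmat \<nu> \<alpha>) * ?T" using S' CC T by (intro assoc_mult_mat[symmetric]) auto
  also have "\<dots> = ?T" using S' T left_mult_one_mat[of ?T ?n ?n] by metis
  finally have "S = ?T" .
  then show "Theta \<nu> \<alpha> = ?T" using S by (simp add: Theta_def)
  with CT TC T show "Cmat \<nu> \<alpha> * Theta \<nu> \<alpha> = 1\<^sub>m ?n" "Theta \<nu> \<alpha> * Cmat \<nu> \<alpha> = 1\<^sub>m ?n"
    "Theta \<nu> \<alpha> \<in> carrier_mat ?n ?n" by simp_all
qed

lemma scaled_Bform_in_Ints:
  assumes nu: "\<forall>i\<le>\<alpha>. \<nu> i \<ge> 1"
  shows "of_nat (yseq \<nu> (int \<alpha> + 1)) * (1 / 2 * Bform \<nu> \<alpha> lam) \<in> \<int>"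
proof -
  let ?n = "mseq \<nu> (Suc \<alpha>)"
  let ?y = "of_nat (yseq \<nu> (int \<alpha> + 1)) :: rat"
  let ?C = "Cint \<nu> \<alpha> ?n"
  let ?v = "lam_tilde \<nu> \<alpha> lam"
  have y: "?y \<noteq> 0" using yseq_last_pos[OF nu] by simp
  have Tc: "Theta \<nu> \<alpha> \<in> carrier_mat ?n ?n" by (rule Theta_eq(4)[OF nu])
  have "of_int \<bar>det ?C\<bar> = ?y" using abs_det_Cint[OF nu] by simp
  then have yd: "?y / of_int (det ?C) \<in> {1, -1}"
    using y by (auto simp: abs_if field_simps split: if_splits)
  have ent: "?y * Theta \<nu> \<alpha> $$ (i, j) \<in> \<int>" if "i < ?n" "j < ?n" for i j
  proof -
    have "?y * Theta \<nu> \<alpha> $$ (i, j) = ?y / of_int (det ?C) * of_int (adj_mat ?C $$ (i, j))"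
      unfolding Theta_eq(1)[OF nu] using that by (simp add: adj_mat_def Cint_def)
    moreover have "?y / of_int (det ?C) \<in> \<int>" using yd by (metis Ints_1 Ints_minus empty_iff insert_iff)
    ultimately show ?thesis by (simp only: Ints_mult Ints_of_int)
  qed
  have vi: "?v $ i \<in> \<int>" if "i < ?n" for i using that by (simp add: lam_tilde_def)
  have "?y * (1 / 2 * Bform \<nu> \<alpha> lam) =
      (\<Sum>i<?n. \<Sum>j<?n. ?v $ i * (?y * Theta \<nu> \<alpha> $$ (i, j)) * ?v $ j)"
    using Tc unfolding Bform_def Bmat_def
    by (simp add: scalar_prod_def lam_tilde_def sum_distrib_left sum_distrib_right
        atLeast0LessThan mult_ac row_def)
  also have "\<dots> \<in> \<int>" by (intro Ints_sum Ints_mult[OF Ints_mult] ent vi) auto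
  finally show ?thesis .
qed

end

theory Submission
  imports Defs
begin

text \<open>
  Let \<open>n\<close> and \<open>w\<close> be the weights of the variables \<open>\<lambda>\<^sub>j\<close> attached to the sequences \<open>y\<close> and \<open>z\<close>, and let
  \<open>W(u, v)\<close> be the part of \<open>q\<^bsup>l\<^sup>2/p\<^esup> V\<^sub>l(q)\<close>, \<open>l = u + v\<close>, in which \<open>w\<cdot>\<lambda> = v\<close>. Every continued
  fraction is obtained from \<open>[1]\<close> by the moves \<open>p \<mapsto> p + 1\<close> and \<open>p \<mapsto> p / (p - 1)\<close>. The first
  adds one variable and completes a square, the second changes the sign of the matrix and of all
  \<open>\<epsilon>(j)\<close>. On the refined sums they act by
  \<^item> \<open>W'(u, v) = q\<^bsup>v\<^sup>2\<^esup> (\<Sum>M. W(u - M, M) / (q)\<^bsub>v-M\<^esub>)\<close> (\<open>energy_raise\<close>, \<open>refined_raise\<close>), which is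
    a step of Bailey's chain, and
  \<^item> \<open>W'(u, v) = q\<^bsup>(u+v)\<^sup>2\<^esup> W(v, u)\<close> with \<open>q\<close> inverted on the right (\<open>energy_reflect\<close>,
    \<open>refined_reflect\<close>).

  There is a family of functions \<open>K\<^bsub>r,c\<^esub>(u, v)\<close>, the coefficients of Bailey's kernel in its
  parameter, which these two operations permute: the first sends \<open>K\<^bsub>r,c\<^esub>\<close> to \<open>K\<^bsub>r,c+r\<^esub>\<close>
  (\<open>kern_step\<close>), the second to \<open>K\<^bsub>c,r\<^esub>\<close> (\<open>kern_flip\<close>). So an expansion of \<open>W\<close> in this family
  is known for all continued fractions once it is known for \<open>[1]\<close>. The refined sum of \<open>[1]\<close>
  is in turn the image of the unit mass at \<open>(0, 0)\<close> under the two operations, and the expansion of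
  the unit mass is elementary, since it separates into single sums given by the \<open>q\<close>-binomial
  theorem (\<open>seed_kern_sum\<close>). The outcome (\<open>refined_expansion\<close>) is a sum over \<open>k \<ge> m \<ge> 0\<close> with
  \<open>r = z\<^sub>\<alpha> k + z\<^bsub>\<alpha>-1\<^esub> m\<close> and \<open>r + c = y\<^bsub>\<alpha>+1\<^esub> k + y\<^sub>\<alpha> m\<close>, because the convergents of the continued
  fraction follow the same recursion as \<open>(r, c)\<close>.

  Summing \<open>K\<^bsub>r,c\<^esub>\<close> over \<open>u + v = l\<close> leaves \<open>q\<^bsup>r(r+c)\<^esup>\<close> if \<open>l = r + c\<close> and \<open>0\<close> otherwise
  (\<open>kern_diagonal_sum\<close>). Hence \<open>q\<^bsup>l\<^sup>2/p\<^esup> V\<^sub>l\<close> is a finite sum over the pairs \<open>(k, m)\<close> with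
  \<open>y\<^bsub>\<alpha>+1\<^esub> k + y\<^sub>\<alpha> m = l\<close> (\<open>weight_sum\<close>). The terms with a fixed \<open>k\<close> add up to the \<open>k\<close>-th term of the
  right-hand side (\<open>bosonic_term\<close>), with \<open>m\<close> and \<open>k - m\<close> exchanged, and collecting them by \<open>k\<close>
  instead of \<open>l\<close> is allowed because their orders in \<open>q\<close> tend to infinity (\<open>regroup_sums\<close>).
\<close>

section \<open>A kernel stable under the two basic moves\<close>

text \<open>The identities below hold in any field for a nonzero base \<open>q\<close> all of whose \<open>q\<close>-factorials are
  invertible. This class of bases is closed under \<open>q \<mapsto> 1 / q\<close>, the operation behind the
  alternating signs \<open>\<epsilon>(j)\<close>.\<close>

definition nonroot :: "'a::field \<Rightarrow> bool" where
  "nonroot q \<longleftrightarrow> q \<noteq> 0 \<and> (\<forall>n>0. q ^ n \<noteq> 1)"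

abbreviation qfact :: "'a::field \<Rightarrow> nat \<Rightarrow> 'a" where
  "qfact q n \<equiv> qpoch q q n"

lemma nonroot_inverse: "nonroot q \<Longrightarrow> nonroot (1 / q)"
  by (auto simp: nonroot_def power_one_over)

lemma qpoch_0 [simp]: "qpoch a q 0 = 1"
  by (simp add: qpoch_def)

lemma qpoch_Suc: "qpoch a q (Suc n) = qpoch a q n * (1 - a * q ^ n)"
  by (simp add: qpoch_def)

lemma qpoch_Suc_left: "qpoch a q (Suc n) = (1 - a) * qpoch (a * q) q n"
proof (induction n)
  case (Suc n)
  show ?case
    unfolding qpoch_Suc[of a q "Suc n"] Suc qpoch_Suc[of "a * q" q n] by (simp add: mult_ac)
qed (simp add: qpoch_Suc)

lemma qfact_Suc: "qfact q (Suc n) = qfact q n * (1 - q ^ Suc n)"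
  by (simp add: qpoch_Suc)

lemma qfact_nonzero: "nonroot q \<Longrightarrow> qfact q n \<noteq> 0"
  by (induction n) (auto simp: qfact_Suc nonroot_def simp del: power_Suc)

lemma choose2_Suc: "Suc n choose 2 = (n choose 2) + n"
  by (simp add: numeral_2_eq_2)

lemma choose2_add: "(a + b) choose 2 = (a choose 2) + (b choose 2) + a * b"
  by (induction a) (simp_all add: choose2_Suc)

lemma qfact_inverse:
  assumes "nonroot q"
  shows "qfact (1 / q) n = (-1) ^ n * qfact q n / q ^ (Suc n choose 2)"
proof (induction n)
  case (Suc n)
  have q: "q \<noteq> 0" using assms by (simp add: nonroot_def)
  have "qfact (1 / q) (Suc n) = qfact (1 / q) n * (1 - 1 / q ^ Suc n)"
    by (simp only: qfact_Suc power_one_over)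
  also have "1 - 1 / q ^ Suc n = - (1 - q ^ Suc n) / q ^ Suc n"
    using q by (simp add: field_simps)
  also have "qfact (1 / q) n * (- (1 - q ^ Suc n) / q ^ Suc n)
      = (-1) ^ Suc n * (qfact q n * (1 - q ^ Suc n)) / q ^ ((Suc n choose 2) + Suc n)"
    unfolding Suc power_add by (simp only: times_divide_times_eq power_Suc mult_minus_left mult_minus_right mult_1_left mult_ac)
  finally show ?case by (simp only: qfact_Suc choose2_Suc[of "Suc n"])
qed (simp add: numeral_2_eq_2)

text \<open>The \<open>q\<close>-Pascal rule for \<open>1 / ((q)\<^sub>a (q)\<^sub>b)\<close>, obtained from
  \<open>1 - q\<^bsup>a+b\<^esup> = (1 - q\<^bsup>b\<^esup>) + q\<^bsup>b\<^esup> (1 - q\<^bsup>a\<^esup>)\<close> by cancelling the last factor of one of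
  the two \<open>q\<close>-factorials.\<close>

lemma pascal_qfact:
  assumes "nonroot q"
  shows "(1 - q ^ (a + b)) / (qfact q a * qfact q b) =
    (if b = 0 then 0 else 1 / (qfact q a * qfact q (b - 1))) +
    (if a = 0 then 0 else q ^ b / (qfact q (a - 1) * qfact q b))"
proof -
  note nz = qfact_nonzero[OF assms]
  have nz': "1 - q ^ Suc n \<noteq> 0" for n
    using assms unfolding nonroot_def by (metis right_minus_eq zero_less_Suc)
  have A: "1 / (qfact q a * qfact q (b - 1)) = (1 - q ^ b) / (qfact q a * qfact q b)" if "b \<noteq> 0"
  proof -
    obtain c where "b = Suc c" using \<open>b \<noteq> 0\<close> not0_implies_Suc by blast
    then show ?thesis using nz nz'[of c] by (simp add: qfact_Suc del: power_Suc)
  qed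
  have B: "1 / (qfact q (a - 1) * qfact q b) = (1 - q ^ a) / (qfact q a * qfact q b)" if "a \<noteq> 0"
  proof -
    obtain c where "a = Suc c" using \<open>a \<noteq> 0\<close> not0_implies_Suc by blast
    then show ?thesis using nz nz'[of c] by (simp add: qfact_Suc del: power_Suc)
  qed
  have B': "q ^ b / (qfact q (a - 1) * qfact q b) = q ^ b * (1 - q ^ a) / (qfact q a * qfact q b)"
    if "a \<noteq> 0" using B[OF that] by (metis times_divide_eq_right mult.right_neutral)
  have "(1 - q ^ (a + b)) = (1 - q ^ b) + q ^ b * (1 - q ^ a)"
    by (simp add: algebra_simps power_add)
  then have "(1 - q ^ (a + b)) / (qfact q a * qfact q b) =
      (1 - q ^ b) / (qfact q a * qfact q b) + q ^ b * (1 - q ^ a) / (qfact q a * qfact q b)"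
    by (simp only: add_divide_distrib)
  then show ?thesis using A B' by auto
qed

text \<open>The shape in which the Pascal rule reduces a sum over \<open>i \<le> n + 1\<close> to one over \<open>i \<le> n\<close>.\<close>

lemma sum_split_ends:
  fixes X Y :: "nat \<Rightarrow> 'a::comm_monoid_add"
  shows "(\<Sum>i\<le>Suc n. (if Suc n - i = 0 then 0 else X i) + (if i = 0 then 0 else Y (i - 1)))
    = (\<Sum>i\<le>n. X i + Y i)"
proof -
  have 1: "(\<Sum>i\<le>Suc n. if Suc n - i = 0 then 0 else X i) = (\<Sum>i\<le>n. X i)"
    unfolding sum.atMost_Suc by (auto intro!: sum.cong)
  have 2: "(\<Sum>i\<le>Suc n. if i = 0 then 0 else Y (i - 1)) = (\<Sum>i\<le>n. Y i)"
    unfolding sum.atMost_Suc_shift by simp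
  show ?thesis unfolding sum.distrib 1 2 ..
qed

text \<open>By the Pascal rule, passing from \<open>n\<close> to \<open>n + 1\<close> multiplies the sum by
  \<open>(1 - x q\<^bsup>n\<^esup>) / (1 - q\<^bsup>n+1\<^esup>)\<close>.\<close>

lemma q_binomial:
  assumes "nonroot q"
  shows "(\<Sum>i\<le>n. (-1) ^ i * q ^ (i choose 2) * x ^ i / (qfact q i * qfact q (n - i)))
    = qpoch x q n / qfact q n"
proof (induction n)
  case (Suc n)
  define t where "t n i = (-1) ^ i * q ^ (i choose 2) * x ^ i / (qfact q i * qfact q (n - i))" for n i
  have nz: "1 - q ^ Suc n \<noteq> 0"
    using assms unfolding nonroot_def by (metis right_minus_eq zero_less_Suc)
  have "(1 - q ^ Suc n) * t (Suc n) i = (if Suc n - i = 0 then 0 else t n i) +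
      (if i = 0 then 0 else - x * q ^ n * t n (i - 1))" if "i \<le> Suc n" for i
  proof -
    have e: "i + (Suc n - i) = Suc n" using that by simp
    have "(1 - q ^ Suc n) * t (Suc n) i = (-1) ^ i * q ^ (i choose 2) * x ^ i *
        ((1 - q ^ (i + (Suc n - i))) / (qfact q i * qfact q (Suc n - i)))"
      unfolding t_def e by simp
    also have "\<dots> = (if Suc n - i = 0 then 0 else
        (-1) ^ i * q ^ (i choose 2) * x ^ i / (qfact q i * qfact q (Suc n - i - 1)))
      + (if i = 0 then 0 else (-1) ^ i * q ^ (i choose 2) * x ^ i * q ^ (Suc n - i) /
         (qfact q (i - 1) * qfact q (Suc n - i)))"
      unfolding pascal_qfact[OF assms] by (simp add: distrib_left)
    also have "Suc n - i - 1 = n - i" by simp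
    also have "(-1) ^ i * q ^ (i choose 2) * x ^ i * q ^ (Suc n - i) /
         (qfact q (i - 1) * qfact q (Suc n - i)) = - x * q ^ n * t n (i - 1)" if "i \<noteq> 0"
    proof -
      obtain j where j: "i = Suc j" using \<open>i \<noteq> 0\<close> not0_implies_Suc by blast
      have "q ^ n = q ^ j * q ^ (n - j)" using \<open>i \<le> Suc n\<close> j by (simp flip: power_add)
      then show ?thesis unfolding t_def j by (simp add: choose2_Suc power_add)
    qed
    then have "(if i = 0 then 0 else (-1) ^ i * q ^ (i choose 2) * x ^ i * q ^ (Suc n - i) /
         (qfact q (i - 1) * qfact q (Suc n - i))) = (if i = 0 then 0 else - x * q ^ n * t n (i - 1))"
      by simp
    finally show ?thesis unfolding t_def .
  qed
  then have "(1 - q ^ Suc n) * (\<Sum>i\<le>Suc n. t (Suc n) i) = 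
      (\<Sum>i\<le>Suc n. (if Suc n - i = 0 then 0 else t n i) + (if i = 0 then 0 else - x * q ^ n * t n (i - 1)))"
    unfolding sum_distrib_left by (intro sum.cong) auto
  also have "\<dots> = (\<Sum>i\<le>n. t n i + - x * q ^ n * t n i)"
    by (rule sum_split_ends)
  also have "\<dots> = (1 - x * q ^ n) * (\<Sum>i\<le>n. t n i)"
    by (simp add: sum_distrib_left algebra_simps sum_subtractf)
  also have "(\<Sum>i\<le>n. t n i) = qpoch x q n / qfact q n" using Suc unfolding t_def .
  finally have "(\<Sum>i\<le>Suc n. t (Suc n) i) = (1 - x * q ^ n) * (qpoch x q n / qfact q n) / (1 - q ^ Suc n)"
    using nz by (metis nonzero_mult_div_cancel_left)
  then show ?case unfolding t_def qfact_Suc by (simp add: qpoch_Suc[of x] mult_ac)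
qed (simp add: numeral_2_eq_2)

text \<open>A case of the \<open>q\<close>-Chu-Vandermonde sum. By the Pascal rule in the other direction, passing
  from \<open>n\<close> to \<open>n + 1\<close> multiplies the sum by \<open>q\<^bsup>w\<^esup> / (1 - q\<^bsup>n+1\<^esup>)\<close>: the two terms that meet at
  index \<open>i\<close> are \<open>q\<^bsup>i\<^esup>\<close> and \<open>q\<^bsup>w\<^esup> - q\<^bsup>i\<^esup>\<close> times the old one.\<close>

lemma q_vandermonde:
  assumes "nonroot q"
  shows "(\<Sum>i\<le>n. if i \<le> w then (-1) ^ i * q ^ (i choose 2) /
      (qfact q i * qfact q (n - i) * qfact q (w - i)) else 0) = q ^ (n * w) / (qfact q n * qfact q w)"
proof (induction n)
  case (Suc n)
  define t where "t n i = (if i \<le> w then (-1) ^ i * q ^ (i choose 2) /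
      (qfact q i * qfact q (n - i) * qfact q (w - i)) else 0)" for n i
  have nz: "1 - q ^ Suc n \<noteq> 0" for n
    using assms unfolding nonroot_def by (metis right_minus_eq zero_less_Suc)
  have "(1 - q ^ Suc n) * t (Suc n) i = (if Suc n - i = 0 then 0 else q ^ i * t n i) +
      (if i = 0 then 0 else (q ^ w - q ^ (i - 1)) * t n (i - 1))" if "i \<le> Suc n" for i
  proof (cases "i \<le> w")
    case True
    have e: "Suc n - i + i = Suc n" using that by simp
    have "(1 - q ^ Suc n) * t (Suc n) i = (-1) ^ i * q ^ (i choose 2) / qfact q (w - i) *
        ((1 - q ^ (Suc n - i + i)) / (qfact q (Suc n - i) * qfact q i))"
      using True unfolding t_def e by (simp add: mult_ac)
    also have "\<dots> = (if Suc n - i = 0 then 0 else (-1) ^ i * q ^ (i choose 2) / qfact q (w - i) *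
          q ^ i / (qfact q (Suc n - i - 1) * qfact q i)) 
      + (if i = 0 then 0 else (-1) ^ i * q ^ (i choose 2) / qfact q (w - i) /
         (qfact q (Suc n - i) * qfact q (i - 1)))"
      unfolding pascal_qfact[OF assms] by (simp add: distrib_left mult_ac)
    also have "Suc n - i - 1 = n - i" by simp
    also have "(-1) ^ i * q ^ (i choose 2) / qfact q (w - i) * q ^ i / (qfact q (n - i) * qfact q i)
       = q ^ i * t n i" using True unfolding t_def by (simp add: mult_ac)
    also have "(-1) ^ i * q ^ (i choose 2) / qfact q (w - i) /
         (qfact q (Suc n - i) * qfact q (i - 1)) = (q ^ w - q ^ (i - 1)) * t n (i - 1)" if "i \<noteq> 0"
    proof -
      obtain j where j: "i = Suc j" using \<open>i \<noteq> 0\<close> not0_implies_Suc by blast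
      obtain d where d: "w = Suc (j + d)" using True j le_Suc_ex[of "Suc j" w] by auto
      have nf: "qfact q d \<noteq> 0" using qfact_nonzero[OF assms] .
      have 1: "q ^ w - q ^ (i - 1) = - (q ^ j) * (1 - q ^ Suc d)"
        unfolding d j by (simp add: power_add algebra_simps)
      have 2: "t n (i - 1) = (-1) ^ j * q ^ (j choose 2) / (qfact q j * qfact q (n - j) * (qfact q d * (1 - q ^ Suc d)))"
        unfolding t_def j d using qfact_Suc[of q d] by (simp add: Suc_diff_le)
      have "(- (q ^ j) * B) * (s * p / (X * Y * (Z * B))) = (- s) * (p * q ^ j) / Z / (Y * X)"
        if "B \<noteq> 0" for B s p X Y Z :: 'a
        using that by (simp add: divide_simps)
      from this[OF nz] show ?thesis unfolding 1 2
        unfolding j d by (simp add: choose2_Suc power_add)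
    qed
    then have "(if i = 0 then 0 else (-1) ^ i * q ^ (i choose 2) / qfact q (w - i) /
         (qfact q (Suc n - i) * qfact q (i - 1))) = (if i = 0 then 0 else (q ^ w - q ^ (i - 1)) * t n (i - 1))"
      by simp
    finally show ?thesis .
  next
    case False
    then show ?thesis by (cases "i = Suc w") (auto simp: t_def)
  qed
  then have "(1 - q ^ Suc n) * (\<Sum>i\<le>Suc n. t (Suc n) i) = 
      (\<Sum>i\<le>Suc n. (if Suc n - i = 0 then 0 else q ^ i * t n i) +
        (if i = 0 then 0 else (q ^ w - q ^ (i - 1)) * t n (i - 1)))"
    unfolding sum_distrib_left by (intro sum.cong) auto
  also have "\<dots> = (\<Sum>i\<le>n. q ^ i * t n i + (q ^ w - q ^ i) * t n i)"
    by (rule sum_split_ends)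
  also have "\<dots> = q ^ w * (\<Sum>i\<le>n. t n i)"
    by (simp add: sum_distrib_left algebra_simps)
  also have "(\<Sum>i\<le>n. t n i) = q ^ (n * w) / (qfact q n * qfact q w)" using Suc unfolding t_def .
  finally have "(\<Sum>i\<le>Suc n. t (Suc n) i) = q ^ w * (q ^ (n * w) / (qfact q n * qfact q w)) / (1 - q ^ Suc n)"
    using nz by (metis nonzero_mult_div_cancel_left)
  then show ?case unfolding t_def qfact_Suc by (simp add: power_add mult_ac)
qed (simp add: numeral_2_eq_2)

text \<open>In generating-function form, \<open>kern q r c u v\<close> is, up to the factor \<open>q\<^bsup>rc\<^esup>\<close>, the coefficient
  of \<open>x\<^bsup>u+v\<^esup>\<close> in \<open>x\<^bsup>c+v\<^esup> q\<^bsup>v\<^sup>2\<^esup> (x q\<^bsup>v+r+1\<^esup>; q)\<^sub>\<infinity> / (q)\<^bsub>v-r\<^esub>\<close>, that is, of the kernel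
  \<open>1 / ((q)\<^bsub>v-r\<^esub> (xq)\<^bsub>v+r\<^esub>)\<close> of Bailey's lemma with parameter \<open>x\<close>, multiplied by \<open>(xq)\<^sub>\<infinity>\<close> and
  a monomial.
  The factor \<open>q\<^bsup>rc\<^esup>\<close> makes both moves act on the family without any multiplier.\<close>

definition kern :: "'a::field \<Rightarrow> nat \<Rightarrow> nat \<Rightarrow> nat \<Rightarrow> nat \<Rightarrow> 'a" where
  "kern q r c u v = (if c \<le> u \<and> r \<le> v
     then (-1) ^ (u - c) * q ^ (r * c + v\<^sup>2 + (Suc (u - c) choose 2) + (u - c) * (v + r)) /
       (qfact q (u - c) * qfact q (v - r))
     else 0)"

lemma kern_eq_0: "\<not> (c \<le> u \<and> r \<le> v) \<Longrightarrow> kern q r c u v = 0"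
  by (simp only: kern_def if_False)

lemma kern_shifted:
  "kern q r c (c + s) (r + t) = (-1) ^ s * q ^ (r * c + (r + t)\<^sup>2 + (Suc s choose 2) + s * (t + 2 * r)) /
     (qfact q s * qfact q t)"
  by (simp add: kern_def algebra_simps mult_2_right)

text \<open>The reflection move exchanges the two parameters. Each of the two \<open>q\<close>-factorials
  contributes a triangular power of \<open>q\<close> and a sign when \<open>q\<close> is inverted; together they turn the
  exponent for \<open>(r, c)\<close> into the one for \<open>(c, r)\<close>.\<close>

lemma kern_flip:
  assumes "nonroot q"
  shows "q ^ ((u + v)\<^sup>2) * kern (1 / q) r c v u = kern q c r u v"
proof (cases "c \<le> v \<and> r \<le> u")
  case True
  obtain s where s: "v = c + s" using True le_Suc_ex by blast
  obtain t where t: "u = r + t" using True le_Suc_ex by blast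
  have q: "q \<noteq> 0" using assms by (simp add: nonroot_def)
  define A where "A = r * c + (r + t)\<^sup>2 + (Suc s choose 2) + s * (t + 2 * r)"
  define B where "B = c * r + (c + s)\<^sup>2 + (Suc t choose 2) + t * (s + 2 * c)"
  have ex: "(u + v)\<^sup>2 + (Suc s choose 2) + (Suc t choose 2) = A + B"
    unfolding s t A_def B_def by (simp add: algebra_simps power2_eq_square)
  have "kern (1 / q) r c v u = (-1) ^ s * (1 / q ^ A) /
     (((-1) ^ s * qfact q s / q ^ (Suc s choose 2)) * ((-1) ^ t * qfact q t / q ^ (Suc t choose 2)))"
    unfolding s t kern_shifted power_one_over qfact_inverse[OF assms] A_def ..
  also have "\<dots> = (-1) ^ t * q ^ (Suc s choose 2) * q ^ (Suc t choose 2) / (q ^ A * (qfact q s * qfact q t))"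
  proof -
    have "s * (1 / a) / ((s * f / x) * (t * g / y)) = t * x * y / (a * (f * g))"
      if "s \<noteq> 0" "a \<noteq> 0" "x \<noteq> 0" "y \<noteq> 0" "t * t = 1" "f \<noteq> 0" "g \<noteq> 0" for s a x y f t g :: 'a
    proof -
      have "t \<noteq> 0" using that by auto
      have "1 / t = t" using that by (auto simp: divide_eq_eq)
      have "s * (1 / a) / ((s * f / x) * (t * g / y)) = (1 / t) * x * y / (a * (f * g))"
        using that(1-4,6-7) \<open>t \<noteq> 0\<close> by (simp add: field_simps)
      then show ?thesis unfolding \<open>1 / t = t\<close> .
    qed
    moreover have "(-1) ^ t * (-1) ^ t = (1 :: 'a)" by (simp flip: power_mult_distrib)
    ultimately show ?thesis using q qfact_nonzero[OF assms] by simp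
  qed
  finally have "q ^ ((u + v)\<^sup>2) * kern (1 / q) r c v u =
      (-1) ^ t * q ^ ((u + v)\<^sup>2 + (Suc s choose 2) + (Suc t choose 2)) / (q ^ A * (qfact q s * qfact q t))"
    by (simp only: power_add times_divide_eq_right mult_ac)
  also have "\<dots> = (-1) ^ t * q ^ B / (qfact q t * qfact q s)"
    unfolding ex power_add using q by simp
  also have "\<dots> = kern q c r u v" unfolding s t kern_shifted B_def ..
  finally show ?thesis .
next
  case False
  then show ?thesis by (auto simp: kern_eq_0)
qed

text \<open>One step of Bailey's chain, with parameter \<open>x\<close> extracted coefficientwise. With \<open>M = r + i\<close>
  all powers of \<open>q\<close> except \<open>i choose 2\<close> become independent of \<open>i\<close>, and the sum is the
  \<open>q\<close>-Vandermonde sum.\<close>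

lemma kern_step:
  assumes "nonroot q"
  shows "q ^ (v\<^sup>2) * (\<Sum>M\<le>min u v. kern q r c (u - M) M / qfact q (v - M)) = kern q r (c + r) u v"
proof (cases "c + r \<le> u \<and> r \<le> v")
  case True
  obtain n where n: "u = c + r + n" using True le_Suc_ex by blast
  obtain w where w: "v = r + w" using True le_Suc_ex by blast
  define e where "e = r * c + r\<^sup>2 + 2 * r * n + (Suc n choose 2)"
  have "(\<Sum>M\<le>min u v. kern q r c (u - M) M / qfact q (v - M)) =
      (\<Sum>i\<le>min n w. kern q r c (u - (r + i)) (r + i) / qfact q (v - (r + i)))"
  proof (rule sum.mono_neutral_cong_right[where S = "(\<lambda>i. r + i) ` {..min n w}", THEN trans])
    show "(\<lambda>i. r + i) ` {..min n w} \<subseteq> {..min u v}" using n w by auto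
    show "\<forall>M\<in>{..min u v} - (\<lambda>i. r + i) ` {..min n w}. kern q r c (u - M) M / qfact q (v - M) = 0"
    proof
      fix M assume M: "M \<in> {..min u v} - (\<lambda>i. r + i) ` {..min n w}"
      have "\<not> (c \<le> u - M \<and> r \<le> M)"
      proof
        assume a: "c \<le> u - M \<and> r \<le> M"
        then have "M - r \<le> min n w" using M n w by auto
        then have "M \<in> (\<lambda>i. r + i) ` {..min n w}" using a by (intro image_eqI[of _ _ "M - r"]) auto
        then show False using M by simp
      qed
      then show "kern q r c (u - M) M / qfact q (v - M) = 0" by (simp add: kern_eq_0)
    qed
  qed (auto simp: sum.reindex)
  also have "\<dots> = (\<Sum>i\<le>min n w. (-1) ^ n * q ^ e *
       ((-1) ^ i * q ^ (i choose 2) / (qfact q i * qfact q (n - i) * qfact q (w - i))))"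
  proof (rule sum.cong[OF refl])
    fix i assume "i \<in> {..min n w}"
    then obtain s where s: "n = i + s" using le_Suc_ex[of i n] by auto
    have ex: "r * c + (r + i)\<^sup>2 + (Suc s choose 2) + s * (i + 2 * r) = e + (i choose 2)"
      unfolding e_def s choose2_Suc choose2_add by (simp add: algebra_simps power2_eq_square choose2_Suc)
        (induction i; simp add: choose2_Suc)
    have sg: "(-1) ^ s = (-1) ^ n * (-1 :: 'a) ^ i" unfolding s by (simp add: power_add flip: power_mult_distrib)
    have u': "u - (r + i) = c + s" using n s by simp
    show "kern q r c (u - (r + i)) (r + i) / qfact q (v - (r + i)) = (-1) ^ n * q ^ e *
       ((-1) ^ i * q ^ (i choose 2) / (qfact q i * qfact q (n - i) * qfact q (w - i)))"
      unfolding u' kern_shifted ex sg w using s by (simp add: power_add mult_ac)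
  qed
  also have "\<dots> = (-1) ^ n * q ^ e * (\<Sum>i\<le>n. if i \<le> w then (-1) ^ i * q ^ (i choose 2) /
      (qfact q i * qfact q (n - i) * qfact q (w - i)) else 0)"
    unfolding sum_distrib_left[symmetric]
    by (intro arg_cong2[where f = "(*)"] refl sum.mono_neutral_cong_left) auto
  also have "\<dots> = (-1) ^ n * q ^ (e + n * w) / (qfact q n * qfact q w)"
    unfolding q_vandermonde[OF assms] by (simp add: power_add)
  finally have "q ^ (v\<^sup>2) * (\<Sum>M\<le>min u v. kern q r c (u - M) M / qfact q (v - M)) =
      (-1) ^ n * q ^ (v\<^sup>2 + (e + n * w)) / (qfact q n * qfact q w)"
    by (simp add: power_add)
  also have "v\<^sup>2 + (e + n * w) = r * (c + r) + (r + w)\<^sup>2 + (Suc n choose 2) + n * (w + 2 * r)"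
    unfolding w e_def by (simp add: algebra_simps power2_eq_square)
  finally show ?thesis unfolding n w kern_shifted .
next
  case False
  then have "kern q r c (u - M) M = 0" if "M \<le> min u v" for M using that by (intro kern_eq_0) auto
  then show ?thesis using False by (auto simp: kern_eq_0)
qed

text \<open>The limiting case of Bailey's lemma: the sum is a multiple of \<open>(1; q)\<^sub>n\<close> with
  \<open>n = l - r - c\<close>, which vanishes unless \<open>n = 0\<close>.\<close>

lemma kern_diagonal_sum:
  assumes "nonroot q"
  shows "(\<Sum>v\<le>l. kern q r c (l - v) v) = (if l = r + c then q ^ (r * l) else 0)"
proof (cases "r + c \<le> l")
  case True
  obtain n where n: "l = r + c + n" using True le_Suc_ex by blast
  define e where "e = r * c + r\<^sup>2 + 2 * r * n + (Suc n choose 2)"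
  have "(\<Sum>v\<le>l. kern q r c (l - v) v) = (\<Sum>i\<le>n. kern q r c (l - (r + i)) (r + i))"
  proof (rule sum.mono_neutral_cong_right[where S = "(\<lambda>i. r + i) ` {..n}", THEN trans])
    show "\<forall>v\<in>{..l} - (\<lambda>i. r + i) ` {..n}. kern q r c (l - v) v = 0"
    proof
      fix v assume v: "v \<in> {..l} - (\<lambda>i. r + i) ` {..n}"
      have "\<not> (c \<le> l - v \<and> r \<le> v)"
      proof
        assume a: "c \<le> l - v \<and> r \<le> v"
        then have "v \<in> (\<lambda>i. r + i) ` {..n}" using v n by (intro image_eqI[of _ _ "v - r"]) auto
        then show False using v by simp
      qed
      then show "kern q r c (l - v) v = 0" by (simp add: kern_eq_0)
    qed
  qed (use n in \<open>auto simp: sum.reindex\<close>)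
  also have "\<dots> = (\<Sum>i\<le>n. (-1) ^ n * q ^ e *
       ((-1) ^ i * q ^ (i choose 2) * 1 ^ i / (qfact q i * qfact q (n - i))))"
  proof (rule sum.cong[OF refl])
    fix i assume "i \<in> {..n}"
    then obtain s where s: "n = i + s" using le_Suc_ex[of i n] by auto
    have ex: "r * c + (r + i)\<^sup>2 + (Suc s choose 2) + s * (i + 2 * r) = e + (i choose 2)"
      unfolding e_def s choose2_Suc choose2_add by (simp add: algebra_simps power2_eq_square choose2_Suc)
        (induction i; simp add: choose2_Suc)
    have sg: "(-1) ^ s = (-1) ^ n * (-1 :: 'a) ^ i" unfolding s by (simp add: power_add flip: power_mult_distrib)
    have u': "l - (r + i) = c + s" using n s by simp
    show "kern q r c (l - (r + i)) (r + i) = (-1) ^ n * q ^ e *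
       ((-1) ^ i * q ^ (i choose 2) * 1 ^ i / (qfact q i * qfact q (n - i)))"
      unfolding u' kern_shifted ex sg using s by (simp add: power_add mult_ac)
  qed
  also have "\<dots> = (-1) ^ n * q ^ e * (qpoch 1 q n / qfact q n)"
    unfolding sum_distrib_left[symmetric] q_binomial[OF assms] ..
  also have "\<dots> = (if n = 0 then q ^ e else 0)"
    by (cases n) (auto simp: qpoch_Suc_left)
  finally show ?thesis unfolding n e_def by (simp add: algebra_simps power2_eq_square numeral_2_eq_2)
next
  case False
  then have "kern q r c (l - v) v = 0" if "v \<le> l" for v using that by (intro kern_eq_0) auto
  then show ?thesis using False by auto
qed

text \<open>The coefficients of the unit mass at \<open>(0, 0)\<close> in the kernel. For \<open>a + b > 0\<close> the factor
  \<open>1 + q\<^bsup>a+b\<^esup> - q\<^sup>a\<close> is what remains of the two \<open>q\<close>-binomials in the polynomial \<open>Q\<close>, see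
  \<open>Qpoly_over_qfact\<close>.\<close>

definition seed :: "'a::field \<Rightarrow> nat \<Rightarrow> nat \<Rightarrow> 'a" where
  "seed q a b = (-1) ^ a * q ^ (a choose 2) * (1 + q ^ (a + b) - q ^ a) / (qfact q a * qfact q b)"

lemma seed_flip:
  assumes "nonroot q"
  shows "seed (1 / q) a b = seed q b a"
proof -
  have q: "q \<noteq> 0" using assms by (simp add: nonroot_def)
  have bb: "(Suc b choose 2) = (b choose 2) + b" "(Suc a choose 2) = (a choose 2) + a"
    by (simp_all add: choose2_Suc)
  have sg: "(-1) ^ b * (-1) ^ b = (1 :: 'a)" by (simp flip: power_mult_distrib)
  have "1 + 1 / q ^ (a + b) - 1 / q ^ a = (1 + q ^ (b + a) - q ^ b) / q ^ (a + b)"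
    using q by (simp add: field_simps power_add)
  then have "seed (1 / q) a b = (-1) ^ a * (1 / q ^ (a choose 2)) * ((1 + q ^ (b + a) - q ^ b) / q ^ (a + b)) /
     (((-1) ^ a * qfact q a / q ^ (Suc a choose 2)) * ((-1) ^ b * qfact q b / q ^ (Suc b choose 2)))"
    unfolding seed_def power_one_over qfact_inverse[OF assms] by simp
  also have "\<dots> = seed q b a"
  proof -
    have "s * (1 / x) * (n / (y * z)) / ((s * f / (x * y)) * (t * g / (w * z))) = t * w * n / (g * f)"
      if "s \<noteq> 0" "x \<noteq> 0" "y \<noteq> 0" "z \<noteq> 0" "w \<noteq> 0" "t \<noteq> 0" "t * t = 1" "f \<noteq> 0" "g \<noteq> 0"
      for s x n y z f t g w :: 'a
    proof -
      have "1 / t = t" using that by (simp add: field_simps)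
      have "s * (1 / x) * (n / (y * z)) / ((s * f / (x * y)) * (t * g / (w * z))) = 1 / t * w * n / (g * f)"
        using that(1-6,8-9) by (simp add: field_simps)
      then show ?thesis unfolding \<open>1 / t = t\<close> .
    qed
    from this[OF _ _ _ _ _ _ sg] show ?thesis
      unfolding bb power_add seed_def using q qfact_nonzero[OF assms] by simp
  qed
  finally show ?thesis .
qed

text \<open>In the product of \<open>seed\<close> and \<open>kern\<close> the mixed term of the exponent is \<open>u a + v (u - b)\<close>, so
  that \<open>a\<close> and \<open>b\<close> separate. The \<open>q\<close>-binomial theorem evaluates the six single sums as shifted
  factorials, and for \<open>u, v > 0\<close> the total has the factor
  \<open>(1 - q\<^sup>u) + q\<^sup>u (1 - q\<^sup>v) - (1 - q\<^bsup>u+v\<^esup>) = 0\<close>.\<close>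

lemma seed_kern_sum:
  assumes "nonroot q"
  shows "(\<Sum>a\<le>v. \<Sum>b\<le>u. seed q a b * kern q a b u v) = (if u = 0 \<and> v = 0 then 1 else 0)"
proof -
  define A where "A e a = (-1) ^ a * q ^ (a choose 2) * (q ^ e) ^ a / (qfact q a * qfact q (v - a))" for e a
  define B where "B e s = (-1) ^ s * q ^ (s choose 2) * (q ^ e) ^ s / (qfact q s * qfact q (u - s))" for e s
  define X where "X e = qpoch (q ^ e) q v" for e
  define Y where "Y e = qpoch (q ^ e) q u" for e
  have X: "(\<Sum>a\<le>v. A e a) = X e / qfact q v" for e
    unfolding A_def X_def by (rule q_binomial[OF assms])
  have Y: "(\<Sum>b\<le>u. B e (u - b)) = Y e / qfact q u" for e
    unfolding Y_def q_binomial[OF assms, symmetric] B_def[symmetric] 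
    by (rule sum.reindex_bij_witness[of _ "\<lambda>s. u - s" "\<lambda>s. u - s"]) auto
  have "seed q a b * kern q a b u v = q ^ (v\<^sup>2) *
      (A u a * B (v + 1) (u - b) + q ^ u * (A (u + 1) a * B v (u - b)) - A (u + 1) a * B (v + 1) (u - b))"
    if "a \<le> v" "b \<le> u" for a b
  proof -
    obtain s where s: "u = b + s" using \<open>b \<le> u\<close> le_Suc_ex by blast
    obtain t where t: "v = a + t" using \<open>a \<le> v\<close> le_Suc_ex by blast
    define Z where "Z = (-1) ^ a * (-1) ^ s * q ^ (a choose 2) * q ^ (s choose 2) /
      (qfact q a * qfact q t * (qfact q s * qfact q b))"
    have 1: "A u a * B (v + 1) s = Z * q ^ (u * a + (v + 1) * s)"
      "A (u + 1) a * B v s = Z * q ^ (u * a + v * s + a)"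
      "A (u + 1) a * B (v + 1) s = Z * q ^ (u * a + (v + 1) * s + a)"
      unfolding A_def B_def Z_def by (simp_all add: s t power_add algebra_simps flip: power_mult)
    have "kern q a b u v = (-1) ^ s * q ^ (a * b + v\<^sup>2 + (Suc s choose 2) + s * (t + 2 * a)) /
        (qfact q s * qfact q t)"
      unfolding s t by (rule kern_shifted)
    also have "a * b + v\<^sup>2 + (Suc s choose 2) + s * (t + 2 * a) = v\<^sup>2 + (s choose 2) + (u * a + (v + 1) * s)"
      unfolding choose2_Suc s t by (simp add: algebra_simps)
    finally have "seed q a b * kern q a b u v =
        q ^ (v\<^sup>2) * (Z * q ^ (u * a + (v + 1) * s) * (1 + q ^ (a + b) - q ^ a))"
      unfolding seed_def Z_def power_add by (simp add: mult_ac)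
    also have "Z * q ^ (u * a + (v + 1) * s) * (1 + q ^ (a + b) - q ^ a) =
        A u a * B (v + 1) s + q ^ u * (A (u + 1) a * B v s) - A (u + 1) a * B (v + 1) s"
      unfolding 1 by (simp add: s power_add algebra_simps)
    finally show ?thesis using s by simp
  qed
  then have "(\<Sum>a\<le>v. \<Sum>b\<le>u. seed q a b * kern q a b u v) = (\<Sum>a\<le>v. \<Sum>b\<le>u. q ^ (v\<^sup>2) *
      (A u a * B (v + 1) (u - b) + q ^ u * (A (u + 1) a * B v (u - b)) - A (u + 1) a * B (v + 1) (u - b)))"
    by (intro sum.cong refl) auto
  also have "\<dots> = q ^ (v\<^sup>2) * ((\<Sum>a\<le>v. A u a) * (\<Sum>b\<le>u. B (v + 1) (u - b)) +
      q ^ u * ((\<Sum>a\<le>v. A (u + 1) a) * (\<Sum>b\<le>u. B v (u - b))) -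
      (\<Sum>a\<le>v. A (u + 1) a) * (\<Sum>b\<le>u. B (v + 1) (u - b)))"
    unfolding sum_product by (simp only: sum_distrib_left sum.distrib sum_subtractf distrib_left right_diff_distrib)
  also have "\<dots> = q ^ (v\<^sup>2) * (X u * Y (v + 1) + q ^ u * (X (u + 1) * Y v) - X (u + 1) * Y (v + 1)) /
      (qfact q v * qfact q u)"
    unfolding X Y by (simp add: add_divide_distrib diff_divide_distrib distrib_left right_diff_distrib)
  also have "X u * Y (v + 1) + q ^ u * (X (u + 1) * Y v) - X (u + 1) * Y (v + 1)
     = (if u = 0 \<and> v = 0 then 1 else 0)"
  proof (cases u; cases v)
    fix u' v' assume u: "u = Suc u'" and v: "v = Suc v'"
    define P where "P = qpoch (q ^ (u + 1)) q v'"
    define Q where "Q = qpoch (q ^ (v + 1)) q u'"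
    have XY: "X u = (1 - q ^ u) * P" "X (u + 1) = P * (1 - q ^ (u + v))"
      "Y v = (1 - q ^ v) * Q" "Y (v + 1) = Q * (1 - q ^ (u + v))"
      unfolding X_def Y_def P_def Q_def
      subgoal by (simp add: v qpoch_Suc_left mult_ac)
      subgoal by (simp add: v qpoch_Suc power_add mult_ac)
      subgoal by (simp add: u qpoch_Suc_left mult_ac)
      subgoal by (simp add: u v qpoch_Suc power_add mult_ac)
      done
    have "X u * Y (v + 1) + q ^ u * (X (u + 1) * Y v) - X (u + 1) * Y (v + 1) =
      P * Q * (1 - q ^ (u + v)) * ((1 - q ^ u) + q ^ u * (1 - q ^ v) - (1 - q ^ (u + v)))"
      unfolding XY by (simp add: algebra_simps)
    also have "\<dots> = 0" by (simp add: algebra_simps power_add)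
    finally show ?thesis using u by simp
  qed (auto simp: X_def Y_def qpoch_Suc_left)
  finally show ?thesis by auto
qed

section \<open>Two moves that generate all continued fractions\<close>

text \<open>On the value \<open>p\<close> of the continued fraction, \<open>raise\<close> is \<open>p \<mapsto> p + 1\<close>, and \<open>reflect\<close>, which
  requires \<open>\<nu> 0 \<ge> 2\<close>, is \<open>p \<mapsto> p / (p - 1)\<close>: it turns \<open>[\<nu>\<^sub>0, \<nu>\<^sub>1, \<dots>]\<close> into
  \<open>[1, \<nu>\<^sub>0 - 1, \<nu>\<^sub>1, \<dots>]\<close>.\<close>

definition raise :: "(nat \<Rightarrow> nat) \<Rightarrow> nat \<Rightarrow> nat" where
  "raise \<nu> = \<nu>(0 := Suc (\<nu> 0))"

definition reflect :: "(nat \<Rightarrow> nat) \<Rightarrow> nat \<Rightarrow> nat" where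
  "reflect \<nu> = (\<lambda>i. if i = 0 then 1 else if i = 1 then \<nu> 0 - 1 else \<nu> (i - 1))"

text \<open>Lower \<open>\<nu> 0\<close> by \<open>raise\<close> until it is 1; then \<open>[1, \<nu>\<^sub>1, \<nu>\<^sub>2, \<dots>]\<close> is the reflection of the
  shorter \<open>[\<nu>\<^sub>1 + 1, \<nu>\<^sub>2, \<dots>]\<close>. The continued fraction \<open>[1]\<close> is the only starting point.\<close>

lemma cfrac_moves_induct [consumes 1, case_names one raise reflect]:
  assumes "\<forall>i\<le>\<alpha>. \<nu> i \<ge> 1"
    and one: "\<And>\<nu>. \<nu> 0 = 1 \<Longrightarrow> P \<nu> 0"
    and raise: "\<And>\<nu> \<alpha>. \<forall>i\<le>\<alpha>. \<nu> i \<ge> 1 \<Longrightarrow> P \<nu> \<alpha> \<Longrightarrow> P (raise \<nu>) \<alpha>"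
    and reflect: "\<And>\<nu> \<alpha>. \<forall>i\<le>\<alpha>. \<nu> i \<ge> 1 \<Longrightarrow> \<nu> 0 \<ge> 2 \<Longrightarrow> P \<nu> \<alpha> \<Longrightarrow> P (reflect \<nu>) (Suc \<alpha>)"
  shows "P \<nu> \<alpha>"
  using assms(1)
proof (induction \<alpha> arbitrary: \<nu>)
  case 0
  then show ?case
  proof (induction "\<nu> 0" arbitrary: \<nu>)
    case (Suc n)
    show ?case
    proof (cases n)
      case 0
      then show ?thesis using Suc.hyps one[of \<nu>] by simp
    next
      case (Suc k)
      have "raise (\<nu>(0 := n)) = \<nu>" using Suc.hyps(2) by (auto simp: raise_def fun_eq_iff)
      then show ?thesis using raise[of 0 "\<nu>(0 := n)"] Suc.hyps(1)[of "\<nu>(0 := n)"] Suc Suc.hyps(2)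
        by simp
    qed
  next
    case 0
    then show ?case by (metis le0 not_one_le_zero)
  qed
next
  case (Suc \<alpha>)
  from Suc.prems show ?case
  proof (induction "\<nu> 0" arbitrary: \<nu>)
    case 0
    then show ?case by (metis le0 not_one_le_zero)
  next
    case inner: (Suc n)
    show ?case
    proof (cases n)
      case 0
      define \<mu> where "\<mu> = (\<lambda>i. if i = 0 then Suc (\<nu> 1) else \<nu> (Suc i))"
      have n1: "\<nu> 0 = 1" using 0 inner.hyps(2) by simp
      have "reflect \<mu> i = \<nu> i" for i
        by (cases i) (auto simp: \<mu>_def reflect_def n1)
      then have eq: "reflect \<mu> = \<nu>" by (rule ext)
      have "\<nu> 1 \<ge> 1" using inner.prems by simp
      then have "\<forall>i\<le>\<alpha>. \<mu> i \<ge> 1" "\<mu> 0 \<ge> 2" using inner.prems by (auto simp: \<mu>_def)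
      then show ?thesis using reflect[of \<alpha> \<mu>] Suc.IH[of \<mu>] unfolding eq by blast
    next
      case (Suc k)
      have eq: "raise (\<nu>(0 := n)) = \<nu>" using inner.hyps(2) by (auto simp: raise_def fun_eq_iff)
      have "\<forall>i\<le>Suc \<alpha>. (\<nu>(0 := n)) i \<ge> 1" using inner.prems Suc by simp
      then show ?thesis using raise[of "Suc \<alpha>" "\<nu>(0 := n)"] inner.hyps(1)[of "\<nu>(0 := n)"]
        unfolding eq by simp
    qed
  qed
qed

lemma raise_pos: "\<forall>i\<le>\<alpha>. \<nu> i \<ge> 1 \<Longrightarrow> \<forall>i\<le>\<alpha>. raise \<nu> i \<ge> 1"
  by (auto simp: raise_def)

lemma reflect_pos: "\<forall>i\<le>\<alpha>. \<nu> i \<ge> 1 \<Longrightarrow> \<nu> 0 \<ge> 2 \<Longrightarrow> \<forall>i\<le>Suc \<alpha>. reflect \<nu> i \<ge> 1"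
  by (auto simp: reflect_def)

lemma cfrac_pos: "\<forall>i\<le>\<alpha>. \<nu> i \<ge> 1 \<Longrightarrow> cfrac \<nu> \<alpha> > 0"
proof (induction \<nu> \<alpha> rule: cfrac.induct)
  case (2 \<nu> n)
  then show ?case by (auto intro!: add_nonneg_pos)
qed simp

lemma cfrac_raise: "cfrac (raise \<nu>) \<alpha> = cfrac \<nu> \<alpha> + 1"
  by (cases \<alpha>) (simp_all add: raise_def)

lemma cfrac_reflect:
  assumes "\<forall>i\<le>\<alpha>. \<nu> i \<ge> 1" "\<nu> 0 \<ge> 2"
  shows "cfrac (reflect \<nu>) (Suc \<alpha>) = cfrac \<nu> \<alpha> / (cfrac \<nu> \<alpha> - 1)" "cfrac \<nu> \<alpha> > 1"
proof -
  define \<mu> where "\<mu> = \<nu>(0 := \<nu> 0 - 1)"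
  have r: "raise \<mu> = \<nu>" using assms(2) by (auto simp: \<mu>_def raise_def)
  have c: "cfrac \<nu> \<alpha> = cfrac \<mu> \<alpha> + 1" using cfrac_raise[of \<mu> \<alpha>] unfolding r .
  have "\<forall>i\<le>\<alpha>. \<mu> i \<ge> 1" using assms by (auto simp: \<mu>_def)
  then have p: "cfrac \<mu> \<alpha> > 0" by (rule cfrac_pos)
  then show "cfrac \<nu> \<alpha> > 1" using c by simp
  have "(\<lambda>i. reflect \<nu> (Suc i)) = \<mu>" by (auto simp: reflect_def \<mu>_def)
  then have "cfrac (reflect \<nu>) (Suc \<alpha>) = 1 + 1 / cfrac \<mu> \<alpha>" by (simp add: reflect_def)
  then show "cfrac (reflect \<nu>) (Suc \<alpha>) = cfrac \<nu> \<alpha> / (cfrac \<nu> \<alpha> - 1)"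
    unfolding c using p by (simp add: field_simps)
qed

lemma mseq_raise: "mseq (raise \<nu>) (Suc i) = Suc (mseq \<nu> (Suc i))"
  by (induction i) (simp_all add: raise_def)

lemma mseq_reflect: "\<nu> 0 \<ge> 1 \<Longrightarrow> mseq (reflect \<nu>) (Suc i) = (if i = 0 then 1 else mseq \<nu> i)"
proof (induction i)
  case (Suc i)
  then show ?case by (cases i) (simp_all add: reflect_def)
qed (simp add: reflect_def)

lemma y_aux_raise: "y_aux (raise \<nu>) (Suc n) = y_aux \<nu> (Suc n) + z_aux \<nu> n"
proof (induction n rule: induct_nat_012)
  case (ge2 n)
  then show ?case by (simp add: raise_def algebra_simps)
qed (simp_all add: raise_def)

lemma z_aux_raise: "z_aux (raise \<nu>) n = z_aux \<nu> n"
  by (induction n rule: induct_nat_012) (simp_all add: raise_def)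

lemma y_aux_reflect: "\<nu> 0 \<ge> 1 \<Longrightarrow> y_aux (reflect \<nu>) (Suc (Suc n)) = y_aux \<nu> (Suc n)"
proof (induction n rule: induct_nat_012)
  case (ge2 n)
  then show ?case by (simp add: reflect_def)
qed (simp_all add: reflect_def)

lemma z_aux_reflect: "\<nu> 0 \<ge> 1 \<Longrightarrow> z_aux (reflect \<nu>) (Suc n) + z_aux \<nu> n = y_aux \<nu> (Suc n)"
proof (induction n rule: induct_nat_012)
  case (ge2 n)
  have "z_aux (reflect \<nu>) (Suc (Suc (Suc n))) =
      z_aux (reflect \<nu>) (Suc n) + \<nu> (Suc n) * z_aux (reflect \<nu>) (Suc (Suc n))"
    unfolding z_aux.simps(3)[of _ "Suc n"] by (simp add: reflect_def)
  then show ?case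
    using ge2(1,2)[OF ge2(3)] z_aux.simps(3)[of \<nu> n] y_aux.simps(3)[of \<nu> "Suc n"]
    by (simp only: add_mult_distrib2 [symmetric] ac_simps)
qed (simp_all add: reflect_def)

lemma ridx_cases:
  assumes "j \<le> mseq \<nu> (Suc \<alpha>)"
  obtains (last) "j = mseq \<nu> (Suc \<alpha>)" "ridx \<nu> \<alpha> j = Suc \<alpha>"
  | (block) i where "i \<le> \<alpha>" "mseq \<nu> i \<le> j" "j < mseq \<nu> (Suc i)" "ridx \<nu> \<alpha> j = i"
proof (cases "j = mseq \<nu> (Suc \<alpha>)")
  case True
  then show ?thesis using last ridx_last by blast
next
  case False
  then show ?thesis using block mseq_cover[of j \<nu> \<alpha>] ridx_eqI[of _ \<alpha> \<nu> j] assms by force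
qed

lemma ridx_raise:
  assumes "1 \<le> j" "j \<le> mseq \<nu> (Suc \<alpha>)"
  shows "ridx (raise \<nu>) \<alpha> (Suc j) = ridx \<nu> \<alpha> j"
  using assms(2)
proof (cases rule: ridx_cases)
  case last
  then show ?thesis using ridx_last[of "raise \<nu>" \<alpha>] unfolding mseq_raise by simp
next
  case (block i)
  have "mseq (raise \<nu>) i \<le> Suc j" using block(2) by (cases i) (simp_all add: mseq_raise del: mseq.simps(2))
  moreover have "Suc j < mseq (raise \<nu>) (Suc i)" using block(3) unfolding mseq_raise by simp
  ultimately show ?thesis using block(1,4) ridx_eqI[of i \<alpha> "raise \<nu>" "Suc j"] by simp
qed

lemma ridx_raise_first: "\<nu> 0 \<ge> 1 \<Longrightarrow> ridx (raise \<nu>) \<alpha> (Suc 0) = 0"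
  by (rule ridx_eqI) (simp_all add: raise_def)

lemma ridx_reflect:
  assumes "\<nu> 0 \<ge> 1" "1 \<le> j" "j \<le> mseq \<nu> (Suc \<alpha>)"
  shows "ridx (reflect \<nu>) (Suc \<alpha>) j = Suc (ridx \<nu> \<alpha> j)"
  using assms(3)
proof (cases rule: ridx_cases)
  case last
  then show ?thesis using ridx_last[of "reflect \<nu>" "Suc \<alpha>"] mseq_reflect[of \<nu> "Suc \<alpha>"] assms(1) by simp
next
  case (block i)
  have "mseq (reflect \<nu>) (Suc i) \<le> j" "j < mseq (reflect \<nu>) (Suc (Suc i))"
    unfolding mseq_reflect[of \<nu>, OF assms(1)] using block assms by auto
  then show ?thesis using block ridx_eqI[of "Suc i" "Suc \<alpha>" "reflect \<nu>" j] by simp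
qed

lemma ridx_first:
  assumes "\<forall>i\<le>\<alpha>. \<nu> i \<ge> 1"
  shows "ridx \<nu> \<alpha> 1 = (if \<nu> 0 = 1 then 1 else 0)"
proof -
  have n0: "\<nu> 0 \<ge> 1" using assms by simp
  show ?thesis
  proof (cases "\<nu> 0 = 1")
    case True
    show ?thesis
    proof (cases \<alpha>)
      case 0
      then show ?thesis using True ridx_last[of \<nu> 0] by simp
    next
      case (Suc a)
      then have "\<nu> 1 \<ge> 1" using assms by simp
      then show ?thesis using ridx_eqI[of 1 \<alpha> \<nu> 1] Suc True by simp
    qed
  next
    case False
    then show ?thesis using ridx_eqI[of 0 \<alpha> \<nu> 1] n0 by simp
  qed
qed

lemma nseq_aux:
  "nseq \<nu> \<alpha> j = y_aux \<nu> (ridx \<nu> \<alpha> j) + (j - mseq \<nu> (ridx \<nu> \<alpha> j)) * y_aux \<nu> (Suc (ridx \<nu> \<alpha> j))"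
  by (simp add: nseq_def yseq_def Let_def nat_add_distrib)

text \<open>The companion of \<open>nseq\<close> built from the sequence \<open>z\<close> in place of \<open>y\<close>, one index lower:
  \<open>z\<^bsub>i-2\<^esub> + (j - m\<^sub>i) z\<^bsub>i-1\<^esub>\<close> for \<open>i = r(j)\<close>, where \<open>z\<^bsub>-2\<^esub> = 1\<close>. The pair of weights
  \<open>(n, w)\<close> transforms linearly under the two moves: \<open>raise\<close> prepends \<open>(1, 1)\<close> to the entries of
  \<open>(n + w, w)\<close>, and \<open>reflect\<close> yields \<open>(n, n - w)\<close>.\<close>

definition wseq :: "(nat \<Rightarrow> nat) \<Rightarrow> nat \<Rightarrow> nat \<Rightarrow> nat" where
  "wseq \<nu> \<alpha> j = (let i = ridx \<nu> \<alpha> j in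
     if i = 0 then 1 else z_aux \<nu> (i - 1) + (j - mseq \<nu> i) * z_aux \<nu> i)"

context
  fixes \<nu> :: "nat \<Rightarrow> nat" and \<alpha> :: nat
  assumes pos: "\<forall>i\<le>\<alpha>. \<nu> i \<ge> 1"
begin

lemma first_pos: "\<nu> 0 \<ge> 1"
  using pos by simp

lemma last_pos: "mseq \<nu> (Suc \<alpha>) \<ge> 1"
proof -
  have "1 \<le> mseq \<nu> 1" using first_pos by simp
  also have "\<dots> \<le> mseq \<nu> (Suc \<alpha>)" by (intro mseq_mono) simp
  finally show ?thesis .
qed

lemma nseq_first: "nseq \<nu> \<alpha> 1 = 1"
  unfolding nseq_aux ridx_first[OF pos] by simp

lemma wseq_first: "wseq \<nu> \<alpha> 1 = (if \<nu> 0 = 1 then 0 else 1)"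
  unfolding wseq_def ridx_first[OF pos] by simp

lemma eps_first: "eps \<nu> \<alpha> 1 = (if \<nu> 0 = 1 then -1 else 1)"
  unfolding eps_def ridx_first[OF pos] by simp

lemma centry_raise_first:
  "centry (raise \<nu>) \<alpha> 1 1 = (if \<nu> 0 = 1 then 1 else 2)"
  using last_pos ridx_raise_first[of \<nu>, OF first_pos, of \<alpha>] mseq_raise[of \<nu> \<alpha>] mseq_raise[of \<nu> 0]
  by (auto simp: centry_def)

lemma centry_raise_off:
  assumes "1 \<le> j" "j \<le> mseq \<nu> (Suc \<alpha>)"
  shows "centry (raise \<nu>) \<alpha> 1 (Suc j) = (if j = 1 then - eps \<nu> \<alpha> 1 else 0)"
    "centry (raise \<nu>) \<alpha> (Suc j) 1 = (if j = 1 then - eps \<nu> \<alpha> 1 else 0)"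
  using assms ridx_raise[OF assms] by (auto simp: centry_def eps_def)

lemma centry_raise:
  assumes "1 \<le> i" "i \<le> mseq \<nu> (Suc \<alpha>)" "1 \<le> j" "j \<le> mseq \<nu> (Suc \<alpha>)"
  shows "centry (raise \<nu>) \<alpha> (Suc i) (Suc j) = centry \<nu> \<alpha> i j"
  using ridx_raise[OF assms(1,2)] ridx_raise[OF assms(3,4)] mseq_raise[of \<nu> \<alpha>]
    mseq_raise[of \<nu> "ridx \<nu> \<alpha> i"] mseq_raise[of \<nu> "ridx \<nu> \<alpha> j"]
  by (auto simp: centry_def)

lemma eps_raise: "1 \<le> j \<Longrightarrow> j \<le> mseq \<nu> (Suc \<alpha>) \<Longrightarrow> eps (raise \<nu>) \<alpha> (Suc j) = eps \<nu> \<alpha> j"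
  by (simp add: eps_def ridx_raise)

lemma eps_raise_first: "eps (raise \<nu>) \<alpha> 1 = 1"
  using ridx_raise_first[of \<nu>, OF first_pos] by (simp add: eps_def)

lemma nseq_raise:
  assumes "1 \<le> j" "j \<le> mseq \<nu> (Suc \<alpha>)"
  shows "nseq (raise \<nu>) \<alpha> (Suc j) = nseq \<nu> \<alpha> j + wseq \<nu> \<alpha> j"
proof (cases "ridx \<nu> \<alpha> j")
  case 0
  then show ?thesis unfolding nseq_aux wseq_def ridx_raise[OF assms] by simp
next
  case (Suc i)
  show ?thesis unfolding nseq_aux wseq_def ridx_raise[OF assms] Suc mseq_raise y_aux_raise Let_def
    by (simp only: diff_Suc_Suc) (simp add: algebra_simps del: mseq.simps y_aux.simps z_aux.simps)
qed

lemma nseq_raise_first: "nseq (raise \<nu>) \<alpha> 1 = 1"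
  unfolding nseq_aux using ridx_raise_first[of \<nu>, OF first_pos] by simp

lemma wseq_raise:
  assumes "1 \<le> j" "j \<le> mseq \<nu> (Suc \<alpha>)"
  shows "wseq (raise \<nu>) \<alpha> (Suc j) = wseq \<nu> \<alpha> j"
proof (cases "ridx \<nu> \<alpha> j")
  case 0
  then show ?thesis unfolding wseq_def ridx_raise[OF assms] by simp
next
  case (Suc i)
  show ?thesis unfolding wseq_def ridx_raise[OF assms] Suc Let_def mseq_raise z_aux_raise
    by (simp del: mseq.simps z_aux.simps)
qed

lemma wseq_raise_first: "wseq (raise \<nu>) \<alpha> 1 = 1"
  unfolding wseq_def using ridx_raise_first[of \<nu>, OF first_pos] by simp

lemma mseq_reflect_last: "mseq (reflect \<nu>) (Suc (Suc \<alpha>)) = mseq \<nu> (Suc \<alpha>)"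
  using mseq_reflect[of \<nu> "Suc \<alpha>"] first_pos by simp

lemma centry_reflect:
  assumes "1 \<le> i" "i \<le> mseq \<nu> (Suc \<alpha>)" "1 \<le> j" "j \<le> mseq \<nu> (Suc \<alpha>)"
  shows "centry (reflect \<nu>) (Suc \<alpha>) i j = - centry \<nu> \<alpha> i j"
  using ridx_reflect[of \<nu>, OF first_pos assms(1,2)] ridx_reflect[of \<nu>, OF first_pos assms(3,4)] mseq_reflect_last
    mseq_reflect[of \<nu> "Suc (ridx \<nu> \<alpha> j)"] first_pos
  by (auto simp: centry_def simp del: mseq.simps)

lemma eps_reflect:
  "1 \<le> j \<Longrightarrow> j \<le> mseq \<nu> (Suc \<alpha>) \<Longrightarrow> eps (reflect \<nu>) (Suc \<alpha>) j = - eps \<nu> \<alpha> j"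
  by (simp add: eps_def ridx_reflect[of \<nu>, OF first_pos])

lemma nseq_reflect:
  assumes "1 \<le> j" "j \<le> mseq \<nu> (Suc \<alpha>)"
  shows "nseq (reflect \<nu>) (Suc \<alpha>) j = nseq \<nu> \<alpha> j"
proof (cases "ridx \<nu> \<alpha> j")
  case 0
  then show ?thesis
    unfolding nseq_aux ridx_reflect[of \<nu>, OF first_pos assms] using assms
    by (simp add: reflect_def)
next
  case (Suc i)
  show ?thesis unfolding nseq_aux ridx_reflect[of \<nu>, OF first_pos assms] Suc
    using mseq_reflect[of \<nu> "Suc i"] y_aux_reflect[of \<nu> i] y_aux_reflect[of \<nu> "Suc i"] first_pos
    by (simp del: mseq.simps y_aux.simps)
qed

lemma wseq_reflect:
  assumes "1 \<le> j" "j \<le> mseq \<nu> (Suc \<alpha>)"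
  shows "wseq (reflect \<nu>) (Suc \<alpha>) j + wseq \<nu> \<alpha> j = nseq \<nu> \<alpha> j"
proof (cases "ridx \<nu> \<alpha> j")
  case 0
  then show ?thesis
    unfolding nseq_aux wseq_def ridx_reflect[of \<nu>, OF first_pos assms] using assms
    by (simp add: reflect_def)
next
  case (Suc i)
  have 1: "mseq (reflect \<nu>) (Suc (Suc i)) = mseq \<nu> (Suc i)"
    using mseq_reflect[of \<nu> "Suc i"] first_pos by simp
  have "wseq (reflect \<nu>) (Suc \<alpha>) j + wseq \<nu> \<alpha> j =
      (z_aux (reflect \<nu>) (Suc i) + z_aux \<nu> i) +
      (j - mseq \<nu> (Suc i)) * (z_aux (reflect \<nu>) (Suc (Suc i)) + z_aux \<nu> (Suc i))"
    unfolding wseq_def ridx_reflect[of \<nu>, OF first_pos assms] Suc Let_def 1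
    by (simp add: algebra_simps del: mseq.simps y_aux.simps z_aux.simps)
  then show ?thesis unfolding z_aux_reflect[of \<nu>, OF first_pos] nseq_aux Suc .
qed

end

section \<open>The energy of a configuration\<close>

abbreviation nvars :: "(nat \<Rightarrow> nat) \<Rightarrow> nat \<Rightarrow> nat" where
  "nvars \<nu> \<alpha> \<equiv> mseq \<nu> (Suc \<alpha>)"

definition lform :: "(nat \<Rightarrow> nat) \<Rightarrow> nat \<Rightarrow> (nat \<Rightarrow> 'a::comm_semiring_1) \<Rightarrow> 'a" where
  "lform \<nu> \<alpha> lam = (\<Sum>j = 1..nvars \<nu> \<alpha>. of_nat (nseq \<nu> \<alpha> j) * lam j)"

definition wform :: "(nat \<Rightarrow> nat) \<Rightarrow> nat \<Rightarrow> (nat \<Rightarrow> 'a::comm_semiring_1) \<Rightarrow> 'a" where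
  "wform \<nu> \<alpha> lam = (\<Sum>j = 1..nvars \<nu> \<alpha>. of_nat (wseq \<nu> \<alpha> j) * lam j)"

text \<open>The equation \<open>\<Theta>\<^sup>-\<^sup>1 \<mu> = \<lambda>~\<close> by components. It is stated for rational \<open>\<lambda>\<close>, because removing
  the first variable from it changes the next entry of \<open>\<lambda>\<close> by a fraction.\<close>

definition solves :: "(nat \<Rightarrow> nat) \<Rightarrow> nat \<Rightarrow> (nat \<Rightarrow> rat) \<Rightarrow> (nat \<Rightarrow> rat) \<Rightarrow> bool" where
  "solves \<nu> \<alpha> lam \<mu> \<longleftrightarrow> (\<forall>j\<in>{1..nvars \<nu> \<alpha>}.
     (\<Sum>i = 1..nvars \<nu> \<alpha>. of_int (centry \<nu> \<alpha> j i) * \<mu> i) = of_int (eps \<nu> \<alpha> j) * lam j)"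

definition pairing :: "(nat \<Rightarrow> nat) \<Rightarrow> nat \<Rightarrow> (nat \<Rightarrow> rat) \<Rightarrow> (nat \<Rightarrow> rat) \<Rightarrow> rat" where
  "pairing \<nu> \<alpha> lam \<mu> = (\<Sum>j = 1..nvars \<nu> \<alpha>. of_int (eps \<nu> \<alpha> j) * lam j * \<mu> j)"

text \<open>The exponent \<open>l\<^sup>2 / p + \<lambda>~ \<Theta> \<lambda>~\<^sup>t\<close> of \<open>q\<close>. Its value does not depend on the chosen solution,
  by \<open>pairing_swap\<close>.\<close>

definition energy :: "(nat \<Rightarrow> nat) \<Rightarrow> nat \<Rightarrow> (nat \<Rightarrow> rat) \<Rightarrow> rat" where
  "energy \<nu> \<alpha> lam = (lform \<nu> \<alpha> lam)\<^sup>2 / cfrac \<nu> \<alpha> +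
     pairing \<nu> \<alpha> lam (SOME \<mu>. solves \<nu> \<alpha> lam \<mu>)"

lemma sum_first: "(\<Sum>j = 1..Suc n. f j) = f 1 + (\<Sum>j = 1..n. f (Suc j))"
  by (simp add: sum.atLeast_Suc_atMost sum.shift_bounds_cl_Suc_ivl del: sum.cl_ivl_Suc)

lemma nvars_raise: "nvars (raise \<nu>) \<alpha> = Suc (nvars \<nu> \<alpha>)"
  by (rule mseq_raise)

lemma centry_sym: "centry \<nu> \<alpha> i j = centry \<nu> \<alpha> j i"
  by (simp add: centry_def)

text \<open>Symmetry of the inverse of a symmetric matrix.\<close>

lemma pairing_swap:
  assumes "solves \<nu> \<alpha> lam \<mu>" "solves \<nu> \<alpha> lam' \<mu>'"
  shows "pairing \<nu> \<alpha> lam \<mu>' = pairing \<nu> \<alpha> lam' \<mu>"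
proof -
  let ?I = "{1..nvars \<nu> \<alpha>}"
  have "pairing \<nu> \<alpha> lam \<mu>' = (\<Sum>j\<in>?I. \<Sum>i\<in>?I. of_int (centry \<nu> \<alpha> j i) * \<mu> i * \<mu>' j)"
    using assms(1) unfolding pairing_def solves_def
    by (intro sum.cong refl) (simp flip: sum_distrib_right)
  also have "\<dots> = (\<Sum>i\<in>?I. \<Sum>j\<in>?I. of_int (centry \<nu> \<alpha> i j) * \<mu>' j * \<mu> i)"
    by (subst sum.swap) (simp add: centry_sym[of \<nu> \<alpha> _ _] mult_ac)
  also have "\<dots> = pairing \<nu> \<alpha> lam' \<mu>"
    using assms(2) unfolding pairing_def solves_def
    by (intro sum.cong refl) (simp flip: sum_distrib_right)
  finally show ?thesis .
qed

context
  fixes \<nu> :: "nat \<Rightarrow> nat" and \<alpha> :: nat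
  assumes pos: "\<forall>i\<le>\<alpha>. \<nu> i \<ge> 1"
begin

lemma lform_raise:
  "lform (raise \<nu>) \<alpha> lam = lform \<nu> \<alpha> (\<lambda>j. lam (Suc j)) + wform (raise \<nu>) \<alpha> lam"
  "wform (raise \<nu>) \<alpha> lam = lam 1 + wform \<nu> \<alpha> (\<lambda>j. lam (Suc j))"
proof -
  show w: "wform (raise \<nu>) \<alpha> lam = lam 1 + wform \<nu> \<alpha> (\<lambda>j. lam (Suc j))"
    unfolding wform_def nvars_raise sum_first wseq_raise_first[OF pos]
    using wseq_raise[OF pos] by simp
  show "lform (raise \<nu>) \<alpha> lam = lform \<nu> \<alpha> (\<lambda>j. lam (Suc j)) + wform (raise \<nu>) \<alpha> lam"
    unfolding w unfolding lform_def wform_def nvars_raise sum_first nseq_raise_first[OF pos]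
    using nseq_raise[OF pos] by (simp add: sum.distrib distrib_right add_ac)
qed

lemma lform_reflect:
  "lform (reflect \<nu>) (Suc \<alpha>) lam = lform \<nu> \<alpha> lam"
  "wform (reflect \<nu>) (Suc \<alpha>) lam + wform \<nu> \<alpha> lam = lform \<nu> \<alpha> lam"
proof -
  show "lform (reflect \<nu>) (Suc \<alpha>) lam = lform \<nu> \<alpha> lam"
    unfolding lform_def mseq_reflect_last[OF pos] using nseq_reflect[OF pos] by (intro sum.cong) auto
  show "wform (reflect \<nu>) (Suc \<alpha>) lam + wform \<nu> \<alpha> lam = lform \<nu> \<alpha> lam"
    unfolding lform_def wform_def mseq_reflect_last[OF pos] sum.distrib[symmetric]
      distrib_right[symmetric] of_nat_add[symmetric]
    using wseq_reflect[OF pos] by (intro sum.cong) auto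
qed

lemma solves_reflect: "solves (reflect \<nu>) (Suc \<alpha>) lam \<mu> \<longleftrightarrow> solves \<nu> \<alpha> lam \<mu>"
proof -
  have "(\<Sum>i = 1..nvars \<nu> \<alpha>. of_int (centry (reflect \<nu>) (Suc \<alpha>) j i) * \<mu> i) =
      - (\<Sum>i = 1..nvars \<nu> \<alpha>. of_int (centry \<nu> \<alpha> j i) * \<mu> i)" if "j \<in> {1..nvars \<nu> \<alpha>}" for j
    unfolding sum_negf[symmetric] using that centry_reflect[OF pos] by (intro sum.cong) auto
  then show ?thesis
    unfolding solves_def mseq_reflect_last[OF pos] using eps_reflect[OF pos] by auto
qed

text \<open>After \<open>raise\<close> the matrix is bordered by one row and column whose only off-diagonal entry
  couples the first two variables. Moving that entry to the right-hand side leaves the system of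
  the smaller matrix, with the second entry of \<open>\<lambda>\<close> increased by \<open>\<mu>\<^sub>1\<close>; the sign of the coupling is
  such that this holds for either sign of \<open>\<epsilon>(1)\<close>.\<close>

lemma solves_raise:
  assumes "solves (raise \<nu>) \<alpha> lam \<mu>"
  defines "lam' \<equiv> \<lambda>j. lam (Suc j)" and "\<mu>' \<equiv> \<lambda>j. \<mu> (Suc j)"
  shows "solves \<nu> \<alpha> (lam'(1 := lam' 1 + \<mu> 1)) \<mu>'"
    and "of_int (centry (raise \<nu>) \<alpha> 1 1) * \<mu> 1 - of_int (eps \<nu> \<alpha> 1) * \<mu>' 1 = lam 1"
proof -
  have s: "(\<Sum>i = 1..nvars \<nu> \<alpha>. of_int (centry (raise \<nu>) \<alpha> 1 (Suc i)) * \<mu>' i) = - of_int (eps \<nu> \<alpha> 1) * \<mu>' 1"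
  proof -
    have "(\<Sum>i = 1..nvars \<nu> \<alpha>. of_int (centry (raise \<nu>) \<alpha> 1 (Suc i)) * \<mu>' i) =
        (\<Sum>i = 1..nvars \<nu> \<alpha>. if i = 1 then - of_int (eps \<nu> \<alpha> 1) * \<mu>' 1 else 0)"
      using centry_raise_off(1)[OF pos] by (intro sum.cong) auto
    then show ?thesis using last_pos[OF pos] by simp
  qed
  have e1: "of_int (centry (raise \<nu>) \<alpha> 1 1) * \<mu> 1 +
     (\<Sum>i = 1..nvars \<nu> \<alpha>. of_int (centry (raise \<nu>) \<alpha> 1 (Suc i)) * \<mu>' i) = of_int (eps (raise \<nu>) \<alpha> 1) * lam 1"
    using assms(1) unfolding solves_def nvars_raise sum_first \<mu>'_def by auto
  show "of_int (centry (raise \<nu>) \<alpha> 1 1) * \<mu> 1 - of_int (eps \<nu> \<alpha> 1) * \<mu>' 1 = lam 1"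
    using e1 unfolding s eps_raise_first[OF pos] by simp
  show "solves \<nu> \<alpha> (lam'(1 := lam' 1 + \<mu> 1)) \<mu>'"
    unfolding solves_def
  proof
    fix j assume j: "j \<in> {1..nvars \<nu> \<alpha>}"
    have "of_int (centry (raise \<nu>) \<alpha> (Suc j) 1) * \<mu> 1 +
       (\<Sum>i = 1..nvars \<nu> \<alpha>. of_int (centry (raise \<nu>) \<alpha> (Suc j) (Suc i)) * \<mu>' i) =
       of_int (eps (raise \<nu>) \<alpha> (Suc j)) * lam' j"
      using assms(1) j unfolding solves_def nvars_raise sum_first \<mu>'_def lam'_def by auto
    moreover have "(\<Sum>i = 1..nvars \<nu> \<alpha>. of_int (centry (raise \<nu>) \<alpha> (Suc j) (Suc i)) * \<mu>' i) =
        (\<Sum>i = 1..nvars \<nu> \<alpha>. of_int (centry \<nu> \<alpha> j i) * \<mu>' i)"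
      using centry_raise[OF pos] j by (intro sum.cong) auto
    ultimately show "(\<Sum>i = 1..nvars \<nu> \<alpha>. of_int (centry \<nu> \<alpha> j i) * \<mu>' i) =
        of_int (eps \<nu> \<alpha> j) * (lam'(1 := lam' 1 + \<mu> 1)) j"
      using centry_raise_off(2)[OF pos, of j] eps_raise[OF pos, of j] j by (auto simp: algebra_simps)
  qed
qed

lemma lform_update:
  "lform \<nu> \<alpha> (lam(1 := lam 1 + t)) = lform \<nu> \<alpha> lam + (t::rat)"
  "wform \<nu> \<alpha> (lam(1 := lam 1 + t)) = wform \<nu> \<alpha> lam + of_nat (wseq \<nu> \<alpha> 1) * t"
proof -
  have *: "(\<Sum>j = 1..nvars \<nu> \<alpha>. f j * (lam(1 := lam 1 + t)) j) =
      (\<Sum>j = 1..nvars \<nu> \<alpha>. f j * lam j) + f 1 * t" for f :: "nat \<Rightarrow> rat"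
  proof -
    have "(\<Sum>j = 1..nvars \<nu> \<alpha>. f j * (lam(1 := lam 1 + t)) j) =
        (\<Sum>j = 1..nvars \<nu> \<alpha>. f j * lam j + (if j = 1 then f 1 * t else 0))"
      by (intro sum.cong) (auto simp: distrib_left)
    then show ?thesis using last_pos[OF pos] by (simp add: sum.distrib)
  qed
  show "lform \<nu> \<alpha> (lam(1 := lam 1 + t)) = lform \<nu> \<alpha> lam + t"
    unfolding lform_def * nseq_first[OF pos] by simp
  show "wform \<nu> \<alpha> (lam(1 := lam 1 + t)) = wform \<nu> \<alpha> lam + of_nat (wseq \<nu> \<alpha> 1) * t"
    unfolding wform_def * ..
qed

lemma solves_exists: "\<exists>\<mu>. solves \<nu> \<alpha> lam \<mu>"
proof -
  define x where "x = vec (nvars \<nu> \<alpha>) (\<lambda>j. of_int (eps \<nu> \<alpha> (Suc j)) * lam (Suc j))"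
  define T where "T = Theta \<nu> \<alpha> *\<^sub>v x"
  note th = Theta_eq[OF pos]
  have C: "Cmat \<nu> \<alpha> \<in> carrier_mat (nvars \<nu> \<alpha>) (nvars \<nu> \<alpha>)" by (simp add: Cmat_def)
  have x: "x \<in> carrier_vec (nvars \<nu> \<alpha>)" by (simp add: x_def)
  have T: "T \<in> carrier_vec (nvars \<nu> \<alpha>)" unfolding T_def by (rule mult_mat_vec_carrier[OF th(4) x])
  have CT: "Cmat \<nu> \<alpha> *\<^sub>v T = x"
    unfolding T_def assoc_mult_mat_vec[OF C th(4) x, symmetric] th(2) using x by simp
  have "solves \<nu> \<alpha> lam (\<lambda>j. T $ (j - 1))"
    unfolding solves_def
  proof
    fix j assume j: "j \<in> {1..nvars \<nu> \<alpha>}"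
    then have j': "j - 1 < nvars \<nu> \<alpha>" "Suc (j - 1) = j" by auto
    then have "(Cmat \<nu> \<alpha> *\<^sub>v T) $ (j - 1) = (\<Sum>i<nvars \<nu> \<alpha>. of_int (centry \<nu> \<alpha> j (Suc i)) * T $ i)"
      using C T by (simp add: scalar_prod_def Cmat_def atLeast0LessThan del: mseq.simps)
    also have "\<dots> = (\<Sum>i = 1..nvars \<nu> \<alpha>. of_int (centry \<nu> \<alpha> j i) * T $ (i - 1))"
      by (rule sum.reindex_bij_witness[of _ "\<lambda>i. i - 1" Suc]) auto
    finally show "(\<Sum>i = 1..nvars \<nu> \<alpha>. of_int (centry \<nu> \<alpha> j i) * T $ (i - 1)) =
        of_int (eps \<nu> \<alpha> j) * lam j"
      unfolding CT x_def index_vec[OF j'(1)] j'(2) by simp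
  qed
  then show ?thesis by (rule exI[of _ "\<lambda>j. T $ (j - 1)"])
qed

lemma energy_eq: "solves \<nu> \<alpha> lam \<mu> \<Longrightarrow> energy \<nu> \<alpha> lam = (lform \<nu> \<alpha> lam)\<^sup>2 / cfrac \<nu> \<alpha> + pairing \<nu> \<alpha> lam \<mu>"
  unfolding energy_def using pairing_swap someI_ex[OF solves_exists] by metis

lemma Bform_energy:
  "(of_nat (lform \<nu> \<alpha> lam))\<^sup>2 / cfrac \<nu> \<alpha> + 1 / 2 * Bform \<nu> \<alpha> lam = energy \<nu> \<alpha> (\<lambda>j. of_nat (lam j))"
proof -
  obtain \<mu> where \<mu>: "solves \<nu> \<alpha> (\<lambda>j. of_nat (lam j)) \<mu>" using solves_exists by blast
  define x where "x = lam_tilde \<nu> \<alpha> lam"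
  define m where "m = vec (nvars \<nu> \<alpha>) (\<lambda>j. \<mu> (Suc j))"
  note th = Theta_eq[OF pos]
  have C: "Cmat \<nu> \<alpha> \<in> carrier_mat (nvars \<nu> \<alpha>) (nvars \<nu> \<alpha>)" by (simp add: Cmat_def)
  have x: "x \<in> carrier_vec (nvars \<nu> \<alpha>)" by (simp add: x_def lam_tilde_def)
  have m: "m \<in> carrier_vec (nvars \<nu> \<alpha>)" by (simp add: m_def)
  have "Cmat \<nu> \<alpha> *\<^sub>v m = x"
  proof (rule eq_vecI)
    fix j assume "j < dim_vec x"
    then have j: "j < nvars \<nu> \<alpha>" using x by simp
    have "(Cmat \<nu> \<alpha> *\<^sub>v m) $ j = (\<Sum>i<nvars \<nu> \<alpha>. of_int (centry \<nu> \<alpha> (Suc j) (Suc i)) * \<mu> (Suc i))"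
      using j by (simp add: scalar_prod_def Cmat_def m_def atLeast0LessThan del: mseq.simps)
    also have "\<dots> = (\<Sum>i = 1..nvars \<nu> \<alpha>. of_int (centry \<nu> \<alpha> (Suc j) i) * \<mu> i)"
      by (rule sum.reindex_bij_witness[of _ "\<lambda>i. i - 1" Suc]) auto
    also have "\<dots> = x $ j"
      using \<mu> j unfolding solves_def x_def lam_tilde_def by (simp del: mseq.simps)
    finally show "(Cmat \<nu> \<alpha> *\<^sub>v m) $ j = x $ j" .
  qed (use C x in auto)
  then have "Theta \<nu> \<alpha> *\<^sub>v x = (Theta \<nu> \<alpha> * Cmat \<nu> \<alpha>) *\<^sub>v m"
    using assoc_mult_mat_vec[OF th(4) C m] by simp
  then have Tx: "Theta \<nu> \<alpha> *\<^sub>v x = m" unfolding th(3) using m by simp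
  have "Bmat \<nu> \<alpha> *\<^sub>v x = 2 \<cdot>\<^sub>v m"
    unfolding Bmat_def Tx[symmetric] using th(4) x by (intro eq_vecI) (auto simp: scalar_prod_def sum_distrib_left mult_ac)
  then have "Bform \<nu> \<alpha> lam = x \<bullet> (2 \<cdot>\<^sub>v m)" unfolding Bform_def x_def by simp
  also have "\<dots> = 2 * (x \<bullet> m)" using x m by simp
  also have "x \<bullet> m = (\<Sum>i<nvars \<nu> \<alpha>. of_int (eps \<nu> \<alpha> (Suc i)) * of_nat (lam (Suc i)) * \<mu> (Suc i))"
    by (simp add: scalar_prod_def x_def lam_tilde_def m_def atLeast0LessThan del: mseq.simps)
  also have "\<dots> = pairing \<nu> \<alpha> (\<lambda>j. of_nat (lam j)) \<mu>"
    unfolding pairing_def by (rule sum.reindex_bij_witness[of _ "\<lambda>i. i - 1" Suc]) auto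
  finally show ?thesis unfolding energy_eq[OF \<mu>] by (simp add: lform_def del: mseq.simps)
qed

end

text \<open>The first row of \<open>\<Theta>\<close>, which is what the recursion for the energy needs. Under \<open>raise\<close> it
  follows by applying the induction hypothesis to the smaller system with its modified right-hand
  side and solving the first equation for \<open>\<mu>\<^sub>1\<close>.\<close>

lemma solution_first:
  assumes "\<forall>i\<le>\<alpha>. \<nu> i \<ge> 1" "solves \<nu> \<alpha> lam \<mu>"
  shows "\<mu> 1 = of_int (eps \<nu> \<alpha> 1) * (wform \<nu> \<alpha> lam - lform \<nu> \<alpha> lam / cfrac \<nu> \<alpha>)"
  using assms
proof (induction \<nu> \<alpha> arbitrary: lam \<mu> rule: cfrac_moves_induct)
  case (one \<nu>)
  then have p: "\<forall>i\<le>0. \<nu> i \<ge> 1" by simp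
  have "centry \<nu> 0 1 1 = -1" using one by (simp add: centry_def)
  then show ?case using one eps_first[OF p] wseq_first[OF p] nseq_first[OF p]
    by (simp add: solves_def wform_def lform_def)
next
  case (raise \<nu> \<alpha>)
  define p where "p = cfrac \<nu> \<alpha>"
  define s :: rat where "s = of_int (eps \<nu> \<alpha> 1)"
  define w :: rat where "w = of_nat (wseq \<nu> \<alpha> 1)"
  define L where "L = lform \<nu> \<alpha> (\<lambda>j. lam (Suc j))"
  define W where "W = wform \<nu> \<alpha> (\<lambda>j. lam (Suc j))"
  have p0: "p > 0" unfolding p_def by (rule cfrac_pos[OF raise(1)])
  note st = solves_raise[OF raise(1,3)]
  \<comment> \<open>Here \<open>n\<^sub>1 = 1\<close>, and \<open>w\<close> is the weight \<open>w\<^sub>1\<close> of the entry that was increased by \<open>\<mu>\<^sub>1\<close>.\<close>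
  have m2: "\<mu> (Suc 1) = s * (W + w * \<mu> 1 - (L + \<mu> 1) / p)"
    using raise(2)[OF st(1)] unfolding lform_update[OF raise(1), of "\<lambda>j. lam (Suc j)" "\<mu> 1"]
    unfolding s_def w_def L_def W_def p_def by simp
  have ss: "s * (s * x) = x" for x using eps_first[OF raise(1)] by (simp add: s_def)
  have c: "of_int (centry (raise \<nu>) \<alpha> 1 1) = 1 + w"
    using centry_raise_first[OF raise(1)] wseq_first[OF raise(1)] by (simp add: w_def)
  have "(1 + w) * \<mu> 1 - s * \<mu> (Suc 1) = lam 1" using st(2) unfolding c s_def .
  then have "(1 + w) * \<mu> 1 - (W + w * \<mu> 1 - (L + \<mu> 1) / p) = lam 1" unfolding m2 ss .
  then have "\<mu> 1 * (p + 1) = (lam 1 + W) * p - L" using p0 by (simp add: field_simps)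
  then have "\<mu> 1 = (lam 1 + W) - (L + (lam 1 + W)) / (p + 1)" using p0 by (simp add: field_simps)
  then show ?case
    unfolding eps_raise_first[OF raise(1)] lform_raise[OF raise(1)] cfrac_raise L_def W_def p_def by simp
next
  case (reflect \<nu> \<alpha>)
  note pos = reflect(1)
  have p: "cfrac \<nu> \<alpha> > 1" using cfrac_reflect[OF reflect(1,2)] by simp
  have "solves \<nu> \<alpha> lam \<mu>" using reflect(4) solves_reflect[OF pos] by simp
  from reflect(3)[OF this] have m: "\<mu> 1 = wform \<nu> \<alpha> lam - lform \<nu> \<alpha> lam / cfrac \<nu> \<alpha>"
    using eps_first[OF pos] reflect(2) by simp
  have e: "eps (reflect \<nu>) (Suc \<alpha>) 1 = -1"
    using eps_first[OF reflect_pos[OF reflect(1,2)]] by (simp add: reflect_def)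
  have w: "wform (reflect \<nu>) (Suc \<alpha>) lam = lform \<nu> \<alpha> lam - wform \<nu> \<alpha> lam"
    using lform_reflect(2)[OF pos, of lam] by (simp add: algebra_simps)
  show ?case
    unfolding m e w lform_reflect(1)[OF pos] cfrac_reflect(1)[OF reflect(1,2)] using p
    by (simp add: field_simps)
qed

lemma energy_one:
  assumes "\<nu> 0 = 1"
  shows "energy \<nu> 0 lam = 0"
proof -
  have p: "\<forall>i\<le>0. \<nu> i \<ge> 1" using assms by simp
  obtain \<mu> where \<mu>: "solves \<nu> 0 lam \<mu>" using solves_exists[OF p] by blast
  have "centry \<nu> 0 1 1 = -1" using assms by (simp add: centry_def)
  then have "\<mu> 1 = lam 1" using \<mu> eps_first[OF p] assms by (simp add: solves_def)
  then show ?thesis unfolding energy_eq[OF p \<mu>] using assms eps_first[OF p] nseq_first[OF p]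
    by (simp add: lform_def pairing_def power2_eq_square)
qed

text \<open>Completing the square in the first variable. By \<open>pairing_swap\<close> the modification of the smaller
  system contributes \<open>\<mu>\<^sub>1 (w\<cdot>\<lambda>' - n\<cdot>\<lambda>' / p)\<close>, and the value of \<open>\<mu>\<^sub>1\<close> from \<open>solution_first\<close> turns the
  difference of the energies into the square of \<open>w\<cdot>\<lambda>\<close>.\<close>

lemma energy_raise:
  assumes pos: "\<forall>i\<le>\<alpha>. \<nu> i \<ge> 1"
  shows "energy (raise \<nu>) \<alpha> lam = (wform (raise \<nu>) \<alpha> lam)\<^sup>2 + energy \<nu> \<alpha> (\<lambda>j. lam (Suc j))"
proof -
  define p where "p = cfrac \<nu> \<alpha>"
  define lam' where "lam' = (\<lambda>j. lam (Suc j))"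
  define L where "L = lform \<nu> \<alpha> lam'"
  define W where "W = wform \<nu> \<alpha> lam'"
  define v where "v = lam 1 + W"
  have p0: "p > 0" unfolding p_def by (rule cfrac_pos[OF pos])
  obtain \<mu> where \<mu>: "solves (raise \<nu>) \<alpha> lam \<mu>" using solves_exists[OF raise_pos[OF pos]] by blast
  obtain \<mu>0 where \<mu>0: "solves \<nu> \<alpha> lam' \<mu>0" using solves_exists[OF pos] by blast
  have v: "wform (raise \<nu>) \<alpha> lam = v" "lform (raise \<nu>) \<alpha> lam = L + v"
    unfolding lform_raise[OF pos] v_def W_def L_def lam'_def by simp_all
  have m1: "\<mu> 1 = v - (L + v) / (p + 1)"
    using solution_first[OF raise_pos[OF pos] \<mu>]
    unfolding eps_raise_first[OF pos] v cfrac_raise p_def by simp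
  have ee: "of_int (eps \<nu> \<alpha> 1) * of_int (eps \<nu> \<alpha> 1) = (1::rat)"
    using eps_first[OF pos] by simp
  have "pairing \<nu> \<alpha> lam' (\<lambda>j. \<mu> (Suc j)) = pairing \<nu> \<alpha> (lam'(1 := lam' 1 + \<mu> 1)) \<mu>0"
    using pairing_swap[OF \<mu>0 solves_raise(1)[OF pos \<mu>]] unfolding lam'_def .
  also have "\<dots> = (\<Sum>j = 1..nvars \<nu> \<alpha>. of_int (eps \<nu> \<alpha> j) * lam' j * \<mu>0 j +
      (if j = 1 then of_int (eps \<nu> \<alpha> 1) * \<mu> 1 * \<mu>0 1 else 0))"
    unfolding pairing_def by (intro sum.cong) (auto simp: algebra_simps)
  also have "\<dots> = pairing \<nu> \<alpha> lam' \<mu>0 + \<mu> 1 * (W - L / p)"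
    unfolding sum.distrib pairing_def using last_pos[OF pos] solution_first[OF pos \<mu>0] ee
    by (simp add: W_def L_def p_def mult_ac)
  finally have *: "pairing \<nu> \<alpha> lam' (\<lambda>j. \<mu> (Suc j)) = pairing \<nu> \<alpha> lam' \<mu>0 + \<mu> 1 * (W - L / p)" .
  have "pairing (raise \<nu>) \<alpha> lam \<mu> = lam 1 * \<mu> 1 + pairing \<nu> \<alpha> lam' (\<lambda>j. \<mu> (Suc j))"
    unfolding pairing_def nvars_raise sum_first eps_raise_first[OF pos] lam'_def
    using eps_raise[OF pos] by simp
  also have "\<dots> = pairing \<nu> \<alpha> lam' \<mu>0 + \<mu> 1 * (v - L / p)"
    unfolding * v_def by (simp add: algebra_simps)
  finally have "energy (raise \<nu>) \<alpha> lam = (L + v)\<^sup>2 / (p + 1) + pairing \<nu> \<alpha> lam' \<mu>0 + \<mu> 1 * (v - L / p)"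
    unfolding energy_eq[OF raise_pos[OF pos] \<mu>] v cfrac_raise p_def by simp
  also have "\<dots> = v\<^sup>2 + (L\<^sup>2 / p + pairing \<nu> \<alpha> lam' \<mu>0)"
  proof -
    have "(L + v)\<^sup>2 / (p + 1) + \<mu> 1 * (v - L / p) = v\<^sup>2 + L\<^sup>2 / p"
      unfolding m1 using p0 by (simp add: divide_simps) (simp add: algebra_simps power2_eq_square)
    then show ?thesis by simp
  qed
  finally show ?thesis unfolding v energy_eq[OF pos \<mu>0[unfolded lam'_def]] L_def p_def lam'_def .
qed

text \<open>Reflection changes the sign of \<open>\<Theta>\<close> but not the form \<open>l\<close>, and \<open>(p - 1) / p = 1 - 1 / p\<close>.\<close>

lemma energy_reflect:
  assumes pos: "\<forall>i\<le>\<alpha>. \<nu> i \<ge> 1" and "\<nu> 0 \<ge> 2"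
  shows "energy (reflect \<nu>) (Suc \<alpha>) lam = (lform \<nu> \<alpha> lam)\<^sup>2 - energy \<nu> \<alpha> lam"
proof -
  obtain \<mu> where \<mu>: "solves \<nu> \<alpha> lam \<mu>" using solves_exists[OF pos] by blast
  have \<mu>': "solves (reflect \<nu>) (Suc \<alpha>) lam \<mu>" using \<mu> solves_reflect[OF pos] by simp
  have "pairing (reflect \<nu>) (Suc \<alpha>) lam \<mu> = - pairing \<nu> \<alpha> lam \<mu>"
    unfolding pairing_def mseq_reflect_last[OF pos] sum_negf[symmetric]
    using eps_reflect[OF pos] by (intro sum.cong) auto
  then show ?thesis
    unfolding energy_eq[OF pos \<mu>] energy_eq[OF reflect_pos[OF assms] \<mu>'] lform_reflect(1)[OF pos]
      cfrac_reflect(1)[OF assms]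
    using cfrac_reflect(2)[OF assms] by (simp add: field_simps)
qed

lemma energy_Ints:
  assumes "\<forall>i\<le>\<alpha>. \<nu> i \<ge> 1"
  shows "energy \<nu> \<alpha> (\<lambda>j. of_nat (lam j)) \<in> \<int>"
  using assms
proof (induction \<nu> \<alpha> arbitrary: lam rule: cfrac_moves_induct)
  case (one \<nu>)
  then show ?case by (simp add: energy_one)
next
  case (raise \<nu> \<alpha>)
  then show ?case unfolding energy_raise[OF raise(1)] by (auto simp: wform_def intro!: Ints_add Ints_power)
next
  case (reflect \<nu> \<alpha>)
  then show ?case unfolding energy_reflect[OF reflect(1,2)] by (auto simp: lform_def intro!: Ints_diff Ints_power)
qed

section \<open>The refined sums\<close>

text \<open>The sum over \<open>\<lambda>\<close> is refined by the value of \<open>w\<cdot>\<lambda>\<close>, without which the two moves would not act on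
  it. The arguments are \<open>u = n\<cdot>\<lambda> - w\<cdot>\<lambda>\<close> and \<open>v = w\<cdot>\<lambda>\<close>, exchanged by \<open>reflect\<close>.\<close>

definition configs :: "(nat \<Rightarrow> nat) \<Rightarrow> nat \<Rightarrow> nat \<Rightarrow> nat \<Rightarrow> (nat \<Rightarrow> nat) set" where
  "configs \<nu> \<alpha> u v = {lam \<in> {1..nvars \<nu> \<alpha>} \<rightarrow>\<^sub>E UNIV. lform \<nu> \<alpha> lam = u + v \<and> wform \<nu> \<alpha> lam = v}"

definition weight :: "'a::field \<Rightarrow> (nat \<Rightarrow> nat) \<Rightarrow> nat \<Rightarrow> (nat \<Rightarrow> nat) \<Rightarrow> 'a" where
  "weight q \<nu> \<alpha> lam = q powi \<lfloor>energy \<nu> \<alpha> (\<lambda>j. of_nat (lam j))\<rfloor> /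
     (\<Prod>j = 1..nvars \<nu> \<alpha>. qpoch (q powi eps \<nu> \<alpha> j) (q powi eps \<nu> \<alpha> j) (lam j))"

definition refined :: "'a::field \<Rightarrow> (nat \<Rightarrow> nat) \<Rightarrow> nat \<Rightarrow> nat \<Rightarrow> nat \<Rightarrow> 'a" where
  "refined q \<nu> \<alpha> u v = (\<Sum>lam\<in>configs \<nu> \<alpha> u v. weight q \<nu> \<alpha> lam)"

lemma lform_cong: "(\<And>j. j \<in> {1..nvars \<nu> \<alpha>} \<Longrightarrow> lam j = lam' j) \<Longrightarrow> lform \<nu> \<alpha> lam = lform \<nu> \<alpha> lam'"
  and wform_cong: "(\<And>j. j \<in> {1..nvars \<nu> \<alpha>} \<Longrightarrow> lam j = lam' j) \<Longrightarrow> wform \<nu> \<alpha> lam = wform \<nu> \<alpha> lam'"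
  unfolding lform_def wform_def by (auto intro!: sum.cong)

lemma energy_cong:
  assumes "\<And>j. j \<in> {1..nvars \<nu> \<alpha>} \<Longrightarrow> lam j = lam' j"
  shows "energy \<nu> \<alpha> lam = energy \<nu> \<alpha> lam'"
proof -
  have "solves \<nu> \<alpha> lam = solves \<nu> \<alpha> lam'" unfolding solves_def using assms by (auto simp: fun_eq_iff)
  moreover have "pairing \<nu> \<alpha> lam = pairing \<nu> \<alpha> lam'"
    unfolding pairing_def fun_eq_iff using assms by (auto intro!: sum.cong)
  moreover have "lform \<nu> \<alpha> lam = lform \<nu> \<alpha> lam'" using assms by (rule lform_cong)
  ultimately show ?thesis unfolding energy_def by simp
qed

lemma lform_of_nat: "lform \<nu> \<alpha> (\<lambda>j. of_nat (lam j)) = of_nat (lform \<nu> \<alpha> lam)"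
  and wform_of_nat: "wform \<nu> \<alpha> (\<lambda>j. of_nat (lam j)) = of_nat (wform \<nu> \<alpha> lam)"
  by (simp_all add: lform_def wform_def)

lemma lam_set_eq: "lam_set \<nu> \<alpha> l = {lam \<in> {1..nvars \<nu> \<alpha>} \<rightarrow>\<^sub>E UNIV. lform \<nu> \<alpha> lam = l}"
  by (simp add: lam_set_def lform_def)

lemma finite_configs: "\<forall>i\<le>\<alpha>. \<nu> i \<ge> 1 \<Longrightarrow> finite (configs \<nu> \<alpha> u v)"
  by (rule finite_subset[OF _ finite_lam_set[of \<alpha> \<nu> "u + v"]]) (auto simp: configs_def lam_set_eq)

lemma refined_one:
  assumes "\<nu> 0 = 1"
  shows "refined q \<nu> 0 u v = (if v = 0 then 1 / qfact (1 / q) u else 0)"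
proof -
  have p: "\<forall>i\<le>0. \<nu> i \<ge> 1" using assms by simp
  have n: "nvars \<nu> 0 = 1" using assms by simp
  have l: "lform \<nu> 0 lam = lam 1" "wform \<nu> 0 lam = 0" for lam :: "nat \<Rightarrow> nat"
    unfolding lform_def wform_def n using nseq_first[OF p] wseq_first[OF p] assms by simp_all
  show ?thesis
  proof (cases "v = 0")
    case True
    have "configs \<nu> 0 u v = {\<lambda>j\<in>{1}. u}"
      unfolding configs_def l n True by (auto simp: PiE_def extensional_def fun_eq_iff)
    moreover have "weight q \<nu> 0 (\<lambda>j\<in>{1}. u) = 1 / qfact (1 / q) u"
      unfolding weight_def energy_one[of \<nu>, OF assms] n using eps_first[OF p] assms
      by (simp add: power_int_minus inverse_eq_divide)
    ultimately show ?thesis using True by (simp add: refined_def)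
  next
    case False
    then have "configs \<nu> 0 u v = {}" unfolding configs_def l by auto
    then show ?thesis using False by (simp add: refined_def)
  qed
qed

text \<open>The new first variable is \<open>\<lambda>\<^sub>1 = v - M\<close>, where \<open>M\<close> is the value of \<open>w\<close> on the remaining ones;
  this is the sum that \<open>kern_step\<close> evaluates.\<close>

lemma refined_raise:
  assumes pos: "\<forall>i\<le>\<alpha>. \<nu> i \<ge> 1" and q: "q \<noteq> 0"
  shows "refined q (raise \<nu>) \<alpha> u v =
    q ^ (v\<^sup>2) * (\<Sum>M\<le>min u v. refined q \<nu> \<alpha> (u - M) M / qfact q (v - M))"
proof -
  let ?n = "nvars \<nu> \<alpha>"
  define tl where "tl lam = (\<lambda>j\<in>{1..?n}. lam (Suc j))" for lam :: "nat \<Rightarrow> nat"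
  define cons where "cons x lam = (\<lambda>j\<in>{1..Suc ?n}. if j = 1 then x else lam (j - 1))"
    for x and lam :: "nat \<Rightarrow> nat"
  have tl_lform: "lform \<nu> \<alpha> (\<lambda>j. lam (Suc j)) = lform \<nu> \<alpha> (tl lam)"
    "wform \<nu> \<alpha> (\<lambda>j. lam (Suc j)) = wform \<nu> \<alpha> (tl lam)" for lam :: "nat \<Rightarrow> nat"
    unfolding tl_def by (auto intro!: lform_cong wform_cong)
  note forms = lform_raise[OF pos, where 'a = nat, unfolded tl_lform]
  have tl_cons: "tl (cons x lam) = lam" if "lam \<in> {1..?n} \<rightarrow>\<^sub>E UNIV" for x lam
    using that unfolding tl_def cons_def
    by (auto simp: fun_eq_iff PiE_def extensional_def simp del: mseq.simps)
  have cons_tl: "cons (lam 1) (tl lam) = lam" if "lam \<in> {1..Suc ?n} \<rightarrow>\<^sub>E UNIV" for lam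
    using that unfolding tl_def cons_def
    by (auto simp: fun_eq_iff PiE_def extensional_def simp del: mseq.simps)
  have cons1: "cons x lam 1 = x" for x lam by (simp add: cons_def del: mseq.simps)
  have weight: "weight q (raise \<nu>) \<alpha> lam = q ^ (v\<^sup>2) * (weight q \<nu> \<alpha> (tl lam) / qfact q (lam 1))"
    if "wform (raise \<nu>) \<alpha> lam = v" for lam
  proof -
    have "energy \<nu> \<alpha> (\<lambda>j. of_nat (lam (Suc j))) = energy \<nu> \<alpha> (\<lambda>j. of_nat (tl lam j))"
      by (rule energy_cong) (simp add: tl_def del: mseq.simps)
    then have "energy (raise \<nu>) \<alpha> (\<lambda>j. of_nat (lam j)) =
        of_int (int (v\<^sup>2)) + energy \<nu> \<alpha> (\<lambda>j. of_nat (tl lam j))"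
      unfolding energy_raise[OF pos] wform_of_nat that by simp
    then have num: "q powi \<lfloor>energy (raise \<nu>) \<alpha> (\<lambda>j. of_nat (lam j))\<rfloor> =
        q ^ (v\<^sup>2) * q powi \<lfloor>energy \<nu> \<alpha> (\<lambda>j. of_nat (tl lam j))\<rfloor>"
      using q by (simp only: int_add_floor[symmetric]) (simp add: power_int_add power_int_of_nat del: of_nat_power)
    have den: "(\<Prod>j = 1..?n. qpoch (q powi eps (raise \<nu>) \<alpha> (Suc j)) (q powi eps (raise \<nu>) \<alpha> (Suc j)) (lam (Suc j)))
       = (\<Prod>j = 1..?n. qpoch (q powi eps \<nu> \<alpha> j) (q powi eps \<nu> \<alpha> j) (tl lam j))"
      using eps_raise[OF pos] by (intro prod.cong) (auto simp: tl_def simp del: mseq.simps)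
    have split: "(\<Prod>j = 1..Suc ?n. f j) = f 1 * (\<Prod>j = 1..?n. f (Suc j))" for f :: "nat \<Rightarrow> 'a"
      by (simp add: prod.atLeast_Suc_atMost prod.shift_bounds_cl_Suc_ivl del: prod.cl_ivl_Suc mseq.simps)
    show ?thesis
      unfolding weight_def nvars_raise num split den eps_raise_first[OF pos] by (simp del: mseq.simps)
  qed
  have "refined q (raise \<nu>) \<alpha> u v =
      (\<Sum>(M, lam)\<in>(SIGMA M:{..min u v}. configs \<nu> \<alpha> (u - M) M).
         q ^ (v\<^sup>2) * (weight q \<nu> \<alpha> lam / qfact q (v - M)))"
    unfolding refined_def
  proof (rule sum.reindex_bij_witness[of _ "\<lambda>(M, lam). cons (v - M) lam" "\<lambda>lam. (wform \<nu> \<alpha> (tl lam), tl lam)"])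
    fix lam assume lam: "lam \<in> configs (raise \<nu>) \<alpha> u v"
    then have L: "lam \<in> {1..Suc ?n} \<rightarrow>\<^sub>E UNIV" "lform (raise \<nu>) \<alpha> lam = u + v" "wform (raise \<nu>) \<alpha> lam = v"
      unfolding configs_def nvars_raise by auto
    define M where "M = wform \<nu> \<alpha> (tl lam)"
    have v: "v = lam 1 + M" using L(3) forms(2)[of lam] by (simp add: M_def)
    have u: "u = lform \<nu> \<alpha> (tl lam)" using L(2,3) forms(1)[of lam] by simp
    have "wform \<nu> \<alpha> (tl lam) \<le> lform \<nu> \<alpha> (tl lam)"
      using lform_reflect(2)[OF pos, of "tl lam"] by simp
    then have M: "M \<le> u" unfolding M_def u .
    show "(case (wform \<nu> \<alpha> (tl lam), tl lam) of (M, lam) \<Rightarrow> cons (v - M) lam) = lam"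
      using cons_tl[OF L(1)] v by (simp add: M_def)
    show "(wform \<nu> \<alpha> (tl lam), tl lam) \<in> (SIGMA M:{..min u v}. configs \<nu> \<alpha> (u - M) M)"
      using M v u unfolding M_def[symmetric] by (auto simp: configs_def M_def tl_def simp del: mseq.simps)
    show "(case (wform \<nu> \<alpha> (tl lam), tl lam) of (M, lam) \<Rightarrow>
        q ^ (v\<^sup>2) * (weight q \<nu> \<alpha> lam / qfact q (v - M))) = weight q (raise \<nu>) \<alpha> lam"
      unfolding weight[OF L(3)] using v by (simp add: M_def)
  next
    fix x assume x: "x \<in> (SIGMA M:{..min u v}. configs \<nu> \<alpha> (u - M) M)"
    obtain M lam where xe: "x = (M, lam)" by (cases x)
    have M: "M \<le> u" "M \<le> v" and L: "lam \<in> {1..?n} \<rightarrow>\<^sub>E UNIV" "lform \<nu> \<alpha> lam = u" "wform \<nu> \<alpha> lam = M"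
      using x unfolding xe configs_def by auto
    have t: "tl (cons (v - M) lam) = lam" by (rule tl_cons[OF L(1)])
    show "(wform \<nu> \<alpha> (tl (case x of (M, lam) \<Rightarrow> cons (v - M) lam)), tl (case x of (M, lam) \<Rightarrow> cons (v - M) lam)) = x"
      unfolding xe by (simp add: t L)
    have "wform (raise \<nu>) \<alpha> (cons (v - M) lam) = v" unfolding forms t cons1 L using M by simp
    moreover from this have "lform (raise \<nu>) \<alpha> (cons (v - M) lam) = u + v"
      using forms(1)[of "cons (v - M) lam"] unfolding t L by simp
    moreover have "cons (v - M) lam \<in> {1..nvars (raise \<nu>) \<alpha>} \<rightarrow>\<^sub>E UNIV"
      unfolding cons_def nvars_raise by simp
    ultimately show "(case x of (M, lam) \<Rightarrow> cons (v - M) lam) \<in> configs (raise \<nu>) \<alpha> u v"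
      unfolding xe configs_def by simp
  qed
  also have "\<dots> = (\<Sum>M\<le>min u v. \<Sum>lam\<in>configs \<nu> \<alpha> (u - M) M. q ^ (v\<^sup>2) * (weight q \<nu> \<alpha> lam / qfact q (v - M)))"
    using finite_configs[OF pos] by (subst sum.Sigma) auto
  finally show ?thesis unfolding refined_def by (simp add: sum_distrib_left sum_divide_distrib)
qed

text \<open>The configurations are the same, the energy becomes \<open>l\<^sup>2\<close> minus the old one, and the change of
  all signs \<open>\<epsilon>(j)\<close> is the substitution \<open>q \<mapsto> 1 / q\<close>.\<close>

lemma refined_reflect:
  assumes pos: "\<forall>i\<le>\<alpha>. \<nu> i \<ge> 1" "\<nu> 0 \<ge> 2" and q: "q \<noteq> 0"
  shows "refined q (reflect \<nu>) (Suc \<alpha>) u v = q ^ ((u + v)\<^sup>2) * refined (1 / q) \<nu> \<alpha> v u"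
proof -
  note eqs = lform_reflect[OF pos(1), where 'a = nat]
  have "lform \<nu> \<alpha> lam = u + v \<and> wform (reflect \<nu>) (Suc \<alpha>) lam = v \<longleftrightarrow>
      lform \<nu> \<alpha> lam = v + u \<and> wform \<nu> \<alpha> lam = u" for lam :: "nat \<Rightarrow> nat"
    using eqs(2)[of lam] by auto
  then have c: "configs (reflect \<nu>) (Suc \<alpha>) u v = configs \<nu> \<alpha> v u"
    unfolding configs_def eqs(1) mseq_reflect_last[OF pos(1)] by simp
  have "weight q (reflect \<nu>) (Suc \<alpha>) lam = q ^ ((u + v)\<^sup>2) * weight (1 / q) \<nu> \<alpha> lam"
    if "lam \<in> configs \<nu> \<alpha> v u" for lam
  proof -
    have l: "lform \<nu> \<alpha> lam = u + v" using that by (simp add: configs_def)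
    obtain e where e: "energy \<nu> \<alpha> (\<lambda>j. of_nat (lam j)) = of_int e"
      using energy_Ints[OF pos(1)] Ints_cases by metis
    have "energy (reflect \<nu>) (Suc \<alpha>) (\<lambda>j. of_nat (lam j)) = of_int (int ((u + v)\<^sup>2) - e)"
      unfolding energy_reflect[OF pos] lform_of_nat l e by simp
    then have "q powi \<lfloor>energy (reflect \<nu>) (Suc \<alpha>) (\<lambda>j. of_nat (lam j))\<rfloor> =
        q ^ ((u + v)\<^sup>2) * (1 / q) powi e"
      using q by (simp only: floor_of_int) (simp add: power_int_diff power_int_of_nat power_int_one_over del: of_nat_power)
    moreover have "q powi eps (reflect \<nu>) (Suc \<alpha>) j = (1 / q) powi eps \<nu> \<alpha> j" if "j \<in> {1..nvars \<nu> \<alpha>}" for j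
      using that eps_reflect[OF pos(1)] by (simp add: power_int_minus power_int_one_over inverse_eq_divide)
    ultimately show ?thesis
      unfolding weight_def e floor_of_int mseq_reflect_last[OF pos(1)] by simp
  qed
  then show ?thesis unfolding refined_def c sum_distrib_left by (intro sum.cong) auto
qed

section \<open>Expansion in the kernel\<close>

text \<open>Each reflection exchanges the arguments of \<open>seed\<close>, by \<open>seed_flip\<close>; in \<open>[1]\<close> they are
  \<open>(k - m, m)\<close>.\<close>

definition coef :: "'a::field \<Rightarrow> nat \<Rightarrow> nat \<Rightarrow> nat \<Rightarrow> 'a" where
  "coef q \<alpha> k m = (if even \<alpha> then seed q (k - m) m else seed q m (k - m))"

text \<open>The linear forms \<open>y\<^bsub>\<alpha>+1\<^esub> k + y\<^sub>\<alpha> m\<close> and \<open>z\<^sub>\<alpha> k + z\<^bsub>\<alpha>-1\<^esub> m\<close>. The parameters of the kernel at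
  \<open>(k, m)\<close> are \<open>r = zval\<close> and \<open>c = yval - zval\<close>, and the two moves change these forms exactly as
  they change \<open>(r, c)\<close>.\<close>

definition yval :: "(nat \<Rightarrow> nat) \<Rightarrow> nat \<Rightarrow> nat \<Rightarrow> nat \<Rightarrow> nat" where
  "yval \<nu> \<alpha> k m = y_aux \<nu> (Suc (Suc \<alpha>)) * k + y_aux \<nu> (Suc \<alpha>) * m"

definition zval :: "(nat \<Rightarrow> nat) \<Rightarrow> nat \<Rightarrow> nat \<Rightarrow> nat \<Rightarrow> nat" where
  "zval \<nu> \<alpha> k m = z_aux \<nu> (Suc \<alpha>) * k + z_aux \<nu> \<alpha> * m"

lemma yval_raise: "yval (raise \<nu>) \<alpha> k m = yval \<nu> \<alpha> k m + zval \<nu> \<alpha> k m"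
  unfolding yval_def zval_def y_aux_raise by (simp only: algebra_simps)

lemma zval_raise: "zval (raise \<nu>) \<alpha> k m = zval \<nu> \<alpha> k m"
  unfolding zval_def z_aux_raise ..

lemma yval_reflect: "\<nu> 0 \<ge> 1 \<Longrightarrow> yval (reflect \<nu>) (Suc \<alpha>) k m = yval \<nu> \<alpha> k m"
  unfolding yval_def by (simp only: y_aux_reflect)

lemma zval_reflect:
  assumes "\<nu> 0 \<ge> 1"
  shows "zval (reflect \<nu>) (Suc \<alpha>) k m + zval \<nu> \<alpha> k m = yval \<nu> \<alpha> k m"
proof -
  have "zval (reflect \<nu>) (Suc \<alpha>) k m + zval \<nu> \<alpha> k m =
      (z_aux (reflect \<nu>) (Suc (Suc \<alpha>)) + z_aux \<nu> (Suc \<alpha>)) * k + (z_aux (reflect \<nu>) (Suc \<alpha>) + z_aux \<nu> \<alpha>) * m"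
    unfolding zval_def by (simp only: algebra_simps)
  then show ?thesis unfolding z_aux_reflect[of \<nu>, OF assms] yval_def .
qed

lemma coef_flip: "nonroot q \<Longrightarrow> coef (1 / q) \<alpha> k m = coef q (Suc \<alpha>) k m"
  by (simp add: coef_def seed_flip)

text \<open>Vanishing of the kernel outside \<open>a \<le> v\<close>, \<open>b \<le> u\<close> lets the rectangle of \<open>seed_kern_sum\<close> be
  replaced by any triangle containing it, so that one bound serves all terms of later sums.\<close>

lemma seed_kern_triangle:
  assumes "nonroot q" "u + v \<le> B"
  shows "(\<Sum>k\<le>B. \<Sum>m\<le>k. seed q m (k - m) * kern q m (k - m) u v) = (if u = 0 \<and> v = 0 then 1 else 0)"
proof -
  have "(\<Sum>k\<le>B. \<Sum>m\<le>k. seed q m (k - m) * kern q m (k - m) u v) =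
      (\<Sum>(a, b)\<in>{(a, b). a + b \<le> B}. seed q a b * kern q a b u v)"
    by (rule sum.triangle_reindex_eq[symmetric])
  also have "\<dots> = (\<Sum>(a, b)\<in>{..v} \<times> {..u}. seed q a b * kern q a b u v)"
  proof (rule sum.mono_neutral_right)
    show "finite {(a, b). a + b \<le> B}"
      by (rule finite_subset[of _ "{..B} \<times> {..B}"]) auto
  qed (use assms(2) kern_eq_0[of _ u _ v q] in \<open>force+\<close>)
  also have "\<dots> = (\<Sum>a\<le>v. \<Sum>b\<le>u. seed q a b * kern q a b u v)"
    by (simp add: sum.cartesian_product)
  finally show ?thesis unfolding seed_kern_sum[OF assms(1)] .
qed

text \<open>The refined sum of \<open>[1]\<close> arises from the unit mass at \<open>(0, 0)\<close> by the operation of \<open>raise\<close>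
  followed by that of \<open>reflect\<close>, so its expansion comes from \<open>seed_kern_sum\<close> through \<open>kern_step\<close> and
  \<open>kern_flip\<close>.\<close>

lemma kern_expansion_one:
  assumes q: "nonroot q" and B: "u + v \<le> B"
  shows "(\<Sum>k\<le>B. \<Sum>m\<le>k. seed q (k - m) m * kern q k m u v) = (if v = 0 then 1 / qfact (1 / q) u else 0)"
proof -
  define p where "p = 1 / q"
  have p: "nonroot p" unfolding p_def by (rule nonroot_inverse[OF q])
  have q0: "q \<noteq> 0" using q by (simp add: nonroot_def)
  define c where "c = q ^ ((u + v)\<^sup>2) * p ^ (u\<^sup>2)"
  have "seed q (k - m) m * kern q k m u v = c * (\<Sum>M\<le>min v u.
      seed p m (k - m) * kern p m (k - m) (v - M) M / qfact p (u - M))" if "m \<le> k" for k m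
  proof -
    have "kern q k m u v = q ^ ((u + v)\<^sup>2) * kern p m (k - m + m) v u"
      unfolding p_def kern_flip[OF q] using that by simp
    also have "\<dots> = c * (\<Sum>M\<le>min v u. kern p m (k - m) (v - M) M / qfact p (u - M))"
      unfolding kern_step[OF p, symmetric] c_def by simp
    finally show ?thesis
      unfolding p_def seed_flip[OF q] by (simp add: sum_distrib_left mult_ac)
  qed
  then have "(\<Sum>k\<le>B. \<Sum>m\<le>k. seed q (k - m) m * kern q k m u v) =
      (\<Sum>k\<le>B. \<Sum>m\<le>k. c * (\<Sum>M\<le>min v u.
        seed p m (k - m) * kern p m (k - m) (v - M) M / qfact p (u - M)))"
    by (intro sum.cong) auto
  also have "\<dots> = c * (\<Sum>M\<le>min v u. \<Sum>k\<le>B. \<Sum>m\<le>k.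
        seed p m (k - m) * kern p m (k - m) (v - M) M / qfact p (u - M))"
    unfolding sum_distrib_left[symmetric] sum.swap[of _ _ "{..min v u}"] ..
  also have "(\<Sum>M\<le>min v u. \<Sum>k\<le>B. \<Sum>m\<le>k. seed p m (k - m) * kern p m (k - m) (v - M) M / qfact p (u - M))
    = (\<Sum>M\<le>min v u. if M = 0 then (if v = 0 then 1 / qfact p u else 0) else 0)"
  proof (rule sum.cong[OF refl])
    fix M assume M: "M \<in> {..min v u}"
    have "(\<Sum>k\<le>B. \<Sum>m\<le>k. seed p m (k - m) * kern p m (k - m) (v - M) M / qfact p (u - M)) =
      (if v - M = 0 \<and> M = 0 then 1 else 0) / qfact p (u - M)"
      unfolding sum_divide_distrib[symmetric] using M B by (subst seed_kern_triangle[OF p]) auto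
    then show "(\<Sum>k\<le>B. \<Sum>m\<le>k. seed p m (k - m) * kern p m (k - m) (v - M) M / qfact p (u - M)) =
      (if M = 0 then (if v = 0 then 1 / qfact p u else 0) else 0)" by auto
  qed
  also have "c * \<dots> = (if v = 0 then 1 / qfact p u else 0)"
    using q0 by (simp add: c_def p_def power_one_over)
  finally show ?thesis unfolding p_def .
qed

text \<open>The moves act on the refined sums as they act on the kernel, so the expansion of \<open>[1]\<close>
  propagates with unchanged coefficients up to the exchange under reflection.\<close>

lemma refined_expansion:
  assumes "\<forall>i\<le>\<alpha>. \<nu> i \<ge> 1" "nonroot q" "u + v \<le> B"
  shows "refined q \<nu> \<alpha> u v = (\<Sum>k\<le>B. \<Sum>m\<le>k. coef q \<alpha> k m *
     kern q (zval \<nu> \<alpha> k m) (yval \<nu> \<alpha> k m - zval \<nu> \<alpha> k m) u v)"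
  using assms
proof (induction \<nu> \<alpha> arbitrary: q u v rule: cfrac_moves_induct)
  case (one \<nu>)
  then show ?case
    unfolding refined_one[of \<nu>, OF one(1)] using kern_expansion_one[OF one(2,3)]
    by (simp add: coef_def zval_def yval_def)
next
  case (raise \<nu> \<alpha>)
  have q0: "q \<noteq> 0" using raise(3) by (simp add: nonroot_def)
  have "\<nu> 0 \<ge> 1" using raise(1) by simp
  define r where "r = zval \<nu> \<alpha>"
  define c where "c k m = yval \<nu> \<alpha> k m - zval \<nu> \<alpha> k m" for k m
  have y: "yval \<nu> \<alpha> k m = c k m + r k m" for k m
    using zval_reflect[of \<nu> \<alpha> k m, OF \<open>\<nu> 0 \<ge> 1\<close>] unfolding c_def r_def by simp
  have "refined q (raise \<nu>) \<alpha> u v =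
    q ^ (v\<^sup>2) * (\<Sum>M\<le>min u v. (\<Sum>k\<le>B. \<Sum>m\<le>k. coef q \<alpha> k m * kern q (r k m) (c k m) (u - M) M) / qfact q (v - M))"
    unfolding refined_raise[OF raise(1) q0] using raise(2)[OF raise(3)] raise(4)
    by (simp add: r_def c_def)
  also have "\<dots> = (\<Sum>k\<le>B. \<Sum>m\<le>k. coef q \<alpha> k m *
      (q ^ (v\<^sup>2) * (\<Sum>M\<le>min u v. kern q (r k m) (c k m) (u - M) M / qfact q (v - M))))"
    unfolding sum_divide_distrib sum_distrib_left sum.swap[of _ _ "{..min u v}"]
    by (simp add: mult_ac)
  also have "\<dots> = (\<Sum>k\<le>B. \<Sum>m\<le>k. coef q \<alpha> k m * kern q (r k m) (c k m + r k m) u v)"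
    unfolding kern_step[OF raise(3)] ..
  finally show ?case unfolding zval_raise yval_raise r_def[symmetric] y by simp
next
  case (reflect \<nu> \<alpha>)
  have q0: "q \<noteq> 0" using reflect(4) by (simp add: nonroot_def)
  have "\<nu> 0 \<ge> 1" using reflect(1) by simp
  define r where "r = zval \<nu> \<alpha>"
  define c where "c k m = yval \<nu> \<alpha> k m - zval \<nu> \<alpha> k m" for k m
  have y: "yval \<nu> \<alpha> k m = c k m + r k m" for k m
    using zval_reflect[of \<nu> \<alpha> k m, OF \<open>\<nu> 0 \<ge> 1\<close>] unfolding c_def r_def by simp
  have z: "zval (reflect \<nu>) (Suc \<alpha>) k m = c k m" for k m
    using zval_reflect[of \<nu> \<alpha> k m, OF \<open>\<nu> 0 \<ge> 1\<close>] unfolding y r_def by simp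
  have "refined q (reflect \<nu>) (Suc \<alpha>) u v = q ^ ((u + v)\<^sup>2) *
      (\<Sum>k\<le>B. \<Sum>m\<le>k. coef (1 / q) \<alpha> k m * kern (1 / q) (r k m) (c k m) v u)"
    unfolding refined_reflect[OF reflect(1,2) q0]
    using reflect(3)[OF nonroot_inverse[OF reflect(4)], of v u] reflect(5) by (simp add: r_def c_def add.commute)
  also have "\<dots> = (\<Sum>k\<le>B. \<Sum>m\<le>k. coef q (Suc \<alpha>) k m * kern q (c k m) (r k m) u v)"
    unfolding sum_distrib_left coef_flip[OF reflect(4)] kern_flip[OF reflect(4), symmetric]
    by (simp add: mult_ac)
  finally show ?case unfolding yval_reflect[of \<nu>, OF \<open>\<nu> 0 \<ge> 1\<close>] y z by simp
qed

text \<open>Forgetting the refinement replaces every kernel by its sum over \<open>u + v = l\<close>. This is a closed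
  form of \<open>q\<^bsup>l\<^sup>2/p\<^esup> V\<^sub>l\<close>.\<close>

lemma weight_sum:
  assumes pos: "\<forall>i\<le>\<alpha>. \<nu> i \<ge> 1" and q: "nonroot q"
  shows "(\<Sum>lam\<in>lam_set \<nu> \<alpha> l. weight q \<nu> \<alpha> lam) =
    (\<Sum>k\<le>l. \<Sum>m\<le>k. if yval \<nu> \<alpha> k m = l then coef q \<alpha> k m * q ^ (zval \<nu> \<alpha> k m * l) else 0)"
proof -
  have "\<nu> 0 \<ge> 1" using pos by simp
  have le: "zval \<nu> \<alpha> k m \<le> yval \<nu> \<alpha> k m" for k m
    using zval_reflect[of \<nu> \<alpha> k m, OF \<open>\<nu> 0 \<ge> 1\<close>] by simp
  have wl: "wform \<nu> \<alpha> lam \<le> lform \<nu> \<alpha> lam" for lam :: "nat \<Rightarrow> nat"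
    using lform_reflect(2)[OF pos, of lam] by simp
  have "(\<Sum>lam\<in>lam_set \<nu> \<alpha> l. weight q \<nu> \<alpha> lam) =
      (\<Sum>v\<le>l. \<Sum>lam\<in>{lam \<in> lam_set \<nu> \<alpha> l. wform \<nu> \<alpha> lam = v}. weight q \<nu> \<alpha> lam)"
    by (rule sum.group[symmetric]) (use finite_lam_set[OF pos] wl in \<open>auto simp: lam_set_eq\<close>)
  also have "\<dots> = (\<Sum>v\<le>l. refined q \<nu> \<alpha> (l - v) v)"
    unfolding refined_def by (intro sum.cong refl) (auto simp: lam_set_eq configs_def)
  also have "\<dots> = (\<Sum>v\<le>l. \<Sum>k\<le>l. \<Sum>m\<le>k. coef q \<alpha> k m *
     kern q (zval \<nu> \<alpha> k m) (yval \<nu> \<alpha> k m - zval \<nu> \<alpha> k m) (l - v) v)"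
    by (intro sum.cong refl refined_expansion[OF pos q]) simp
  also have "\<dots> = (\<Sum>k\<le>l. \<Sum>m\<le>k. coef q \<alpha> k m *
     (\<Sum>v\<le>l. kern q (zval \<nu> \<alpha> k m) (yval \<nu> \<alpha> k m - zval \<nu> \<alpha> k m) (l - v) v))"
    unfolding sum_distrib_left sum.swap[of _ _ "{..l}"] ..
  also have "\<dots> = (\<Sum>k\<le>l. \<Sum>m\<le>k. if yval \<nu> \<alpha> k m = l then coef q \<alpha> k m * q ^ (zval \<nu> \<alpha> k m * l) else 0)"
    unfolding kern_diagonal_sum[OF q] using le by (intro sum.cong refl) auto
  finally show ?thesis .
qed

section \<open>Convergence of Laurent series\<close>

definition vanishes_below :: "int \<Rightarrow> 'a::zero fls \<Rightarrow> bool" where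
  "vanishes_below n f \<longleftrightarrow> (\<forall>i<n. fls_nth f i = 0)"

lemma vanishes_below_mono: "vanishes_below n f \<Longrightarrow> m \<le> n \<Longrightarrow> vanishes_below m f"
  by (simp add: vanishes_below_def)

lemma vanishes_below_0: "vanishes_below n 0"
  by (simp add: vanishes_below_def)

lemma vanishes_below_uminus: "vanishes_below n f \<Longrightarrow> vanishes_below n (- f :: 'a::group_add fls)"
  by (simp add: vanishes_below_def)

lemma vanishes_below_subdegree: "n \<le> fls_subdegree f \<Longrightarrow> vanishes_below n f"
  by (simp add: vanishes_below_def)

lemma vanishes_below_add:
  "vanishes_below n f \<Longrightarrow> vanishes_below n g \<Longrightarrow> vanishes_below n (f + g :: 'a::monoid_add fls)"
  by (simp add: vanishes_below_def)

lemma vanishes_below_diff: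
  "vanishes_below n f \<Longrightarrow> vanishes_below n g \<Longrightarrow> vanishes_below n (f - g :: 'a::group_add fls)"
  by (simp add: vanishes_below_def)

lemma vanishes_below_sum:
  "(\<And>i. i \<in> A \<Longrightarrow> vanishes_below n (f i)) \<Longrightarrow> vanishes_below n (\<Sum>i\<in>A. f i :: 'a::comm_monoid_add fls)"
  by (induction A rule: infinite_finite_induct) (auto intro: vanishes_below_0 vanishes_below_add)

lemma vanishes_below_mult:
  fixes f g :: "'a::field fls"
  assumes "vanishes_below a f" "vanishes_below b g"
  shows "vanishes_below (a + b) (f * g)"
proof (cases "f = 0 \<or> g = 0")
  case False
  then have "a \<le> fls_subdegree f" "b \<le> fls_subdegree g"
    using assms by (auto simp: vanishes_below_def intro: fls_subdegree_geI)
  then show ?thesis using False by (intro vanishes_below_subdegree) simp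
qed (auto simp: vanishes_below_0)

lemma tendsto_flsI:
  fixes F :: "nat \<Rightarrow> 'a::group_add fls"
  assumes "\<And>N. vanishes_below (int N) (F N - S)"
  shows "F \<longlonglongrightarrow> S"
  unfolding LIMSEQ_def
proof (intro allI impI)
  fix r :: real assume "r > 0"
  then obtain n0 where n0: "inverse (2 ^ n0) < r"
    using real_arch_pow_inv[of r "1/2"] by (auto simp: power_one_over inverse_eq_divide)
  show "\<exists>no. \<forall>n\<ge>no. dist (F n) S < r"
  proof (intro exI allI impI)
    fix n assume n: "n \<ge> n0"
    show "dist (F n) S < r"
    proof (cases "F n = S")
      case True
      then show ?thesis using \<open>r > 0\<close> by simp
    next
      case False
      then have "int n \<le> fls_subdegree (F n - S)"
        using assms[of n] by (intro fls_subdegree_geI) (auto simp: vanishes_below_def)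
      then have d: "dist (F n) S = inverse (2 ^ nat (fls_subdegree (F n - S)))"
        and "n0 \<le> nat (fls_subdegree (F n - S))" using False n by (auto simp: dist_fls_def)
      then have "dist (F n) S \<le> inverse (2 ^ n0)"
        unfolding d by (intro le_imp_inverse_le power_increasing) auto
      then show ?thesis using n0 by simp
    qed
  qed
qed

text \<open>The coefficient at \<open>n\<close> of the limit is a sum over \<open>k \<le> n\<close>, since later terms do not reach
  down to \<open>n\<close>.\<close>

lemma fls_limit_exists:
  fixes f :: "nat \<Rightarrow> 'a::ab_group_add fls"
  assumes "\<And>k. vanishes_below (int k) (f k)"
  obtains S where "\<And>N. vanishes_below (int N) ((\<Sum>k<N. f k) - S)"
proof
  define S where "S = fps_to_fls (Abs_fps (\<lambda>n. \<Sum>k\<le>n. fls_nth (f k) (int n)))"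
  have fs: "fls_nth (\<Sum>k\<in>A. f k) i = (\<Sum>k\<in>A. fls_nth (f k) i)" for A i
    by (induction A rule: infinite_finite_induct) auto
  fix N
  show "vanishes_below (int N) ((\<Sum>k<N. f k) - S)"
    unfolding vanishes_below_def
  proof (intro allI impI)
    fix i assume i: "i < int N"
    show "fls_nth ((\<Sum>k<N. f k) - S) i = 0"
    proof (cases "i < 0")
      case True
      then have "fls_nth (f k) i = 0" for k using assms[of k] by (simp add: vanishes_below_def)
      then show ?thesis using True by (simp add: fs S_def)
    next
      case False
      then obtain n where n: "i = int n" by (metis nonneg_int_cases not_less)
      have "(\<Sum>k<N. fls_nth (f k) (int n)) = (\<Sum>k\<le>n. fls_nth (f k) (int n))"
        using assms i n by (intro sum.mono_neutral_right) (auto simp: vanishes_below_def)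
      then show ?thesis by (simp add: fs S_def n)
    qed
  qed
qed

text \<open>Both partial sums approximate the sum of all \<open>t k m\<close>. Those with \<open>k < N\<close> contain those with
  \<open>h k m < N\<close>, and the surplus consists of terms of order at least \<open>N\<close>.\<close>

lemma regroup_sums:
  fixes t :: "nat \<Rightarrow> nat \<Rightarrow> 'a::field fls" and h :: "nat \<Rightarrow> nat \<Rightarrow> nat"
  assumes t: "\<And>k m. m \<le> k \<Longrightarrow> vanishes_below (int (h k m)) (t k m)"
    and h: "\<And>k m. k \<le> h k m"
  obtains S where "(\<lambda>l. \<Sum>k\<le>l. \<Sum>m\<le>k. if h k m = l then t k m else 0) sums S"
    and "(\<lambda>k. \<Sum>m\<le>Suc k. t (Suc k) m) sums (S - t 0 0)"
proof -
  define f where "f k = (\<Sum>m\<le>k. t k m)" for k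
  have "vanishes_below (int k) (f k)" for k
    unfolding f_def by (intro vanishes_below_sum vanishes_below_mono[OF t]) (auto simp: h)
  from fls_limit_exists[of f, OF this]
  obtain S where S: "\<And>N. vanishes_below (int N) ((\<Sum>k<N. f k) - S)"
    by blast
  show ?thesis
  proof (rule that)
    show "(\<lambda>k. \<Sum>m\<le>Suc k. t (Suc k) m) sums (S - t 0 0)"
      unfolding sums_def
    proof (rule tendsto_flsI)
      fix N
      have eq: "(\<Sum>k<N. f (Suc k)) - (S - t 0 0) = (\<Sum>k<Suc N. f k) - S"
        unfolding sum.lessThan_Suc_shift by (simp add: f_def)
      show "vanishes_below (int N) ((\<Sum>k<N. \<Sum>m\<le>Suc k. t (Suc k) m) - (S - t 0 0))"
        unfolding f_def[symmetric] eq by (rule vanishes_below_mono[OF S]) simp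
    qed
    show "(\<lambda>l. \<Sum>k\<le>l. \<Sum>m\<le>k. if h k m = l then t k m else 0) sums S"
      unfolding sums_def
    proof (rule tendsto_flsI)
      fix N
      have "(\<Sum>l<N. \<Sum>k\<le>l. \<Sum>m\<le>k. if h k m = l then t k m else 0) =
          (\<Sum>l<N. \<Sum>k<N. \<Sum>m\<le>k. if h k m = l then t k m else 0)"
      proof (rule sum.cong[OF refl], rule sum.mono_neutral_left)
        fix l
        show "\<forall>k\<in>{..<N} - {..l}. (\<Sum>m\<le>k. if h k m = l then t k m else 0) = 0"
        proof
          fix k assume "k \<in> {..<N} - {..l}"
          then have "h k m \<noteq> l" for m using h[of k m] by auto
          then show "(\<Sum>m\<le>k. if h k m = l then t k m else 0) = 0" by simp
        qed
      qed auto
      also have "\<dots> = (\<Sum>k<N. \<Sum>m\<le>k. \<Sum>l<N. if h k m = l then t k m else 0)"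
        by (subst sum.swap) (intro sum.cong refl sum.swap)
      also have "\<dots> = (\<Sum>k<N. f k) - (\<Sum>k<N. \<Sum>m\<le>k. if h k m < N then 0 else t k m)"
        unfolding f_def sum_subtractf[symmetric] by (intro sum.cong) auto
      finally have "(\<Sum>l<N. \<Sum>k\<le>l. \<Sum>m\<le>k. if h k m = l then t k m else 0) - S =
          ((\<Sum>k<N. f k) - S) - (\<Sum>k<N. \<Sum>m\<le>k. if h k m < N then 0 else t k m)" by simp
      moreover have "vanishes_below (int N) (\<Sum>k<N. \<Sum>m\<le>k. if h k m < N then 0 else t k m)"
        by (intro vanishes_below_sum) (auto intro: vanishes_below_0 vanishes_below_mono[OF t])
      ultimately show "vanishes_below (int N) ((\<Sum>l<N. \<Sum>k\<le>l. \<Sum>m\<le>k. if h k m = l then t k m else 0) - S)"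
        by (simp only: vanishes_below_diff[OF S])
    qed
  qed
qed

section \<open>Comparison of the two sides\<close>

lemma qvar_eq:
  "qvar \<nu> \<alpha> = fls_X ^ yseq \<nu> (int \<alpha> + 1)"
  by (simp add: qvar_def qpow_def power_int_of_nat)

lemma subdegree_one_minus_X:
  assumes "n > 0"
  shows "fls_subdegree (1 - fls_X ^ n :: 'a::field fls) = 0"
  using assms by (intro fls_subdegree_eqI) auto

lemma nonroot_X_power:
  assumes "n > 0"
  shows "nonroot (fls_X ^ n :: 'a::field fls)"
  unfolding nonroot_def
proof (intro conjI allI impI)
  fix k :: nat assume "k > 0"
  then have "fls_nth (fls_X ^ (n * k) :: 'a fls) 0 \<noteq> fls_nth 1 0" using assms by simp
  then show "(fls_X ^ n) ^ k \<noteq> (1 :: 'a fls)" unfolding power_mult[symmetric] by metis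
qed simp

lemma vanishes_below_X_power: "vanishes_below (int N) (fls_X ^ N :: 'a::field fls)"
  by (rule vanishes_below_subdegree) simp

lemma subdegree_qfact_X:
  assumes "n > 0"
  shows "fls_subdegree (qfact (fls_X ^ n :: 'a::field fls) k) = 0"
proof (induction k)
  case (Suc k)
  have "1 - fls_X ^ (n * Suc k) \<noteq> (0 :: 'a fls)"
    using nonroot_X_power[OF assms, where 'a = 'a] unfolding nonroot_def power_mult
    by (metis right_minus_eq zero_less_Suc)
  moreover have "fls_subdegree (1 - fls_X ^ (n * Suc k) :: 'a fls) = 0"
    using assms by (intro subdegree_one_minus_X) simp
  ultimately show ?case
    unfolding qfact_Suc power_mult[symmetric]
    using Suc qfact_nonzero[OF nonroot_X_power[OF assms, where 'a = 'a]] by simp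
qed simp

lemma vanishes_below_seed:
  assumes "n > 0"
  shows "vanishes_below 0 (seed (fls_X ^ n :: 'a::field fls) a b)"
proof -
  let ?q = "fls_X ^ n :: 'a fls"
  have X: "vanishes_below 0 (?q ^ j)" for j
    using vanishes_below_mono[OF vanishes_below_X_power[of "n * j", where 'a = 'a], of 0]
    by (simp add: power_mult)
  have one: "vanishes_below 0 (1 :: 'a fls)" by (rule vanishes_below_subdegree) simp
  have mult: "vanishes_below 0 (f * g)" if "vanishes_below 0 f" "vanishes_below 0 g" for f g :: "'a fls"
    using vanishes_below_mult[OF that] by simp
  have i: "vanishes_below 0 (inverse (qfact ?q j))" for j
    using subdegree_qfact_X[OF assms, of j, where 'a = 'a] by (intro vanishes_below_subdegree) simp
  have s: "vanishes_below 0 ((-1) ^ a :: 'a fls)"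
    by (cases "even a") (auto intro: one vanishes_below_uminus)
  have "seed ?q a b = (-1) ^ a * ?q ^ (a choose 2) * (1 + ?q ^ (a + b) - ?q ^ a) *
      (inverse (qfact ?q a) * inverse (qfact ?q b))"
    by (simp add: seed_def field_simps)
  then show ?thesis
    by (auto intro!: mult s X i vanishes_below_add vanishes_below_diff one)
qed

lemma yval_int:
  "int (yval \<nu> \<alpha> k m) = int (yseq \<nu> (int \<alpha> + 1)) * int k + int (yseq \<nu> (int \<alpha>)) * int m"
  "int (zval \<nu> \<alpha> k m) = int (zseq \<nu> (int \<alpha>)) * int k + int (zseq \<nu> (int \<alpha> - 1)) * int m"
proof -
  have "nat (int \<alpha> + 1 + 1) = Suc (Suc \<alpha>)" "nat (int \<alpha> + 1) = Suc \<alpha>" by auto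
  then show "int (yval \<nu> \<alpha> k m) = int (yseq \<nu> (int \<alpha> + 1)) * int k + int (yseq \<nu> (int \<alpha>)) * int m"
    "int (zval \<nu> \<alpha> k m) = int (zseq \<nu> (int \<alpha>)) * int k + int (zseq \<nu> (int \<alpha> - 1)) * int m"
    unfolding yval_def zval_def yseq_def zseq_def by (simp_all del: y_aux.simps z_aux.simps)
qed

text \<open>With the factor \<open>1 / (q)\<^sub>k\<close> both \<open>q\<close>-binomials acquire the same denominator, also in the
  degenerate cases \<open>m = k\<close> and \<open>m = 0\<close>.\<close>

lemma qbinom_pred:
  assumes q: "nonroot q" and "m \<le> k" "k > 0"
  shows "qbinom q (int k - 1) (int m) / qfact q k = (1 - q ^ (k - m)) / ((1 - q ^ k) * (qfact q m * qfact q (k - m)))"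
    and "qbinom q (int k - 1) (int m - 1) / qfact q k = (1 - q ^ m) / ((1 - q ^ k) * (qfact q m * qfact q (k - m)))"
proof -
  note nz = qfact_nonzero[OF q]
  have nq: "1 - q ^ i \<noteq> 0" if "i > 0" for i using q that unfolding nonroot_def by auto
  have F: "qfact q i = qfact q (i - 1) * (1 - q ^ i)" if "i > 0" for i
    using that qfact_Suc[of q "i - 1"] by simp
  have cancel: "A / (M * B) / (A * x) = y / (x * (M * (B * y)))" "A / (M * B) / (A * x) = y / (x * (M * y * B))"
    if "A \<noteq> 0" "M \<noteq> 0" "B \<noteq> 0" "x \<noteq> 0" "y \<noteq> 0" for A M B x y :: 'a
    using that by (simp_all add: field_simps)
  have k2: "nat (int k - 1 - int m) = k - m - 1" by simp
  have k1: "nat (int k - 1) = k - 1" "nat (int m - 1) = m - 1" by auto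
  show "qbinom q (int k - 1) (int m) / qfact q k = (1 - q ^ (k - m)) / ((1 - q ^ k) * (qfact q m * qfact q (k - m)))"
  proof (cases "m = k")
    case False
    then have "qbinom q (int k - 1) (int m) = qfact q (k - 1) / (qfact q m * qfact q (k - m - 1))"
      unfolding qbinom_def k2 using assms k1 by simp
    moreover have "qfact q k = qfact q (k - 1) * (1 - q ^ k)"
      "qfact q (k - m) = qfact q (k - m - 1) * (1 - q ^ (k - m))"
      using F[of k] F[of "k - m"] False assms by simp_all
    ultimately show ?thesis
      using cancel(1)[of "qfact q (k - 1)" "qfact q m" "qfact q (k - m - 1)" "1 - q ^ k" "1 - q ^ (k - m)"]
        nz nq[of k] nq[of "k - m"] False assms by simp
  qed (simp add: qbinom_def)
  show "qbinom q (int k - 1) (int m - 1) / qfact q k = (1 - q ^ m) / ((1 - q ^ k) * (qfact q m * qfact q (k - m)))"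
  proof (cases "m = 0")
    case False
    have "nat (int k - 1 - (int m - 1)) = k - m" by simp
    then have "qbinom q (int k - 1) (int m - 1) = qfact q (k - 1) / (qfact q (m - 1) * qfact q (k - m))"
      unfolding qbinom_def using assms k1 False by simp
    moreover have "qfact q k = qfact q (k - 1) * (1 - q ^ k)"
      "qfact q m = qfact q (m - 1) * (1 - q ^ m)"
      using F[of k] F[of m] False assms by simp_all
    ultimately show ?thesis
      using cancel(2)[of "qfact q (k - 1)" "qfact q (m - 1)" "qfact q (k - m)" "1 - q ^ k" "1 - q ^ m"]
        nz nq[of k] nq[of m] False assms by simp
  qed (simp add: qbinom_def)
qed

text \<open>The common numerator of the two \<open>q\<close>-binomials is divisible by \<open>1 - q\<^sup>k\<close>.\<close>

lemma Qpoly_over_qfact: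
  assumes q: "nonroot q" and km: "m \<le> k" "k > 0"
  shows "Qpoly 1 q (int k) (int m) / qfact q k = (1 + q ^ k - q ^ (k - m)) / (qfact q m * qfact q (k - m))"
    and "Qpoly (-1) q (int k) (int m) / qfact q k = (1 + q ^ k - q ^ m) / (qfact q m * qfact q (k - m))"
proof -
  note b = qbinom_pred[OF assms]
  have nq: "1 - q ^ k \<noteq> 0" using q km unfolding nonroot_def by auto
  define F where "F = qfact q m * qfact q (k - m)"
  have p1: "q powi (2 * int k - int m) = q ^ k * q ^ (k - m)"
  proof -
    have "2 * int k - int m = int (k + (k - m))" using km by simp
    then show ?thesis by (simp only: power_int_of_nat power_add)
  qed
  have p2: "q powi (int k + int m) = q ^ k * q ^ m"
  proof -
    have "int k + int m = int (k + m)" by simp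
    then show ?thesis by (simp only: power_int_of_nat power_add)
  qed
  have pk: "q ^ m * q ^ (k - m) = q ^ k" using km by (simp flip: power_add)
  have "Qpoly 1 q (int k) (int m) / qfact q k =
      qbinom q (int k - 1) (int m) / qfact q k + q ^ k * q ^ (k - m) * (qbinom q (int k - 1) (int m - 1) / qfact q k)"
    unfolding Qpoly_def by (simp add: p1 add_divide_distrib)
  also have "\<dots> = ((1 - q ^ (k - m)) + q ^ k * q ^ (k - m) * (1 - q ^ m)) / ((1 - q ^ k) * F)"
    unfolding b F_def by (simp add: add_divide_distrib)
  also have "(1 - q ^ (k - m)) + q ^ k * q ^ (k - m) * (1 - q ^ m) = (1 - q ^ k) * (1 + q ^ k - q ^ (k - m))"
    using pk by (simp add: algebra_simps)
  finally show "Qpoly 1 q (int k) (int m) / qfact q k = (1 + q ^ k - q ^ (k - m)) / (qfact q m * qfact q (k - m))"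
    using nq by (simp add: F_def)
  have "Qpoly (-1) q (int k) (int m) / qfact q k =
      q ^ k * q ^ m * (qbinom q (int k - 1) (int m) / qfact q k) + qbinom q (int k - 1) (int m - 1) / qfact q k"
    unfolding Qpoly_def by (simp add: p2 add_divide_distrib)
  also have "\<dots> = (q ^ k * q ^ m * (1 - q ^ (k - m)) + (1 - q ^ m)) / ((1 - q ^ k) * F)"
    unfolding b F_def by (simp add: add_divide_distrib)
  also have "q ^ k * q ^ m * (1 - q ^ (k - m)) + (1 - q ^ m) = (1 - q ^ k) * (1 + q ^ k - q ^ m)"
    using pk by (simp add: algebra_simps)
  finally show "Qpoly (-1) q (int k) (int m) / qfact q k = (1 + q ^ k - q ^ m) / (qfact q m * qfact q (k - m))"
    using nq by (simp add: F_def)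
qed

lemma coef_Qpoly:
  assumes q: "nonroot q" and km: "m \<le> k" "k > 0"
  shows "(-1) powi ((1 - (-1) ^ \<alpha>) div 2 * int k) * (-1) ^ (k - m) * q powi Delta \<alpha> (int k) (int m) *
    (Qpoly ((-1) ^ \<alpha>) q (int k) (int m) / qfact q k) = coef q \<alpha> k m"
proof (cases "even \<alpha>")
  case True
  have "nat (int k - int m) = k - m" by simp
  then show ?thesis using True Qpoly_over_qfact(1)[OF assms]
    by (simp add: Delta_def coef_def seed_def power_int_of_nat km mult_ac)
next
  case False
  have "(-1) ^ k * (-1) ^ (k - m) = (-1 :: 'a) ^ m"
  proof -
    obtain j where "k = m + j" using km le_Suc_ex by blast
    then show ?thesis by (simp add: power_add flip: power_mult_distrib)
  qed
  then show ?thesis using False Qpoly_over_qfact(2)[OF assms]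
    by (simp add: Delta_def coef_def seed_def power_int_of_nat km)
qed

text \<open>With \<open>m\<close> replaced by \<open>k - m\<close> in \<open>L\<^sub>k\<close>, the exponent of \<open>q\<close> other than \<open>\<Delta>\<^sub>\<alpha>\<close> factorises as
  \<open>(y\<^bsub>\<alpha>+1\<^esub> k + y\<^sub>\<alpha> m) (z\<^sub>\<alpha> k + z\<^bsub>\<alpha>-1\<^esub> m)\<close>.\<close>

lemma bosonic_term:
  assumes q: "nonroot q" and k: "k > 0"
  shows "(-1) powi ((1 - (-1) ^ \<alpha>) div 2 * int k) *
      q powi ((int k)\<^sup>2 * (int (yseq \<nu> (int \<alpha> + 1)) + int (yseq \<nu> (int \<alpha>))) *
        (int (zseq \<nu> (int \<alpha>)) + int (zseq \<nu> (int \<alpha> - 1)))) * (Lser \<nu> \<alpha> q k / qfact q k) =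
    (\<Sum>m\<le>k. coef q \<alpha> k m * q ^ (zval \<nu> \<alpha> k m * yval \<nu> \<alpha> k m))"
proof -
  have q0: "q \<noteq> 0" using q by (simp add: nonroot_def)
  define y1 y0 z1 z0 where "y1 = int (yseq \<nu> (int \<alpha> + 1))" "y0 = int (yseq \<nu> (int \<alpha>))"
    "z1 = int (zseq \<nu> (int \<alpha>))" "z0 = int (zseq \<nu> (int \<alpha> - 1))"
  note defs = this
  define E where "E m = (int m)\<^sup>2 * y0 * z0 - int k * int m * (y1 * z0 + 2 * y0 * z0 + y0 * z1)" for m
  define K where "K = (int k)\<^sup>2 * (y1 + y0) * (z1 + z0)"
  define s :: 'a where "s = (-1) powi ((1 - (-1) ^ \<alpha>) div 2 * int k)"
  define g where "g m = (-1) ^ m * q powi (E m + Delta \<alpha> (int k) (int k - int m)) *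
        Qpoly ((-1) ^ \<alpha>) q (int k) (int k - int m)" for m
  have "Lser \<nu> \<alpha> q k = (\<Sum>m\<le>k. g m)"
    unfolding Lser_def Let_def g_def E_def defs ..
  also have "\<dots> = (\<Sum>m\<le>k. g (k - m))"
    by (rule sum.reindex_bij_witness[of _ "\<lambda>m. k - m" "\<lambda>m. k - m"]) auto
  finally have L: "Lser \<nu> \<alpha> q k = (\<Sum>m\<le>k. g (k - m))" .
  have "s * q powi K * (g (k - m) / qfact q k) = coef q \<alpha> k m * q ^ (zval \<nu> \<alpha> k m * yval \<nu> \<alpha> k m)"
    if m: "m \<le> k" for m
  proof -
    have km: "int k - int (k - m) = int m" using m by simp
    have "K + E (k - m) = int (zval \<nu> \<alpha> k m * yval \<nu> \<alpha> k m)"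
      unfolding of_nat_mult yval_int K_def E_def of_nat_diff[OF m] defs[symmetric]
      by (simp add: algebra_simps power2_eq_square)
    then have ex: "q powi K * q powi (E (k - m)) = q ^ (zval \<nu> \<alpha> k m * yval \<nu> \<alpha> k m)"
      using q0 by (simp only: power_int_add[symmetric] power_int_of_nat simp_thms)
    have "s * q powi K * (g (k - m) / qfact q k) = (q powi K * q powi (E (k - m))) *
      (s * (-1) ^ (k - m) * q powi Delta \<alpha> (int k) (int m) * (Qpoly ((-1) ^ \<alpha>) q (int k) (int m) / qfact q k))"
      unfolding g_def km using q0 by (simp add: power_int_add)
    then show ?thesis unfolding ex s_def coef_Qpoly[OF q m k] by (simp add: mult.commute)
  qed
  then have "(\<Sum>m\<le>k. s * q powi K * (g (k - m) / qfact q k)) = 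
      (\<Sum>m\<le>k. coef q \<alpha> k m * q ^ (zval \<nu> \<alpha> k m * yval \<nu> \<alpha> k m))" by (intro sum.cong) auto
  then show ?thesis
    unfolding L s_def K_def defs by (simp add: sum_distrib_left sum_divide_distrib)
qed

text \<open>The two rational powers of \<open>q\<close> combine to the power given by the energy, which is an integer.\<close>

lemma fermionic_term:
  assumes pos: "\<forall>i\<le>\<alpha>. \<nu> i \<ge> 1"
  shows "qpow \<nu> \<alpha> ((of_nat l)\<^sup>2 / cfrac \<nu> \<alpha>) * Vser \<nu> \<alpha> l =
    (\<Sum>lam\<in>lam_set \<nu> \<alpha> l. weight (qvar \<nu> \<alpha>) \<nu> \<alpha> lam)"
  unfolding Vser_def sum_distrib_left
proof (rule sum.cong[OF refl])
  fix lam assume lam: "lam \<in> lam_set \<nu> \<alpha> l"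
  let ?Y = "yseq \<nu> (int \<alpha> + 1)"
  have l: "lform \<nu> \<alpha> lam = l" using lam by (simp add: lam_set_eq)
  obtain e where e: "energy \<nu> \<alpha> (\<lambda>j. of_nat (lam j)) = of_int e"
    using energy_Ints[OF pos] Ints_cases by metis
  obtain a where a: "of_nat ?Y * ((of_nat l)\<^sup>2 / cfrac \<nu> \<alpha>) = (of_int a :: rat)"
    using scaled_square_in_Ints[OF pos] Ints_cases by metis
  obtain b where b: "of_nat ?Y * (1 / 2 * Bform \<nu> \<alpha> lam) = (of_int b :: rat)"
    using scaled_Bform_in_Ints[OF pos] Ints_cases by metis
  have "of_int (a + b) = (of_int (int ?Y * e) :: rat)"
    unfolding of_int_add a[symmetric] b[symmetric] of_int_mult e[symmetric] Bform_energy[OF pos, symmetric] l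
    by (simp add: distrib_left)
  then have ab: "a + b = int ?Y * e" by (simp only: of_int_eq_iff)
  have "qpow \<nu> \<alpha> ((of_nat l)\<^sup>2 / cfrac \<nu> \<alpha>) * qpow \<nu> \<alpha> (1 / 2 * Bform \<nu> \<alpha> lam) = fls_X powi (a + b)"
    unfolding qpow_def a b floor_of_int by (rule power_int_add[symmetric]) simp
  also have "\<dots> = qvar \<nu> \<alpha> powi e" unfolding ab qvar_eq by (simp add: power_int_mult power_int_of_nat)
  finally show "qpow \<nu> \<alpha> ((of_nat l)\<^sup>2 / cfrac \<nu> \<alpha>) *
      (qpow \<nu> \<alpha> (1 / 2 * Bform \<nu> \<alpha> lam) /
       (\<Prod>j = 1..mseq \<nu> (\<alpha> + 1). qpoch (qvar \<nu> \<alpha> powi eps \<nu> \<alpha> j) (qvar \<nu> \<alpha> powi eps \<nu> \<alpha> j) (lam j))) =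
      weight (qvar \<nu> \<alpha>) \<nu> \<alpha> lam"
    unfolding weight_def e floor_of_int by simp
qed

theorem corollary2p4:
  fixes p0 :: rat and \<nu> :: "nat \<Rightarrow> nat" and \<alpha> :: nat
  assumes "p0 \<ge> 1"
    and "\<forall>i\<le>\<alpha>. \<nu> i \<ge> 1"
    and "\<alpha> > 0 \<longrightarrow> \<nu> \<alpha> \<ge> 2"
    and "p0 = cfrac \<nu> \<alpha>"
  shows
    "let q = qvar \<nu> \<alpha>;
         y = (\<lambda>i. int (yseq \<nu> i));
         z = (\<lambda>i. int (zseq \<nu> i));
         a = int \<alpha>;
         R = (\<lambda>k. (-1) powi ((1 - (-1) ^ \<alpha>) div 2 * int k) *
                  q powi ((int k)\<^sup>2 * (y (a + 1) + y a) * (z a + z (a - 1))) *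
                  (Lser \<nu> \<alpha> q k / qpoch q q k))
     in summable (\<lambda>k. R (Suc k)) \<and>
        (\<lambda>l. qpow \<nu> \<alpha> ((of_nat l)\<^sup>2 / p0) * Vser \<nu> \<alpha> l) sums (1 + (\<Sum>k. R (Suc k)))"
proof -
  note pos = assms(2)
  let ?Y = "yseq \<nu> (int \<alpha> + 1)"
  define q where "q = qvar \<nu> \<alpha>"
  have Y: "?Y > 0" by (rule yseq_last_pos[OF pos])
  have qX: "q = fls_X ^ ?Y" unfolding q_def by (rule qvar_eq)
  have q: "nonroot q" unfolding qX by (rule nonroot_X_power[OF Y])
  define t where "t k m = coef q \<alpha> k m * q ^ (zval \<nu> \<alpha> k m * yval \<nu> \<alpha> k m)" for k m
  have yk: "k \<le> yval \<nu> \<alpha> k m" for k m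
    using y_aux_pos[of "Suc \<alpha>" \<nu>] pos unfolding yval_def
    by (intro trans_le_add1) (auto simp del: y_aux.simps simp: less_Suc_eq_le)
  have zk: "k \<le> zval \<nu> \<alpha> k m" for k m
    using y_aux_pos[of \<alpha> "\<lambda>i. \<nu> (Suc i)"] pos unfolding zval_def z_aux_shift
    by (intro trans_le_add1) (auto simp del: y_aux.simps simp: Suc_le_eq)
  \<comment> \<open>The order in \<open>q\<close> is at least \<open>zval * yval\<close>, where \<open>zval \<ge> k\<close>; if \<open>k = 0\<close>, then \<open>yval = 0\<close>.\<close>
  have t: "vanishes_below (int (yval \<nu> \<alpha> k m)) (t k m)" if "m \<le> k" for k m
  proof -
    have c: "vanishes_below 0 (coef q \<alpha> k m)"
      unfolding coef_def qX using vanishes_below_seed[OF Y, where 'a = rat] by simp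
    have "vanishes_below (int (?Y * (zval \<nu> \<alpha> k m * yval \<nu> \<alpha> k m))) (t k m)"
      using vanishes_below_mult[OF c vanishes_below_X_power[of "?Y * (zval \<nu> \<alpha> k m * yval \<nu> \<alpha> k m)"]]
      unfolding t_def qX power_mult[symmetric] by (simp only: add_0_left)
    moreover have "yval \<nu> \<alpha> k m \<le> ?Y * (zval \<nu> \<alpha> k m * yval \<nu> \<alpha> k m)"
    proof (cases "k = 0")
      case True
      then show ?thesis using that by (simp add: yval_def)
    next
      case False
      then show ?thesis using zk[of k m] Y by simp
    qed
    ultimately show ?thesis using vanishes_below_mono of_nat_mono by blast
  qed
  obtain S where S: "(\<lambda>l. \<Sum>k\<le>l. \<Sum>m\<le>k. if yval \<nu> \<alpha> k m = l then t k m else 0) sums S"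
    "(\<lambda>k. \<Sum>m\<le>Suc k. t (Suc k) m) sums (S - t 0 0)"
    using regroup_sums[where h = "yval \<nu> \<alpha>", OF t yk] by blast
  have t0: "t 0 0 = 1" by (simp add: t_def coef_def seed_def zval_def yval_def numeral_2_eq_2)
  define R where "R k = (-1) powi ((1 - (-1) ^ \<alpha>) div 2 * int k) *
      q powi ((int k)\<^sup>2 * (int (yseq \<nu> (int \<alpha> + 1)) + int (yseq \<nu> (int \<alpha>))) *
        (int (zseq \<nu> (int \<alpha>)) + int (zseq \<nu> (int \<alpha> - 1)))) * (Lser \<nu> \<alpha> q k / qfact q k)" for k
  have "R (Suc k) = (\<Sum>m\<le>Suc k. t (Suc k) m)" for k
    unfolding R_def t_def by (rule bosonic_term[OF q]) simp
  then have R: "(\<lambda>k. R (Suc k)) sums (S - 1)" using S(2) unfolding t0 by simp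
  have "qpow \<nu> \<alpha> ((of_nat l)\<^sup>2 / p0) * Vser \<nu> \<alpha> l =
      (\<Sum>k\<le>l. \<Sum>m\<le>k. if yval \<nu> \<alpha> k m = l then t k m else 0)" for l
    unfolding assms(4) fermionic_term[OF pos] q_def[symmetric] weight_sum[OF pos q] t_def
    by (intro sum.cong refl) auto
  then have "(\<lambda>l. qpow \<nu> \<alpha> ((of_nat l)\<^sup>2 / p0) * Vser \<nu> \<alpha> l) sums (1 + (\<Sum>k. R (Suc k)))"
    using S(1) unfolding sums_unique[OF R, symmetric] by simp
  then show ?thesis
    using sums_summable[OF R] unfolding Let_def R_def q_def by blast
qed

end
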